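(* There exists an absolute constant $c>0$ (independent of $u$, $p$ and $\xi$) such that the following holds. Let $(u,p)$, with $u:\mathbb R^3\to\mathbb R^3$ and $p:\mathbb R^3\to\mathbb R$, be a smooth solution of the stationary Navier--Stokes equations $$-\Delta u+(u\cdot\nabla)u+\nabla p=0,\qquad \nabla\cdot u=0\qquad\text{in }\mathbb R^3,$$ satisfying $u(x)\to0$ as $|x|\to+\infty$ and $\int_{\mathbb R^3}|\nabla u|^2\,dx<+\infty$, with the pressure normalized by an additive constant so that $Q:=\frac12|u|^2+p$ satisfies $Q(x)\to0$ as $|x|\to+\infty$. Let $\xi:[0,+\infty)\to[0,+\infty)$ be a continuous nondecreasing function with $\xi(0)=0$, $\xi(s)>0$ for $s>0$, and $\int_0^1\frac{ds}{\xi(s)}=+\infty$. Suppose that either $$\liminf_{\lambda\to0^+}\left(\int_\lambda^1\frac{ds}{\xi(s)}\right)^{-1}\left\|\frac{|u_T|^2\,\Theta^2}{\xi(|Q|)}\right\|_{L^\infty(\{|Q|>\lambda\})}<1,$$ or $$\liminf_{\lambda\to0^+}\left(\int_\lambda^1\frac{ds}{\xi(s)}\right)^{-1}\left\|\frac{|\omega_T|^2\,\Theta^2}{\xi(|Q|)}\right\|_{L^{3/2}(\{|Q|>\lambda\})}<c.$$ Then $u\equiv0$.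
   Context: Notation. For the smooth solution $(u,p)$, $\omega:=\nabla\times u$ is the vorticity and $Q:=\frac12|u|^2+p$ is the head pressure. Under the decay condition $u\to0$ at infinity and $\int_{\mathbb R^3}|\nabla u|^2\,dx<+\infty$, it is known that $Q$ has a finite limit at infinity; the pressure is normalized by subtracting a constant so that this limit is $0$. On $\{|\nabla Q|>0\}$ set $$n_Q:=\frac{\nabla Q}{|\nabla Q|},\qquad u_T:=u-(u\cdot n_Q)n_Q,\qquad \omega_T:=\omega-(\omega\cdot n_Q)n_Q,$$ and on $\{|\nabla Q|=0\}$ set $n_Q=u_T=\omega_T=0$. The tangential angular factor is $$\Theta:=\frac{(u_T\times\omega_T)\cdot n_Q}{|u_T|\,|\omega_T|}\ \text{ on }\{|u_T|\,|\omega_T|\,|\nabla Q|>0\},\qquad \Theta:=0\ \text{ on }\{|u_T|\,|\omega_T|\,|\nabla Q|=0\}.$$ Here $\{|Q|>\lambda\}=\{x\in\mathbb R^3:|Q(x)|>\lambda\}$, and norms over this set are with respect to Lebesgue measure (the norm over the empty set is $0$). *)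

theory Defs
  imports "HOL-Analysis.Analysis" "HOL-Probability.Essential_Supremum"
begin

unbundle cross3_syntax

subsection \<open>Differential operators\<close>

definition partial :: "'n::finite \<Rightarrow> (real^'n \<Rightarrow> 'b::real_normed_vector) \<Rightarrow> real^'n \<Rightarrow> 'b"
  where "partial i f x = frechet_derivative f (at x) (axis i 1)"

text \<open>\<open>C_diff k f\<close> says that \<open>f\<close> is of class \<open>C\<^sup>k\<close> on the whole space. Frechet differentiability is required
  at each step, so no derivative below is evaluated where it does not exist.\<close>

primrec C_diff :: "nat \<Rightarrow> (real^'n \<Rightarrow> 'b::real_normed_vector) \<Rightarrow> bool" where
  "C_diff 0 f \<longleftrightarrow> continuous_on UNIV f"
| "C_diff (Suc k) f \<longleftrightarrow> f differentiable_on UNIV \<and> (\<forall>i. C_diff k (partial i f))"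

definition smooth :: "(real^'n \<Rightarrow> 'b::real_normed_vector) \<Rightarrow> bool"
  where "smooth f \<longleftrightarrow> (\<forall>k. C_diff k f)"

definition gradient :: "(real^'n \<Rightarrow> real) \<Rightarrow> real^'n \<Rightarrow> real^'n"
  where "gradient f x = (\<chi> i. partial i f x)"

definition laplacian :: "(real^'n \<Rightarrow> 'b::real_normed_vector) \<Rightarrow> real^'n \<Rightarrow> 'b"
  where "laplacian f x = (\<Sum>i\<in>UNIV. partial i (partial i f) x)"

definition divergence :: "(real^'n \<Rightarrow> real^'n) \<Rightarrow> real^'n \<Rightarrow> real"
  where "divergence v x = (\<Sum>i\<in>UNIV. partial i v x $ i)"

text \<open>\<open>convection v w\<close> is \<open>(v \<cdot> \<nabla>) w\<close>.\<close>

definition convection ::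
    "(real^'n \<Rightarrow> real^'n) \<Rightarrow> (real^'n \<Rightarrow> 'b::real_normed_vector) \<Rightarrow> real^'n \<Rightarrow> 'b"
  where "convection v w x = (\<Sum>j\<in>UNIV. (v x $ j) *\<^sub>R partial j w x)"

definition curl :: "(real^3 \<Rightarrow> real^3) \<Rightarrow> real^3 \<Rightarrow> real^3"
  where "curl v x = vector [partial 2 v x $ 3 - partial 3 v x $ 2,
                            partial 3 v x $ 1 - partial 1 v x $ 3,
                            partial 1 v x $ 2 - partial 2 v x $ 1]"

text \<open>The squared Frobenius norm of the Jacobian matrix.\<close>

definition grad_norm_sq :: "(real^'n \<Rightarrow> 'b::real_normed_vector) \<Rightarrow> real^'n \<Rightarrow> real"
  where "grad_norm_sq v x = (\<Sum>j\<in>UNIV. (norm (partial j v x))\<^sup>2)"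


subsection \<open>Stationary Navier--Stokes equations\<close>

definition smooth_stationary_NS :: "(real^3 \<Rightarrow> real^3) \<Rightarrow> (real^3 \<Rightarrow> real) \<Rightarrow> bool"
  where "smooth_stationary_NS u p \<longleftrightarrow> smooth u \<and> smooth p \<and>
    (\<forall>x. - laplacian u x + convection u u x + gradient p x = 0) \<and>
    (\<forall>x. divergence u x = 0)"

definition head_pressure :: "(real^3 \<Rightarrow> real^3) \<Rightarrow> (real^3 \<Rightarrow> real) \<Rightarrow> real^3 \<Rightarrow> real"
  where "head_pressure u p x = (1/2) * (norm (u x))\<^sup>2 + p x"

text \<open>In the following two definitions \<open>q\<close> plays the role of the head pressure.\<close>

definition normal_dir :: "(real^3 \<Rightarrow> real) \<Rightarrow> real^3 \<Rightarrow> real^3"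
  where "normal_dir q x =
    (if norm (gradient q x) > 0 then gradient q x /\<^sub>R norm (gradient q x) else 0)"

definition tangential :: "(real^3 \<Rightarrow> real) \<Rightarrow> (real^3 \<Rightarrow> real^3) \<Rightarrow> real^3 \<Rightarrow> real^3"
  where "tangential q v x =
    (if norm (gradient q x) > 0 then v x - (v x \<bullet> normal_dir q x) *\<^sub>R normal_dir q x else 0)"

definition u_tan :: "(real^3 \<Rightarrow> real^3) \<Rightarrow> (real^3 \<Rightarrow> real) \<Rightarrow> real^3 \<Rightarrow> real^3"
  where "u_tan u p = tangential (head_pressure u p) u"

definition vort_tan :: "(real^3 \<Rightarrow> real^3) \<Rightarrow> (real^3 \<Rightarrow> real) \<Rightarrow> real^3 \<Rightarrow> real^3"
  where "vort_tan u p = tangential (head_pressure u p) (curl u)"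

definition tan_angle :: "(real^3 \<Rightarrow> real^3) \<Rightarrow> (real^3 \<Rightarrow> real) \<Rightarrow> real^3 \<Rightarrow> real"
  where "tan_angle u p x =
    (if norm (u_tan u p x) * norm (vort_tan u p x) * norm (gradient (head_pressure u p) x) > 0
     then ((u_tan u p x \<times> vort_tan u p x) \<bullet> normal_dir (head_pressure u p) x)
            / (norm (u_tan u p x) * norm (vort_tan u p x))
     else 0)"

definition superlevel :: "(real^3 \<Rightarrow> real^3) \<Rightarrow> (real^3 \<Rightarrow> real) \<Rightarrow> real \<Rightarrow> (real^3) set"
  where "superlevel u p l = {x. \<bar>head_pressure u p x\<bar> > l}"


subsection \<open>Lebesgue norms with values in the extended nonnegative reals\<close>

text \<open>The real power of an extended nonnegative real, meant for positive exponents.\<close>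

definition ennpowr :: "ennreal \<Rightarrow> real \<Rightarrow> ennreal"
  where "ennpowr a r = (if a = \<infinity> then \<infinity> else ennreal (enn2real a powr r))"

definition Lp_norm :: "real \<Rightarrow> 'a::euclidean_space set \<Rightarrow> ('a \<Rightarrow> real) \<Rightarrow> ennreal"
  where "Lp_norm r S f = ennpowr (\<integral>\<^sup>+x. ennreal (\<bar>f x\<bar> powr r) \<partial>(lebesgue_on S)) (1 / r)"

text \<open>The values of \<open>esssup\<close> are taken in \<open>ennreal\<close>, where the least element is \<open>0\<close>; hence the norm
  over the empty set is \<open>0\<close>.\<close>

definition Linf_norm :: "'a::euclidean_space set \<Rightarrow> ('a \<Rightarrow> real) \<Rightarrow> ennreal"
  where "Linf_norm S f = esssup (lebesgue_on S) (\<lambda>x. ennreal \<bar>f x\<bar>)"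


subsection \<open>Moduli\<close>

text \<open>\<open>\<integral>\<^sub>l\<^sup>1 ds / \<xi>(s)\<close>. For \<open>l = 0\<close> the integrand takes the junk value \<open>1 / 0 = 0\<close> at the single point
  \<open>0\<close>, which does not affect the integral.\<close>

definition recip_integral :: "(real \<Rightarrow> real) \<Rightarrow> real \<Rightarrow> ennreal"
  where "recip_integral \<xi> l = (\<integral>\<^sup>+s\<in>{l..1}. ennreal (1 / \<xi> s) \<partial>lborel)"

text \<open>A function on \<open>[0, \<infinity>)\<close> is encoded as a function on the reals whose values at negative arguments
  are ignored.\<close>

definition admissible_modulus :: "(real \<Rightarrow> real) \<Rightarrow> bool"
  where "admissible_modulus \<xi> \<longleftrightarrow> continuous_on {0..} \<xi> \<and> mono_on {0..} \<xi> \<and>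
    \<xi> 0 = 0 \<and> (\<forall>s>0. \<xi> s > 0) \<and> recip_integral \<xi> 0 = \<infinity>"

end

(* Write Q = |u|^2/2 + p. The equations give grad Q = Laplace u + u x omega and
   Laplace Q - u . grad Q = |omega|^2. Testing with functions of Q, which have compact support when they
   vanish near 0, yields Q <= 0 and, for g' = h supported in {s > lambda},
     int |omega|^2 g(|Q|) = int h(|Q|) |grad Q|^2 = int h(|Q|) grad Q . (u x omega)
                          <= int h(|Q|) |u_T|^2 |omega_T|^2 Theta^2.
   With h close to 1/xi and I = int_lambda^1 1/xi, the ratio g(|Q|)/I tends to 1 on {Q < 0} as lambda -> 0,
   and omega = 0 on {Q = 0} since Q is maximal there. Hence int |omega|^2 <= theta int |omega|^2 with
   theta < 1: in the first case directly, in the second by Hoelder, the Sobolev inequality and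
   int_{u /= 0} |grad u|^2 <= int |omega|^2. So omega = 0, and the last inequality gives u = 0. *)

theory Submission
  imports Defs
begin

text \<open>The obstacle: far out, only u, Q -> 0 and a finite Dirichlet integral are known, so
  cut-offs in x leave flux terms without evident control. Cut-offs in the values of Q or |u|^2 have
  bounded support by decay alone, and every integration by parts is exact. The inequality in the
  display is an absorption. With S = ((u x omega) . n_Q)^2, grad Q . (u x omega) <= |grad Q|^2 / 2 +
  S / 2, and half of the left side is moved over; the resulting constant 1 is the threshold of the
  first criterion. S equals |u_T|^2 |omega_T|^2 Theta^2 because subtracting multiples of n_Q from u
  and omega does not change (u x omega) . n_Q. Divergence of the integral of 1/\<xi> enters as
  follows: on {|Q| > m} with m fixed, g(|Q|) falls short of I by at most the integral of 1/\<xi>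
  over [m, 1] plus 1, which is negligible as I tends to infinity. The set {u /= 0} appears because
  the cut-offs in |u|^2 converge to its indicator; the Sobolev inequality, proved with truncations
  of |u_j|, also sees the gradient only where u_j /= 0. Its constant 16 gives c = 1/16.\<close>

subsection \<open>Calculus of partial derivatives\<close>

lemma partial_eqI: "(f has_derivative f') (at x) \<Longrightarrow> partial i f x = f' (axis i 1)"
  unfolding partial_def by (metis frechet_derivative_at)

lemma differentiable_has_derivative:
  "f differentiable (at x) \<Longrightarrow> (f has_derivative frechet_derivative f (at x)) (at x)"
  by (simp add: frechet_derivative_works)

lemma partial_const [simp]: "partial i (\<lambda>x. c) = (\<lambda>x. 0)"
proof
  fix x show "partial i (\<lambda>x. c) x = 0"
    by (rule partial_eqI[where f'="\<lambda>_. 0"]) simp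
qed

lemma partial_add:
  assumes "f differentiable (at x)" "g differentiable (at x)"
  shows "partial i (\<lambda>x. f x + g x) x = partial i f x + partial i g x"
  unfolding partial_def[of i f] partial_def[of i g]
  by (rule partial_eqI[OF has_derivative_add[OF assms[THEN differentiable_has_derivative]]])

lemma partial_diff:
  assumes "f differentiable (at x)" "g differentiable (at x)"
  shows "partial i (\<lambda>x. f x - g x) x = partial i f x - partial i g x"
  unfolding partial_def[of i f] partial_def[of i g]
  by (rule partial_eqI[OF has_derivative_diff[OF assms[THEN differentiable_has_derivative]]])

lemma partial_mult:
  fixes f g :: "real^'n \<Rightarrow> real"
  assumes "f differentiable (at x)" "g differentiable (at x)"
  shows "partial i (\<lambda>x. f x * g x) x = f x * partial i g x + partial i f x * g x"
  unfolding partial_def[of i f] partial_def[of i g]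
  by (rule partial_eqI[OF has_derivative_mult[OF assms[THEN differentiable_has_derivative]]])

lemma partial_sum:
  assumes "\<And>j. j \<in> J \<Longrightarrow> f j differentiable (at x)"
  shows "partial i (\<lambda>x. \<Sum>j\<in>J. f j x) x = (\<Sum>j\<in>J. partial i (f j) x)"
  unfolding partial_def[of i "f _"]
  by (rule partial_eqI[OF has_derivative_sum]) (use assms differentiable_has_derivative in blast)

lemma partial_component:
  assumes "f differentiable (at x)"
  shows "partial i (\<lambda>x. f x $ j) x = partial i f x $ j"
  unfolding partial_def[of i f]
  by (rule partial_eqI[OF bounded_linear.has_derivative[OF bounded_linear_vec_nth
        differentiable_has_derivative[OF assms]]])

lemma partial_compose:
  fixes f :: "real^'n \<Rightarrow> real"
  assumes "f differentiable (at x)" "(\<phi> has_real_derivative d) (at (f x))"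
  shows "partial i (\<lambda>x. \<phi> (f x)) x = d * partial i f x"
proof -
  have "(\<phi> has_derivative (*) d) (at (f x))"
    using assms(2) by (simp add: has_field_derivative_def)
  from has_derivative_compose[OF differentiable_has_derivative[OF assms(1)] this]
  show ?thesis unfolding partial_def[of i f] by (subst partial_eqI) (auto simp: mult.commute)
qed

lemma differentiable_compose_real:
  fixes f :: "real^'n \<Rightarrow> real"
  assumes "f differentiable (at x)" "(\<phi> has_real_derivative d) (at (f x))"
  shows "(\<lambda>x. \<phi> (f x)) differentiable (at x)"
proof -
  have "(\<phi> has_derivative (*) d) (at (f x))"
    using assms(2) by (simp add: has_field_derivative_def)
  from has_derivative_compose[OF differentiable_has_derivative[OF assms(1)] this]
  show ?thesis by (auto simp: differentiable_def)
qed

lemma differentiable_component: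
  assumes "f differentiable (at x)"
  shows "(\<lambda>x. f x $ j) differentiable (at x)"
  using bounded_linear.has_derivative[OF bounded_linear_vec_nth differentiable_has_derivative[OF assms]]
  by (auto simp: differentiable_def)

section \<open>Closure properties of the classes C^k and of smooth functions\<close>

lemma C_diff_Suc_iff:
  "C_diff (Suc k) f \<longleftrightarrow> (\<forall>x. f differentiable (at x)) \<and> (\<forall>i. C_diff k (partial i f))"
  by (simp add: differentiable_on_def)

lemma C_diff_antimono: "C_diff (Suc k) f \<Longrightarrow> C_diff k f"
proof (induction k arbitrary: f)
  case 0 then show ?case by (simp add: differentiable_imp_continuous_on)
next
  case (Suc k) then show ?case by (metis C_diff_Suc_iff)
qed

lemma C_diff_const: "C_diff k (\<lambda>x. c)"
  by (induction k arbitrary: c) auto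

lemma C_diff_add: "C_diff k f \<Longrightarrow> C_diff k g \<Longrightarrow> C_diff k (\<lambda>x. f x + g x)"
proof (induction k arbitrary: f g)
  case 0 then show ?case by (auto intro: continuous_intros)
next
  case (Suc k)
  have "partial i (\<lambda>x. f x + g x) = (\<lambda>x. partial i f x + partial i g x)" for i
    using Suc.prems unfolding C_diff_Suc_iff by (auto intro!: partial_add)
  with Suc show ?case unfolding C_diff_Suc_iff by (auto intro!: differentiable_add)
qed

lemma C_diff_mult:
  fixes f g :: "real^'n \<Rightarrow> real"
  shows "C_diff k f \<Longrightarrow> C_diff k g \<Longrightarrow> C_diff k (\<lambda>x. f x * g x)"
proof (induction k arbitrary: f g)
  case 0 then show ?case by (auto intro: continuous_intros)
next
  case (Suc k)
  have "partial i (\<lambda>x. f x * g x) = (\<lambda>x. f x * partial i g x + partial i f x * g x)" for i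
    using Suc.prems unfolding C_diff_Suc_iff by (auto intro!: partial_mult)
  moreover have "C_diff k f" "C_diff k g" using Suc.prems C_diff_antimono by blast+
  ultimately show ?case using Suc unfolding C_diff_Suc_iff 
    by (auto intro!: differentiable_mult C_diff_add)
qed

lemma C_diff_component: "C_diff k f \<Longrightarrow> C_diff k (\<lambda>x. f x $ j)"
proof (induction k arbitrary: f)
  case 0 then show ?case by (auto intro: continuous_intros)
next
  case (Suc k)
  have "partial i (\<lambda>x. f x $ j) = (\<lambda>x. partial i f x $ j)" for i
    using Suc.prems unfolding C_diff_Suc_iff by (auto intro!: partial_component)
  with Suc show ?case unfolding C_diff_Suc_iff by (auto intro!: differentiable_component)
qed

lemma smooth_const [intro, simp]: "smooth (\<lambda>x. c)"
  by (simp add: smooth_def C_diff_const)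

lemma smooth_add [intro]: "smooth f \<Longrightarrow> smooth g \<Longrightarrow> smooth (\<lambda>x. f x + g x)"
  by (simp add: smooth_def C_diff_add)

lemma smooth_mult [intro]:
  fixes f g :: "real^'n \<Rightarrow> real"
  shows "smooth f \<Longrightarrow> smooth g \<Longrightarrow> smooth (\<lambda>x. f x * g x)"
  by (simp add: smooth_def C_diff_mult)

lemma smooth_diff [intro]:
  fixes f g :: "real^'n \<Rightarrow> real"
  assumes "smooth f" "smooth g" shows "smooth (\<lambda>x. f x - g x)"
  using smooth_add[OF assms(1) smooth_mult[OF smooth_const[of "-1"] assms(2)]] by simp

lemma smooth_sum [intro]:
  "(\<And>j. j \<in> J \<Longrightarrow> smooth (f j)) \<Longrightarrow> smooth (\<lambda>x. \<Sum>j\<in>J. f j x)"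
  by (induction J rule: infinite_finite_induct) auto

lemma smooth_component [intro]: "smooth f \<Longrightarrow> smooth (\<lambda>x. f x $ j)"
  by (simp add: smooth_def C_diff_component)

lemma smooth_partial [intro]: "smooth f \<Longrightarrow> smooth (partial i f)"
  unfolding smooth_def by (metis C_diff.simps(2))

lemma smooth_differentiable: "smooth f \<Longrightarrow> f differentiable (at x)"
  unfolding smooth_def by (metis C_diff_Suc_iff)

lemma smooth_continuous: "smooth f \<Longrightarrow> continuous_on S f"
  unfolding smooth_def by (metis C_diff.simps(1) continuous_on_subset subset_UNIV)

text \<open>Bridge to one-variable calculus: the mean value theorem, the fundamental theorem and the
  test for maxima are all applied along coordinate lines through it.\<close>

lemma has_real_derivative_along_axis:
  fixes f :: "real^'n \<Rightarrow> real"
  assumes "f differentiable (at (a + s *\<^sub>R axis i 1))"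
  shows "((\<lambda>s. f (a + s *\<^sub>R axis i 1)) has_real_derivative partial i f (a + s *\<^sub>R axis i 1)) (at s)"
proof -
  let ?D = "frechet_derivative f (at (a + s *\<^sub>R axis i 1))"
  have 1: "((\<lambda>s. a + s *\<^sub>R axis i 1) has_derivative (\<lambda>t. t *\<^sub>R axis i 1)) (at s)"
    by (auto intro!: derivative_eq_intros)
  have 2: "((\<lambda>s. f (a + s *\<^sub>R axis i 1)) has_derivative (\<lambda>t. ?D (t *\<^sub>R axis i 1))) (at s)"
    using has_derivative_compose[OF 1 differentiable_has_derivative[OF assms]] .
  have "linear ?D"
    using differentiable_has_derivative[OF assms] has_derivative_linear by blast
  then have "?D (t *\<^sub>R axis i 1) = partial i f (a + s *\<^sub>R axis i 1) * t" for t
    by (simp add: partial_def linear_scale mult.commute)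
  then show ?thesis using 2 by (simp add: has_field_derivative_def)
qed

text \<open>The mean value theorem in direction i, applied to a difference in direction j, and then
  once more in direction j. The second difference on the left is symmetric in i and j, while the
  mixed partial on the right is not yet known to be.\<close>

lemma second_difference_mean_value:
  fixes f :: "real^'n \<Rightarrow> real"
  assumes f: "\<And>x. f differentiable (at x)" and fi: "\<And>x. partial i f differentiable (at x)" and h: "h > 0"
  shows "\<exists>y. dist y x \<le> 2 * h \<and>
    f (x + h *\<^sub>R axis i 1 + h *\<^sub>R axis j 1) - f (x + h *\<^sub>R axis i 1) - f (x + h *\<^sub>R axis j 1) + f x
      = h\<^sup>2 * partial j (partial i f) y"
proof -
  define G where "G s = f ((x + h *\<^sub>R axis j 1) + s *\<^sub>R axis i 1) - f (x + s *\<^sub>R axis i 1)" for s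
  have G: "(G has_real_derivative
      partial i f ((x + h *\<^sub>R axis j 1) + s *\<^sub>R axis i 1) - partial i f (x + s *\<^sub>R axis i 1)) (at s)" for s
    unfolding G_def by (intro DERIV_diff has_real_derivative_along_axis f)
  obtain s where s: "0 < s" "s < h" "G h - G 0 = (h - 0) *
      (partial i f ((x + h *\<^sub>R axis j 1) + s *\<^sub>R axis i 1) - partial i f (x + s *\<^sub>R axis i 1))"
    using MVT2[OF h G] by blast
  obtain t where t: "0 < t" "t < h"
    "partial i f ((x + s *\<^sub>R axis i 1) + h *\<^sub>R axis j 1) - partial i f ((x + s *\<^sub>R axis i 1) + 0 *\<^sub>R axis j 1)
     = (h - 0) * partial j (partial i f) ((x + s *\<^sub>R axis i 1) + t *\<^sub>R axis j 1)"
    using MVT2[OF h has_real_derivative_along_axis[OF fi]] by blast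
  let ?y = "(x + s *\<^sub>R axis i 1) + t *\<^sub>R axis j 1"
  have "dist ?y x = norm (s *\<^sub>R axis i 1 + t *\<^sub>R axis j 1 :: real^'n)"
    by (simp add: dist_norm)
  also have "\<dots> \<le> norm (s *\<^sub>R axis i 1 :: real^'n) + norm (t *\<^sub>R axis j 1 :: real^'n)"
    by (rule norm_triangle_ineq)
  also have "\<dots> \<le> 2 * h" using s t by simp
  finally have "dist ?y x \<le> 2 * h" .
  moreover have "f (x + h *\<^sub>R axis i 1 + h *\<^sub>R axis j 1) - f (x + h *\<^sub>R axis i 1) - f (x + h *\<^sub>R axis j 1) + f x
      = G h - G 0"
    unfolding G_def by (simp add: algebra_simps)
  moreover have "\<dots> = h\<^sup>2 * partial j (partial i f) ?y"
    using s(3) t(3) by (simp add: algebra_simps power2_eq_square)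
  ultimately show ?thesis by metis
qed

text \<open>By symmetry of the second difference, both mixed partials take one common value at
  points arbitrarily close to x; continuity forces them to agree at x.\<close>

lemma partial_commute:
  fixes f :: "real^'n \<Rightarrow> real"
  assumes f: "smooth f"
  shows "partial i (partial j f) x = partial j (partial i f) x"
proof (rule ccontr)
  let ?A = "partial i (partial j f)" and ?B = "partial j (partial i f)"
  assume ne: "?A x \<noteq> ?B x"
  define e where "e = \<bar>?A x - ?B x\<bar> / 2"
  have e: "e > 0" using ne by (simp add: e_def)
  have cont: "continuous (at x) (partial k (partial l f))" for k l
    using smooth_continuous[OF smooth_partial[OF smooth_partial[OF f]], of UNIV k l]
    by (simp add: continuous_on_eq_continuous_at)
  obtain d1 where d1: "d1 > 0" "\<And>y. dist y x < d1 \<Longrightarrow> \<bar>?A y - ?A x\<bar> < e"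
    using cont[of i j] e unfolding continuous_at_eps_delta dist_real_def by blast
  obtain d2 where d2: "d2 > 0" "\<And>y. dist y x < d2 \<Longrightarrow> \<bar>?B y - ?B x\<bar> < e"
    using cont[of j i] e unfolding continuous_at_eps_delta dist_real_def by blast
  note d = d1(1) d2(1) d1(2) d2(2)
  \<comment> \<open>A third of the minimum, since the intermediate points lie within 2h of
    x.\<close>
  define h where "h = min d1 d2 / 3"
  have h: "h > 0" "2 * h < d1" "2 * h < d2" using d by (auto simp: h_def)
  note sm = smooth_differentiable[OF f] smooth_differentiable[OF smooth_partial[OF f]]
  obtain y where y: "dist y x \<le> 2 * h" "f (x + h *\<^sub>R axis i 1 + h *\<^sub>R axis j 1) - f (x + h *\<^sub>R axis i 1) - f (x + h *\<^sub>R axis j 1) + f x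
      = h\<^sup>2 * ?B y" using second_difference_mean_value[OF sm h(1)] by blast
  obtain z where z: "dist z x \<le> 2 * h" "f (x + h *\<^sub>R axis j 1 + h *\<^sub>R axis i 1) - f (x + h *\<^sub>R axis j 1) - f (x + h *\<^sub>R axis i 1) + f x
      = h\<^sup>2 * ?A z" using second_difference_mean_value[OF sm h(1)] by blast
  have "h\<^sup>2 * ?B y = h\<^sup>2 * ?A z" using y(2) z(2) by (simp add: algebra_simps)
  then have "?B y = ?A z" using h by simp
  moreover have "\<bar>?A z - ?A x\<bar> < e" "\<bar>?B y - ?B x\<bar> < e"
    using d y z h by (meson order_le_less_trans)+
  ultimately show False unfolding e_def by (auto simp: abs_if split: if_splits)
qed

subsection \<open>Integration by parts\<close>

text \<open>A linear map that vanishes on the axis vectors is zero. Together with decay at infinity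
  this gives the vanishing of \<open>\<phi> (Q x)\<close> and of |u|^2 later on.\<close>

lemma zero_partials_imp_constant:
  fixes f :: "real^'n \<Rightarrow> real"
  assumes f: "\<And>x. f differentiable (at x)" and 0: "\<And>i x. partial i f x = 0"
  shows "f x = f y"
proof -
  have "(f has_derivative (\<lambda>_. 0)) (at x)" for x
  proof -
    let ?D = "frechet_derivative f (at x)"
    have D: "(f has_derivative ?D) (at x)" using f by (rule differentiable_has_derivative)
    then have lin: "linear ?D" by (rule has_derivative_linear)
    have "?D v = 0" for v
    proof -
      have "?D v = ?D (\<Sum>i\<in>UNIV. v $ i *s axis i 1)" by (simp add: basis_expansion)
      also have "\<dots> = (\<Sum>i\<in>UNIV. v $ i * ?D (axis i 1))"
        using lin by (simp add: linear_sum linear_scale scalar_mult_eq_scaleR)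
      finally show ?thesis using 0 by (simp add: partial_def)
    qed
    then show ?thesis using D by (simp add: ext[of ?D "\<lambda>_. 0"])
  qed
  then show ?thesis
    using has_derivative_zero_constant[of UNIV f] by (metis UNIV_I convex_UNIV)
qed

lemma continuous_bounded_support_integrable:
  fixes f :: "'a::euclidean_space \<Rightarrow> real"
  assumes "continuous_on UNIV f" "\<And>x. f x \<noteq> 0 \<Longrightarrow> norm x \<le> R"
  shows "integrable lborel f"
proof -
  have "integrable lborel (\<lambda>x. indicator (cball 0 R) x *\<^sub>R f x)"
    by (intro borel_integrable_compact compact_cball continuous_on_subset[OF assms(1)]) simp
  moreover have "(\<lambda>x. indicator (cball 0 R) x *\<^sub>R f x) = f"
    using assms(2) by (auto simp: indicator_def fun_eq_iff)
  ultimately show ?thesis by simp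
qed

lemma lborel_integral_translate:
  fixes f :: "'a::euclidean_space \<Rightarrow> real"
  assumes [measurable]: "f \<in> borel_measurable borel"
  shows "(\<integral>x. f (x + c) \<partial>lborel) = (\<integral>x. f x \<partial>lborel)"
proof -
  have "(\<integral>x. f x \<partial>lborel) = (\<integral>x. f x \<partial>(distr lborel borel ((+) c)))"
    by (simp add: lborel_distr_plus)
  also have "\<dots> = (\<integral>x. f (c + x) \<partial>lborel)"
    by (rule integral_distr) auto
  finally show ?thesis by (simp add: add.commute)
qed

lemma lborel_integrable_translate:
  fixes f :: "'a::euclidean_space \<Rightarrow> real"
  assumes "integrable lborel f"
  shows "integrable lborel (\<lambda>x. f (x + c))"
proof -
  have "integrable (distr lborel borel ((+) c)) f"
    using assms by (simp add: lborel_distr_plus)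
  then show ?thesis
    using integrable_distr_eq[of "(+) c" lborel borel f] borel_measurable_integrable[OF assms]
    by (simp add: add.commute)
qed

lemma partial_eq_0_outside:
  fixes F :: "real^'n \<Rightarrow> real"
  assumes "\<And>x. F x \<noteq> 0 \<Longrightarrow> norm x \<le> R" "norm x > R"
  shows "partial i F x = 0"
proof -
  have "(F has_derivative (\<lambda>_. 0)) (at x)"
  proof (rule has_derivative_transform_within_open[of "\<lambda>_. 0" _ x UNIV "{x. norm x > R}"])
    show "open {x::real^'n. norm x > R}" by (intro open_Collect_less continuous_intros)
  qed (use assms in force)+
  from partial_eqI[OF this] show ?thesis by simp
qed

lemma difference_quotient_along_axis:
  fixes F :: "real^'n \<Rightarrow> real"
  assumes "F differentiable (at x)"
  shows "(\<lambda>n. (F (x + inverse (real (Suc n)) *\<^sub>R axis i 1) - F x) * real (Suc n))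
    \<longlonglongrightarrow> partial i F x"
proof -
  have "((\<lambda>s. F (x + s *\<^sub>R axis i 1)) has_real_derivative partial i F x) (at 0)"
    using has_real_derivative_along_axis[of F x 0 i] assms by simp
  then have *: "((\<lambda>h. (F (x + h *\<^sub>R axis i 1) - F x) / h) \<longlongrightarrow> partial i F x) (at 0)"
    by (simp add: DERIV_def)
  have "filterlim (\<lambda>n. inverse (real (Suc n))) (at 0) sequentially"
    using LIMSEQ_inverse_real_of_nat by (auto simp: filterlim_at)
  from filterlim_compose[OF * this] show ?thesis by (simp add: divide_inverse)
qed

text \<open>Lebesgue measure is translation invariant, so the difference quotients of \<open>F\<close> integrate to zero.\<close>

lemma integral_partial_bounded_support:
  fixes F :: "real^'n \<Rightarrow> real"
  assumes F: "\<And>x. F differentiable (at x)" and cont: "continuous_on UNIV (partial i F)"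
    and supp: "bounded {x. F x \<noteq> 0}"
  shows "integrable lborel (partial i F)" "(\<integral>x. partial i F x \<partial>lborel) = 0"
proof -
  obtain R where R: "R > 0" "\<And>x. F x \<noteq> 0 \<Longrightarrow> norm x \<le> R"
    using supp unfolding bounded_pos by blast
  have contF: "continuous_on UNIV F"
    using F by (simp add: continuous_on_eq_continuous_at differentiable_imp_continuous_within)
  show int: "integrable lborel (partial i F)"
    by (rule continuous_bounded_support_integrable[OF cont, of R])
       (use partial_eq_0_outside[of F R] R in force)
  have intF: "integrable lborel F"
    by (rule continuous_bounded_support_integrable[OF contF R(2)])
  \<comment> \<open>Radius R + 2: the dominating function lives on the ball of radius R + 1, and the
    mean value theorem moves the point by at most 1 more.\<close>
  have "compact (partial i F ` cball 0 (R + 2))"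
    by (rule compact_continuous_image) (use cont continuous_on_subset in auto)
  then obtain B where B: "\<And>x. norm x \<le> R + 2 \<Longrightarrow> \<bar>partial i F x\<bar> \<le> B"
    by (force dest!: compact_imp_bounded simp: bounded_iff)
  define h where "h n = inverse (real (Suc n))" for n
  have h: "0 < h n" "h n \<le> 1" for n by (auto simp: h_def field_simps)
  define D where "D n x = (F (x + h n *\<^sub>R axis i 1) - F x) * real (Suc n)" for n x
  have D0: "(\<integral>x. D n x \<partial>lborel) = 0" for n
  proof -
    have "(\<integral>x. D n x \<partial>lborel) =
        ((\<integral>x. F (x + h n *\<^sub>R axis i 1) \<partial>lborel) - (\<integral>x. F x \<partial>lborel)) * real (Suc n)"
      unfolding D_def
      by (simp add: Bochner_Integration.integral_diff intF lborel_integrable_translate)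
    then show ?thesis
      using intF by (simp add: lborel_integral_translate)
  qed
  \<comment> \<open>Inside the ball the quotient is a value of the partial derivative; outside it, x
    and its translate both miss the support, because the shift has length at most 1.\<close>
  have bound: "norm (D n x) \<le> B * indicator (cball 0 (R + 1)) x" for n x
  proof (cases "norm x \<le> R + 1")
    case True
    obtain s where s: "0 < s" "s < h n" "F (x + h n *\<^sub>R axis i 1) - F (x + 0 *\<^sub>R axis i 1)
        = (h n - 0) * partial i F (x + s *\<^sub>R axis i 1)"
      using MVT2[OF h(1) has_real_derivative_along_axis[OF F]] by blast
    have "D n x = partial i F (x + s *\<^sub>R axis i 1)"
      using s(3) by (simp add: D_def h_def field_simps)
    moreover have "norm (x + s *\<^sub>R axis i 1) \<le> R + 2"
      using norm_triangle_ineq[of x "s *\<^sub>R axis i 1"] True s h(2)[of n] by simp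
    ultimately show ?thesis using B True by simp
  next
    case False
    have "norm (x + h n *\<^sub>R axis i 1) > R"
      using norm_triangle_ineq2[of x "- (h n *\<^sub>R axis i 1)"] False h[of n] by simp
    then have "F (x + h n *\<^sub>R axis i 1) = 0" "F x = 0" using R(2) False by fastforce+
    then have "D n x = 0" unfolding D_def by simp
    then show ?thesis using False by simp
  qed
  have "(\<lambda>n. \<integral>x. D n x \<partial>lborel) \<longlonglongrightarrow> (\<integral>x. partial i F x \<partial>lborel)"
  proof (rule integral_dominated_convergence[where w="\<lambda>x. B * indicator (cball 0 (R + 1)) x"])
    show "integrable lborel (\<lambda>x::real^'n. B * indicator (cball 0 (R + 1)) x)"
      by (intro integrable_mult_right integrable_real_indicator)
        (auto simp: emeasure_bounded_finite[unfolded infinity_ennreal_def])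
    show "AE x in lborel. (\<lambda>n. D n x) \<longlonglongrightarrow> partial i F x"
      unfolding D_def h_def using difference_quotient_along_axis[OF F] by (intro AE_I2)
    show "D n \<in> borel_measurable lborel" for n
      using intF lborel_integrable_translate[OF intF] unfolding D_def
      by (intro borel_measurable_times borel_measurable_diff borel_measurable_const borel_measurable_integrable)
    show "partial i F \<in> borel_measurable lborel" using int by simp
    show "AE x in lborel. norm (D n x) \<le> B * indicator (cball 0 (R + 1)) x" for n
      using bound by simp
  qed
  then show "(\<integral>x. partial i F x \<partial>lborel) = 0" by (simp add: D0 LIMSEQ_const_iff)
qed

lemma integral_divergence_bounded_support:
  fixes F :: "'n \<Rightarrow> real^'n \<Rightarrow> real"
  assumes "\<And>i x. F i differentiable (at x)" "\<And>i. continuous_on UNIV (partial i (F i))"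
    "\<And>i. bounded {x. F i x \<noteq> 0}"
  shows "integrable lborel (\<lambda>x. \<Sum>i\<in>UNIV. partial i (F i) x)"
    "(\<integral>x. (\<Sum>i\<in>UNIV. partial i (F i) x) \<partial>lborel) = 0"
  using integral_partial_bounded_support[OF assms] by simp_all

text \<open>The set where f is nonzero is open and null, and nonempty open sets are not
  negligible.\<close>

lemma continuous_AE_eq_0:
  fixes f :: "'a::euclidean_space \<Rightarrow> real"
  assumes c: "continuous_on UNIV f" and ae: "AE x in lborel. f x = 0"
  shows "f x = 0"
proof (rule ccontr)
  assume "f x \<noteq> 0"
  let ?U = "{x. f x \<noteq> 0}"
  have "open ?U" using open_Collect_neq[OF c continuous_on_const] .
  have "emeasure lborel ?U = 0"
    using ae \<open>open ?U\<close> by (subst (asm) AE_iff_measurable[OF _ refl]) auto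
  then have "?U \<in> null_sets lborel" using \<open>open ?U\<close> by auto
  then have "negligible ?U"
    by (simp add: negligible_iff_null_sets null_sets_completionI)
  then show False using open_not_negligible[OF \<open>open ?U\<close>] \<open>f x \<noteq> 0\<close> by blast
qed

subsection \<open>Pointwise identities\<close>

text \<open>The source of bounded support for every test function of Q, |u|^2 or a component of u
  that vanishes near the value 0.\<close>

lemma bounded_superlevel_at_infinity:
  fixes f :: "'a::euclidean_space \<Rightarrow> 'b::real_normed_vector"
  assumes "(f \<longlongrightarrow> 0) at_infinity" "l > 0"
  shows "bounded {x. norm (f x) > l}"
proof -
  obtain b where b: "\<And>x. norm x \<ge> b \<Longrightarrow> norm (f x) < l"
    using tendstoD[OF assms] unfolding eventually_at_infinity by auto
  have "{x. norm (f x) > l} \<subseteq> cball 0 b"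
  proof
    fix x assume "x \<in> {x. norm (f x) > l}"
    then show "x \<in> cball 0 b" using b[of x] by (cases "norm x \<ge> b") auto
  qed
  then show ?thesis using bounded_subset bounded_cball by blast
qed

lemma constant_at_infinity_eq_0:
  fixes f :: "'a::euclidean_space \<Rightarrow> real"
  assumes "(f \<longlongrightarrow> 0) at_infinity" "\<And>x y. f x = f y"
  shows "f x = 0"
proof -
  have "f = (\<lambda>_. f x)" using assms(2) by blast
  then have "((\<lambda>_. f x) \<longlongrightarrow> 0) (at_infinity :: 'a filter)" using assms(1) by metis
  then show ?thesis by (rule tendsto_const_iff[OF trivial_limit_at_infinity, THEN iffD1])
qed

text \<open>An exponent of at least 2 removes the kink: at 0 the difference quotient is at most
  |h|^(n+1). The square serves the cut-offs, the fourth power the Sobolev inequality.\<close>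

lemma DERIV_max_0_power:
  "((\<lambda>t::real. (max 0 t) ^ (n + 2)) has_real_derivative real (n + 2) * (max 0 t) ^ (n + 1)) (at t)"
proof -
  consider "t > 0" | "t < 0" | "t = 0" by linarith
  then show ?thesis
  proof cases
    case 1
    have "((\<lambda>t::real. t ^ (n + 2)) has_real_derivative real (n + 2) * t ^ (n + 1)) (at t)"
      using DERIV_pow[of "n + 2" t] by simp
    then have "((\<lambda>t::real. (max 0 t) ^ (n + 2)) has_real_derivative real (n + 2) * t ^ (n + 1)) (at t)"
      by (rule DERIV_cong_ev[THEN iffD1, rotated -1])
        (use eventually_nhds_in_open[of "{0<..}" t] 1 in \<open>auto elim!: eventually_mono\<close>)
    then show ?thesis using 1 by simp
  next
    case 2
    have "((\<lambda>t::real. 0) has_real_derivative 0) (at t)" by simp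
    then have "((\<lambda>t::real. (max 0 t) ^ (n + 2)) has_real_derivative 0) (at t)"
      by (rule DERIV_cong_ev[THEN iffD1, rotated -1])
        (use eventually_nhds_in_open[of "{..<0}" t] 2 in \<open>auto elim!: eventually_mono\<close>)
    then show ?thesis using 2 by simp
  next
    case 3
    have "((\<lambda>h::real. (max 0 h) ^ (n + 2) / h) \<longlongrightarrow> 0) (at 0)"
    proof (rule Lim_null_comparison[where g="\<lambda>h. \<bar>h\<bar> ^ (n + 1)"])
      have "norm ((max 0 h) ^ (n + 2) / h) \<le> \<bar>h\<bar> ^ (n + 1)" for h :: real
      proof (cases "h > 0")
        case False
        then have "max 0 h = 0" by simp
        then show ?thesis using zero_le_power[OF abs_ge_zero, of h "n + 1"] by simp
      qed (auto simp: max_def)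
      then show "\<forall>\<^sub>F h in at 0. norm ((max 0 h) ^ (n + 2) / h) \<le> \<bar>h\<bar> ^ (n + 1)" for h :: real
        by simp
      have "((\<lambda>h::real. \<bar>h\<bar> ^ (n + 1)) \<longlongrightarrow> \<bar>0\<bar> ^ (n + 1)) (at 0)"
        by (intro tendsto_intros)
      then show "((\<lambda>h::real. \<bar>h\<bar> ^ (n + 1)) \<longlongrightarrow> 0) (at 0)" by simp
    qed
    then show ?thesis using 3 by (simp add: DERIV_def)
  qed
qed

lemma DERIV_max_0_square:
  "((\<lambda>t::real. (max 0 (t - l))\<^sup>2) has_real_derivative 2 * max 0 (t - l)) (at t)"
proof -
  have "((\<lambda>t::real. (max 0 t)\<^sup>2) has_real_derivative 2 * max 0 t) (at t)" for t
    using DERIV_max_0_power[of 0 t] by (simp add: power2_eq_square)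
  from DERIV_chain2[OF this, of "\<lambda>t. t - l" 1 t UNIV] DERIV_diff[OF DERIV_ident DERIV_const, of l t UNIV]
  show ?thesis by simp
qed

text \<open>A primitive of h is constant on [-l, l]; subtracting its value at 0 makes it vanish
  there, so that its composition with Q has bounded support like that of h.\<close>

lemma antiderivative_vanishing_near_0:
  fixes h :: "real \<Rightarrow> real"
  assumes h: "continuous_on UNIV h" and 0: "\<And>t. \<bar>t\<bar> \<le> l \<Longrightarrow> h t = 0"
  obtains \<phi> where "\<And>t. (\<phi> has_real_derivative h t) (at t)" "\<And>t. \<bar>t\<bar> \<le> l \<Longrightarrow> \<phi> t = 0"
proof -
  obtain F where F: "\<And>t. (F has_real_derivative h t) (at t)"
    using einterval_antiderivative[of "-\<infinity>" "\<infinity>" h] h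
    by (auto simp: continuous_on_eq_continuous_at has_real_derivative_iff_has_vector_derivative)
  define \<phi> where "\<phi> t = F t - F 0" for t
  have \<phi>: "(\<phi> has_real_derivative h t) (at t)" for t
    unfolding \<phi>_def using DERIV_diff[OF F DERIV_const] by simp
  have "\<phi> t = 0" if t: "\<bar>t\<bar> \<le> l" for t
  proof -
    have "(\<phi> has_field_derivative 0) (at x within {-l..l})" if "x \<in> {-l..l}" for x
    proof -
      have "h x = 0" using 0 that by (simp add: abs_le_iff)
      with \<phi>[of x] show ?thesis by (auto intro: has_field_derivative_at_within)
    qed
    from has_field_derivative_zero_constant[OF _ this] obtain c where "\<And>x. x \<in> {-l..l} \<Longrightarrow> \<phi> x = c"
      by auto
    then have "\<phi> t = \<phi> 0" using t by (metis abs_le_iff abs_zero abs_ge_zero atLeastAtMost_iff minus_le_iff neg_0_le_iff_le order.trans)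
    then show ?thesis by (simp add: \<phi>_def)
  qed
  with \<phi> that show ?thesis by blast
qed

section \<open>Coordinate identities for a decaying solution\<close>

locale decaying_NS =
  fixes u :: "real^3 \<Rightarrow> real^3" and p :: "real^3 \<Rightarrow> real"
  assumes NS: "smooth_stationary_NS u p"
    and u_infinity: "(u \<longlongrightarrow> 0) at_infinity"
    and finite_dirichlet: "(\<integral>\<^sup>+x. ennreal (grad_norm_sq u x) \<partial>lborel) < \<infinity>"
    and Q_infinity: "(head_pressure u p \<longlongrightarrow> 0) at_infinity"
begin

abbreviation Q :: "real^3 \<Rightarrow> real" where "Q \<equiv> head_pressure u p"
abbreviation U :: "3 \<Rightarrow> real^3 \<Rightarrow> real" where "U j \<equiv> \<lambda>x. u x $ j"
abbreviation DU :: "3 \<Rightarrow> 3 \<Rightarrow> real^3 \<Rightarrow> real" where "DU i j \<equiv> partial i (\<lambda>x. u x $ j)"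

text \<open>The j-th component of the Laplacian of u, as a scalar function so that it can be
  differentiated again.\<close>

definition L :: "3 \<Rightarrow> real^3 \<Rightarrow> real" where "L j x = (\<Sum>i\<in>UNIV. partial i (DU i j) x)"

lemma smooth_u: "smooth u" and smooth_p: "smooth p"
  using NS by (auto simp: smooth_stationary_NS_def)

lemma smooth_U [intro]: "smooth (U j)"
  using smooth_u by (rule smooth_component)

lemma smooth_DU [intro]: "smooth (DU i j)"
  by (intro smooth_partial smooth_U)

lemma smooth_L [intro]: "smooth (L j)"
  unfolding L_def[abs_def] by (intro smooth_sum smooth_partial smooth_U)

lemma partial_u: "partial i u x $ j = DU i j x"
  using partial_component[OF smooth_differentiable[OF smooth_u]] by simp

lemma head_pressure_eq: "Q = (\<lambda>x. (1/2) * (\<Sum>i\<in>UNIV. U i x * U i x) + p x)"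
  by (auto simp: head_pressure_def fun_eq_iff power2_norm_eq_inner inner_vec_def)

lemma smooth_Q [intro]: "smooth Q"
  unfolding head_pressure_eq by (intro smooth_add smooth_mult smooth_sum smooth_const smooth_U smooth_p)

lemma div_u: "(\<Sum>i\<in>UNIV. DU i i x) = 0"
  using NS by (simp add: smooth_stationary_NS_def divergence_def partial_u)

lemma momentum: "L j x = (\<Sum>i\<in>UNIV. U i x * DU i j x) + partial j p x"
proof -
  have "partial i (partial i u) x $ j = partial i (DU i j) x" for i
    using partial_component[OF smooth_differentiable[OF smooth_partial[OF smooth_u]], of i i j x]
    by (simp add: partial_u)
  moreover have "- laplacian u x + convection u u x + gradient p x = 0"
    using NS by (simp add: smooth_stationary_NS_def)
  then have "(- laplacian u x + convection u u x + gradient p x) $ j = 0" by simp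
  ultimately show ?thesis
    by (simp add: laplacian_def convection_def gradient_def L_def partial_u)
qed

text \<open>By \<open>momentum\<close>, the gradient of p is Laplace u minus the convection term.
  Adding the gradient of |u|^2 / 2 leaves the antisymmetric part of the Jacobian acting on u, which
  is the j-th component of u x omega.\<close>

lemma partial_Q: "partial j Q x = L j x + (\<Sum>i\<in>UNIV. U i x * DU j i x - U i x * DU i j x)"
proof -
  define S where "S x = (\<Sum>i\<in>UNIV. U i x * U i x)" for x
  have S: "smooth S" unfolding S_def[abs_def] by (intro smooth_sum smooth_mult smooth_U)
  have "partial j S x = (\<Sum>i\<in>UNIV. partial j (\<lambda>x. U i x * U i x) x)"
    unfolding S_def[abs_def] by (intro partial_sum smooth_differentiable smooth_mult smooth_U)
  also have "\<dots> = 2 * (\<Sum>i\<in>UNIV. U i x * DU j i x)"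
    by (simp add: partial_mult smooth_differentiable smooth_U sum_distrib_left)
  finally have dS: "partial j S x = 2 * (\<Sum>i\<in>UNIV. U i x * DU j i x)" .
  have "partial j Q x = partial j (\<lambda>x. (1/2) * S x + p x) x"
    unfolding head_pressure_eq S_def ..
  also have "\<dots> = partial j (\<lambda>x. (1/2) * S x) x + partial j p x"
    by (intro partial_add smooth_differentiable smooth_mult smooth_const S smooth_p)
  also have "partial j (\<lambda>x. (1/2) * S x) x = (1/2) * partial j S x"
    by (subst partial_mult) (simp_all add: smooth_differentiable S)
  finally have "partial j Q x = (\<Sum>i\<in>UNIV. U i x * DU j i x) + partial j p x"
    by (simp add: dS)
  then show ?thesis by (simp add: momentum sum_subtractf)
qed

lemma vorticity_components:
  "curl u x $ 1 = DU 2 3 x - DU 3 2 x" "curl u x $ 2 = DU 3 1 x - DU 1 3 x"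
  "curl u x $ 3 = DU 1 2 x - DU 2 1 x"
  by (simp_all add: curl_def vector_3 partial_u)

lemma gradient_Q: "gradient Q x = (\<chi> j. L j x) + u x \<times> curl u x"
  by (simp add: vec_eq_iff forall_3 gradient_def partial_Q cross_components vorticity_components
      sum_3 algebra_simps)

lemma partial_div_u: "(\<Sum>j\<in>UNIV. partial i (DU j j) x) = 0"
proof -
  have "(\<Sum>j\<in>UNIV. partial i (DU j j) x) = partial i (\<lambda>x. \<Sum>j\<in>UNIV. DU j j x) x"
    by (intro partial_sum[symmetric] smooth_differentiable smooth_DU)
  then show ?thesis by (simp add: div_u)
qed

text \<open>Divergence commutes with the Laplacian, so div Laplace u = Laplace div u = 0.\<close>

lemma div_L: "(\<Sum>j\<in>UNIV. partial j (L j) x) = 0"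
proof -
  have "partial j (L j) x = (\<Sum>i\<in>UNIV. partial i (partial i (DU j j)) x)" for j
  proof -
    have "partial j (L j) x = (\<Sum>i\<in>UNIV. partial j (partial i (DU i j)) x)"
      unfolding L_def[abs_def] by (intro partial_sum smooth_differentiable smooth_partial smooth_U)
    also have "\<dots> = (\<Sum>i\<in>UNIV. partial i (partial i (DU j j)) x)"
    proof (rule sum.cong[OF refl])
      fix i
      have "partial j (partial i (DU i j)) x = partial i (partial j (DU i j)) x"
        by (rule partial_commute[OF smooth_DU])
      also have "partial j (DU i j) = partial i (DU j j)"
        by (rule ext) (rule partial_commute[OF smooth_U])
      finally show "partial j (partial i (DU i j)) x = partial i (partial i (DU j j)) x" .
    qed
    finally show ?thesis .
  qed
  then have "(\<Sum>j\<in>UNIV. partial j (L j) x) = (\<Sum>i\<in>UNIV. \<Sum>j\<in>UNIV. partial i (partial i (DU j j)) x)"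
    by (subst sum.swap) simp
  also have "\<dots> = (\<Sum>i\<in>UNIV. partial i (\<lambda>x. \<Sum>j\<in>UNIV. partial i (DU j j) x) x)"
    by (intro sum.cong[OF refl] partial_sum[symmetric] smooth_differentiable smooth_partial smooth_U)
  finally show ?thesis by (simp add: partial_div_u)
qed

text \<open>The subtracted sum is the trace of the squared Jacobian. For divergence-free u it is the
  divergence of (u . grad) u, which is what links the Dirichlet integral to the enstrophy.\<close>

lemma norm_vorticity_sq:
  "(norm (curl u x))\<^sup>2 = (\<Sum>i\<in>UNIV. \<Sum>j\<in>UNIV. DU i j x * DU i j x - DU i j x * DU j i x)"
  by (simp add: power2_norm_eq_inner inner_vec_def sum_3 vorticity_components algebra_simps)

lemma grad_norm_sq_u: "grad_norm_sq u x = (\<Sum>i\<in>UNIV. \<Sum>j\<in>UNIV. DU i j x * DU i j x)"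
  by (simp add: grad_norm_sq_def power2_norm_eq_inner inner_vec_def partial_u)

lemma norm_vorticity_sq_le: "(norm (curl u x))\<^sup>2 \<le> 2 * grad_norm_sq u x"
proof -
  \<comment> \<open>With a, b the two entries this is (a + b)^2 >= 0; summed over i and j, the
    weights 3 and 1 add up to 4.\<close>
  have "2 * (DU i j x * DU i j x - DU i j x * DU j i x) \<le> 3 * (DU i j x * DU i j x) + DU j i x * DU j i x" for i j
    using zero_le_square[of "DU i j x + DU j i x"] by (simp add: algebra_simps)
  then have "2 * (norm (curl u x))\<^sup>2 \<le> (\<Sum>i\<in>UNIV. \<Sum>j\<in>UNIV. 3 * (DU i j x * DU i j x) + DU j i x * DU j i x)"
    unfolding norm_vorticity_sq sum_distrib_left by (intro sum_mono)
  also have "\<dots> = 4 * grad_norm_sq u x"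
    unfolding grad_norm_sq_u by (simp add: sum_3)
  finally show ?thesis by simp
qed

text \<open>The part u x omega of grad Q is orthogonal to u.\<close>

lemma u_dot_gradient_Q: "(\<Sum>j\<in>UNIV. U j x * partial j Q x) = (\<Sum>j\<in>UNIV. U j x * L j x)"
  by (simp add: partial_Q sum_3 algebra_simps)

text \<open>Take the divergence of \<open>partial_Q\<close>. The Laplacian part drops out by
  \<open>div_L\<close>, the quadratic terms form |omega|^2, and of the second order terms u . grad
  div u vanishes while u . Laplace u equals u . grad Q by \<open>u_dot_gradient_Q\<close>.\<close>

lemma head_pressure_equation:
  "(\<Sum>j\<in>UNIV. partial j (partial j Q) x) = (norm (curl u x))\<^sup>2 + (\<Sum>j\<in>UNIV. U j x * partial j Q x)"
proof -
  note sm = smooth_differentiable smooth_U smooth_DU smooth_L smooth_mult smooth_sum smooth_diff smooth_partial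
  have "partial j (partial j Q) x = partial j (L j) x + (\<Sum>i\<in>UNIV. (U i x * partial j (DU j i) x + DU j i x * DU j i x)
      - (U i x * partial j (DU i j) x + DU j i x * DU i j x))" for j
  proof -
    have "partial j Q = (\<lambda>x. L j x + (\<Sum>i\<in>UNIV. U i x * DU j i x - U i x * DU i j x))"
      by (rule ext) (rule partial_Q)
    then show ?thesis by (simp add: partial_add partial_mult partial_sum partial_diff sm)
  qed
  moreover have "(\<Sum>i\<in>UNIV. (U i x * partial j (DU j i) x + DU j i x * DU j i x)
      - (U i x * partial j (DU i j) x + DU j i x * DU i j x))
    = (\<Sum>i\<in>UNIV. (U i x * partial j (DU j i) x + DU j i x * DU j i x)
      - (U i x * partial i (DU j j) x + DU j i x * DU i j x))" for j
  proof (rule sum.cong[OF refl])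
    fix i
    show "(U i x * partial j (DU j i) x + DU j i x * DU j i x)
        - (U i x * partial j (DU i j) x + DU j i x * DU i j x)
      = (U i x * partial j (DU j i) x + DU j i x * DU j i x)
        - (U i x * partial i (DU j j) x + DU j i x * DU i j x)"
      by (subst partial_commute[OF smooth_U, of j i j]) (rule refl)
  qed
  ultimately have "(\<Sum>j\<in>UNIV. partial j (partial j Q) x) = (\<Sum>j\<in>UNIV. partial j (L j) x)
     + (\<Sum>j\<in>UNIV. \<Sum>i\<in>UNIV. (U i x * partial j (DU j i) x + DU j i x * DU j i x)
      - (U i x * partial i (DU j j) x + DU j i x * DU i j x))"
    by (simp only: sum.distrib)
  also have "\<dots> = (\<Sum>j\<in>UNIV. \<Sum>i\<in>UNIV. U i x * partial j (DU j i) x)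
      + (\<Sum>j\<in>UNIV. \<Sum>i\<in>UNIV. DU j i x * DU j i x - DU j i x * DU i j x)
      - (\<Sum>j\<in>UNIV. \<Sum>i\<in>UNIV. U i x * partial i (DU j j) x)"
    by (simp add: div_L sum.distrib sum_subtractf)
  also have "(\<Sum>j\<in>UNIV. \<Sum>i\<in>UNIV. U i x * partial i (DU j j) x) = 0"
    by (subst sum.swap) (simp add: partial_div_u flip: sum_distrib_left)
  also have "(\<Sum>j\<in>UNIV. \<Sum>i\<in>UNIV. U i x * partial j (DU j i) x) = (\<Sum>i\<in>UNIV. U i x * L i x)"
    by (subst sum.swap) (simp add: L_def sum_distrib_left)
  finally show ?thesis
    by (simp add: norm_vorticity_sq u_dot_gradient_Q)
qed

end

subsection \<open>Integral inequalities\<close>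

lemma ennpowr_ennreal [simp]: "0 \<le> x \<Longrightarrow> ennpowr (ennreal x) r = ennreal (x powr r)"
  by (simp add: ennpowr_def)

lemma ennpowr_top [simp]: "ennpowr top r = top"
  by (simp add: ennpowr_def)

lemma ennpowr_0 [simp]: "ennpowr 0 r = 0"
  by (simp add: ennpowr_def)

lemma ennpowr_eq_0_iff: "ennpowr a r = 0 \<longleftrightarrow> a = 0"
  by (cases a) (auto simp: ennreal_eq_0_iff powr_def)

lemma ennpowr_mono: "a \<le> b \<Longrightarrow> 0 \<le> r \<Longrightarrow> ennpowr a r \<le> ennpowr b r"
  by (cases a; cases b) (auto intro!: ennreal_leI powr_mono2 simp: top_unique)

lemma ennpowr_ennpowr: "ennpowr (ennpowr a r) s = ennpowr a (r * s)"
  by (cases a) (auto simp: powr_powr)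

lemma ennpowr_1 [simp]: "ennpowr a 1 = a"
  by (cases a) auto

lemma ennpowr_mult: "0 < r \<Longrightarrow> ennpowr (a * b) r = ennpowr a r * ennpowr b r"
proof (cases "a = 0 \<or> b = 0")
  case False
  then show ?thesis
    by (cases a; cases b) (auto simp: powr_mult ennreal_mult_top ennreal_top_mult ennreal_eq_0_iff
      simp flip: ennreal_mult)
qed auto

text \<open>At n = 0 the two sides differ for a = 0, since \<open>0 powr 0 = 0\<close>.\<close>

lemma ennpowr_power: "n > 0 \<Longrightarrow> ennpowr a (real n) = a ^ n"
proof (cases a)
  case (real x)
  then show "n > 0 \<Longrightarrow> ?thesis" by (cases "x = 0") (auto simp: powr_realpow ennreal_power)
qed (auto simp: top_power_ennreal)

lemma measurable_ennpowr [measurable (raw)]: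
  assumes [measurable]: "f \<in> borel_measurable M"
  shows "(\<lambda>x. ennpowr (f x) r) \<in> borel_measurable M"
  unfolding ennpowr_def by measurable

text \<open>Young's inequality for f and g divided by their norms, integrated. Working in
  \<open>ennreal\<close> makes the inequality available before any finiteness is known.\<close>

lemma nn_integral_Holder:
  fixes f g :: "'a \<Rightarrow> ennreal"
  assumes pq: "p > 1" "q > 1" "1/p + 1/q = 1"
    and [measurable]: "f \<in> borel_measurable M" "g \<in> borel_measurable M"
  shows "(\<integral>\<^sup>+x. f x * g x \<partial>M) \<le>
    ennpowr (\<integral>\<^sup>+x. ennpowr (f x) p \<partial>M) (1/p) * ennpowr (\<integral>\<^sup>+x. ennpowr (g x) q \<partial>M) (1/q)"
    (is "?I \<le> ennpowr ?A _ * ennpowr ?B _")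
proof -
  \<comment> \<open>The zero cases come first: there the right side is 0 even if the other integral
    is infinite, so the product on the left has to be shown to vanish almost everywhere.\<close>
  consider "?A = 0" | "?B = 0" | "?A \<noteq> 0" "?B \<noteq> 0" "?A = \<infinity> \<or> ?B = \<infinity>"
    | "?A \<noteq> 0" "?B \<noteq> 0" "?A \<noteq> \<infinity>" "?B \<noteq> \<infinity>" by blast
  then show ?thesis
  proof cases
    case 1
    then have "AE x in M. f x = 0" by (simp add: nn_integral_0_iff_AE ennpowr_eq_0_iff)
    then have "?I = 0" by (subst nn_integral_0_iff_AE) auto
    then show ?thesis by simp
  next
    case 2
    then have "AE x in M. g x = 0" by (simp add: nn_integral_0_iff_AE ennpowr_eq_0_iff)
    then have "?I = 0" by (subst nn_integral_0_iff_AE) auto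
    then show ?thesis by simp
  next
    case 3
    then have "ennpowr ?A (1/p) * ennpowr ?B (1/q) = \<infinity>"
      by (auto simp: ennreal_mult_top ennreal_top_mult ennpowr_eq_0_iff)
    then show ?thesis by simp
  next
    case 4
    obtain A where A: "?A = ennreal A" "A > 0"
      using 4 by (cases ?A) (auto simp: ennreal_eq_0_iff not_le)
    obtain B where B: "?B = ennreal B" "B > 0"
      using 4 by (cases ?B) (auto simp: ennreal_eq_0_iff not_le)
    \<comment> \<open>These are the two norms; the inequality \<open>Young\<close> below is Young's
      inequality for f / a and g / b, multiplied by a b.\<close>
    define a b where "a = A powr (1/p)" and "b = B powr (1/q)"
    have ab: "a > 0" "b > 0" "a powr p = A" "b powr q = B"
      using A B pq by (auto simp: a_def b_def powr_powr)
    have Young: "f x * g x \<le> ennreal (a * b / (p * A)) * ennpowr (f x) p + ennreal (a * b / (q * B)) * ennpowr (g x) q" for x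
    proof (cases "f x = top \<or> g x = top")
      case True
      have "ennreal (a * b / (p * A)) \<noteq> 0" "ennreal (a * b / (q * B)) \<noteq> 0"
        using ab A B pq by (auto simp: ennreal_eq_0_iff not_le)
      with True show ?thesis by (auto simp: ennreal_mult_top)
    next
      case False
      then obtain s t where st: "f x = ennreal s" "s \<ge> 0" "g x = ennreal t" "t \<ge> 0"
        by (cases "f x"; cases "g x") auto
      have "(s / a) * (t / b) \<le> (s / a) powr p / p + (t / b) powr q / q"
        using st ab by (intro Youngs_inequality pq) auto
      also have "\<dots> = s powr p / (p * A) + t powr q / (q * B)"
        using st ab by (simp add: powr_divide mult.commute)
      finally have "s * t \<le> a * b * (s powr p / (p * A) + t powr q / (q * B))"
        using ab by (simp add: field_simps)
      then show ?thesis using st ab A B pq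
        by (simp add: algebra_simps flip: ennreal_mult ennreal_plus)
    qed
    have "?I \<le> (\<integral>\<^sup>+x. ennreal (a * b / (p * A)) * ennpowr (f x) p + ennreal (a * b / (q * B)) * ennpowr (g x) q \<partial>M)"
      by (intro nn_integral_mono Young)
    also have "\<dots> = ennreal (a * b / (p * A)) * ?A + ennreal (a * b / (q * B)) * ?B"
      by (simp add: nn_integral_add nn_integral_cmult)
    also have "\<dots> = ennreal (a * b / p + a * b / q)"
      using A B ab pq by (simp flip: ennreal_mult ennreal_plus)
    also have "a * b / p + a * b / q = a * b * (1 / p + 1 / q)"
      by (simp add: algebra_simps)
    also have "\<dots> = a * b" by (simp add: pq)
    also have "ennreal (a * b) = ennpowr ?A (1/p) * ennpowr ?B (1/q)"
      using A B by (simp add: a_def b_def flip: ennreal_mult)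
    finally show ?thesis .
  qed
qed

abbreviation ennsqrt :: "ennreal \<Rightarrow> ennreal" where "ennsqrt a \<equiv> ennpowr a (1/2)"

lemma ennsqrt_power2 [simp]: "(ennsqrt a)\<^sup>2 = a"
  using ennpowr_power[of 2 "ennsqrt a"] by (simp add: ennpowr_ennpowr)

lemma ennsqrt_of_power2 [simp]: "ennsqrt (a\<^sup>2) = a"
  using ennpowr_power[of 2 a] by (simp add: ennpowr_ennpowr flip: ennpowr_power[of 2 a, simplified])

lemma nn_integral_Cauchy_Schwarz:
  fixes f g :: "'a \<Rightarrow> ennreal"
  assumes [measurable]: "f \<in> borel_measurable M" "g \<in> borel_measurable M"
  shows "(\<integral>\<^sup>+x. f x * g x \<partial>M) \<le> ennsqrt (\<integral>\<^sup>+x. (f x)\<^sup>2 \<partial>M) * ennsqrt (\<integral>\<^sup>+x. (g x)\<^sup>2 \<partial>M)"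
  using nn_integral_Holder[of 2 2 f M g] by (simp add: ennpowr_power[of 2, simplified])

text \<open>Cauchy-Schwarz in z, then y, then x. Each of the three functions is independent of one
  variable, so in each integration one factor is constant and the other two are paired.\<close>

lemma Loomis_Whitney:
  fixes a b c :: "real \<Rightarrow> real \<Rightarrow> ennreal"
  assumes [measurable]: "case_prod a \<in> borel_measurable borel" "case_prod b \<in> borel_measurable borel"
    "case_prod c \<in> borel_measurable borel"
  shows "(\<integral>\<^sup>+x. \<integral>\<^sup>+y. \<integral>\<^sup>+z. a y z * b x z * c x y \<partial>lborel \<partial>lborel \<partial>lborel) \<le>
    ennsqrt (\<integral>\<^sup>+y. \<integral>\<^sup>+z. (a y z)\<^sup>2 \<partial>lborel \<partial>lborel) * ennsqrt (\<integral>\<^sup>+x. \<integral>\<^sup>+z. (b x z)\<^sup>2 \<partial>lborel \<partial>lborel)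
      * ennsqrt (\<integral>\<^sup>+x. \<integral>\<^sup>+y. (c x y)\<^sup>2 \<partial>lborel \<partial>lborel)"
proof -
  define \<alpha> \<beta> \<gamma> where "\<alpha> y = ennsqrt (\<integral>\<^sup>+z. (a y z)\<^sup>2 \<partial>lborel)" and "\<beta> x = ennsqrt (\<integral>\<^sup>+z. (b x z)\<^sup>2 \<partial>lborel)"
    and "\<gamma> x = ennsqrt (\<integral>\<^sup>+y. (c x y)\<^sup>2 \<partial>lborel)" for x y
  \<comment> \<open>Stated for arbitrary measurable arguments, so that sections and reordered
    variables are covered too.\<close>
  have a[measurable]: "(\<lambda>x. a (f x) (g x)) \<in> borel_measurable M"
    if "f \<in> borel_measurable M" "g \<in> borel_measurable M" for f g and M :: "'z measure"
    using measurable_compose[OF borel_measurable_Pair[OF that] assms(1)] by simp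
  have b[measurable]: "(\<lambda>x. b (f x) (g x)) \<in> borel_measurable M"
    if "f \<in> borel_measurable M" "g \<in> borel_measurable M" for f g and M :: "'z measure"
    using measurable_compose[OF borel_measurable_Pair[OF that] assms(2)] by simp
  have c[measurable]: "(\<lambda>x. c (f x) (g x)) \<in> borel_measurable M"
    if "f \<in> borel_measurable M" "g \<in> borel_measurable M" for f g and M :: "'z measure"
    using measurable_compose[OF borel_measurable_Pair[OF that] assms(3)] by simp
  have [measurable]: "\<alpha> \<in> borel_measurable borel" "\<beta> \<in> borel_measurable borel" "\<gamma> \<in> borel_measurable borel"
    unfolding \<alpha>_def[abs_def] \<beta>_def[abs_def] \<gamma>_def[abs_def] by measurable
  have z: "(\<integral>\<^sup>+z. a y z * b x z * c x y \<partial>lborel) \<le> \<beta> x * (c x y * \<alpha> y)" for x y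
  proof -
    have "(\<integral>\<^sup>+z. a y z * b x z * c x y \<partial>lborel) = (\<integral>\<^sup>+z. a y z * b x z \<partial>lborel) * c x y"
      by (rule nn_integral_multc) measurable
    also have "\<dots> \<le> (\<alpha> y * \<beta> x) * c x y"
      unfolding \<alpha>_def \<beta>_def by (intro mult_right_mono nn_integral_Cauchy_Schwarz) auto
    finally show ?thesis by (simp add: ac_simps)
  qed
  have y: "(\<integral>\<^sup>+y. \<integral>\<^sup>+z. a y z * b x z * c x y \<partial>lborel \<partial>lborel)
      \<le> (\<beta> x * \<gamma> x) * ennsqrt (\<integral>\<^sup>+y. (\<alpha> y)\<^sup>2 \<partial>lborel)" for x
  proof -
    have "(\<integral>\<^sup>+y. \<integral>\<^sup>+z. a y z * b x z * c x y \<partial>lborel \<partial>lborel) \<le> (\<integral>\<^sup>+y. \<beta> x * (c x y * \<alpha> y) \<partial>lborel)"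
      by (intro nn_integral_mono z)
    also have "\<dots> = \<beta> x * (\<integral>\<^sup>+y. c x y * \<alpha> y \<partial>lborel)"
      by (rule nn_integral_cmult) measurable
    also have "\<dots> \<le> \<beta> x * (\<gamma> x * ennsqrt (\<integral>\<^sup>+y. (\<alpha> y)\<^sup>2 \<partial>lborel))"
      unfolding \<gamma>_def by (intro mult_left_mono nn_integral_Cauchy_Schwarz) auto
    finally show ?thesis by (simp add: ac_simps)
  qed
  have "(\<integral>\<^sup>+x. \<integral>\<^sup>+y. \<integral>\<^sup>+z. a y z * b x z * c x y \<partial>lborel \<partial>lborel \<partial>lborel) \<le>
      (\<integral>\<^sup>+x. (\<beta> x * \<gamma> x) * ennsqrt (\<integral>\<^sup>+y. (\<alpha> y)\<^sup>2 \<partial>lborel) \<partial>lborel)"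
    by (intro nn_integral_mono y)
  also have "\<dots> = (\<integral>\<^sup>+x. \<beta> x * \<gamma> x \<partial>lborel) * ennsqrt (\<integral>\<^sup>+y. (\<alpha> y)\<^sup>2 \<partial>lborel)"
    by (rule nn_integral_multc) measurable
  also have "\<dots> \<le> (ennsqrt (\<integral>\<^sup>+x. (\<beta> x)\<^sup>2 \<partial>lborel) * ennsqrt (\<integral>\<^sup>+x. (\<gamma> x)\<^sup>2 \<partial>lborel)) * ennsqrt (\<integral>\<^sup>+y. (\<alpha> y)\<^sup>2 \<partial>lborel)"
    by (intro mult_right_mono nn_integral_Cauchy_Schwarz) auto
  finally show ?thesis by (simp add: \<alpha>_def \<beta>_def \<gamma>_def ac_simps)
qed

section \<open>Lebesgue measure on \<open>real^3\<close> as an iterated integral\<close>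

definition coords :: "real \<Rightarrow> real \<Rightarrow> real \<Rightarrow> real^3"
  where "coords x y z = x *\<^sub>R axis 1 1 + y *\<^sub>R axis 2 1 + z *\<^sub>R axis 3 1"

lemma coords_nth [simp]: "coords x y z $ 1 = x" "coords x y z $ 2 = y" "coords x y z $ 3 = z"
  by (simp_all add: coords_def axis_def)

lemma measurable_coords [measurable (raw)]:
  assumes [measurable]: "f \<in> borel_measurable M" "g \<in> borel_measurable M" "h \<in> borel_measurable M"
  shows "(\<lambda>x. coords (f x) (g x) (h x)) \<in> borel_measurable M"
  unfolding coords_def by measurable

text \<open>A Borel measure that gives every box its volume is \<open>lborel\<close>, and the
  preimage of a box under \<open>coords\<close> is a product of intervals.\<close>

lemma lborel_eq_distr_coords:
  "(lborel :: (real^3) measure) = distr (lborel \<Otimes>\<^sub>M (lborel \<Otimes>\<^sub>M lborel)) borel (\<lambda>(x, y, z). coords x y z)"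
proof (rule lborel_eqI)
  fix l u :: "real^3"
  assume lu: "\<And>b. b \<in> Basis \<Longrightarrow> l \<bullet> b \<le> u \<bullet> b"
  have sf: "sigma_finite_measure (lborel \<Otimes>\<^sub>M lborel :: (real \<times> real) measure)"
    by (simp add: lborel_prod sigma_finite_lborel)
  have lu: "l $ i \<le> u $ i" for i using lu[of "axis i 1"] by (simp add: inner_axis axis_in_Basis_iff)
  have "emeasure (distr (lborel \<Otimes>\<^sub>M (lborel \<Otimes>\<^sub>M lborel)) borel (\<lambda>(x, y, z). coords x y z)) (box l u)
    = emeasure (lborel \<Otimes>\<^sub>M (lborel \<Otimes>\<^sub>M lborel)) (Sigma {l$1<..<u$1} (\<lambda>_. Sigma {l$2<..<u$2} (\<lambda>_. {l$3<..<u$3})))"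
    by (subst emeasure_distr)
      (auto simp: space_pair_measure mem_box_cart forall_3 intro!: arg_cong[where f="emeasure _"])
  also have "\<dots> = ennreal (u$1 - l$1) * (ennreal (u$2 - l$2) * ennreal (u$3 - l$3))"
    using lu by (subst sigma_finite_measure.emeasure_pair_measure_Times[OF sf])
      (simp_all add: lborel.emeasure_pair_measure_Times)
  also have "\<dots> = ennreal ((u$1 - l$1) * ((u$2 - l$2) * (u$3 - l$3)))"
    using lu by (simp add: ennreal_mult)
  also have "(u$1 - l$1) * ((u$2 - l$2) * (u$3 - l$3)) = (\<Prod>i\<in>UNIV. (u - l) \<bullet> axis i 1)"
    unfolding UNIV_3 by (simp add: inner_axis ac_simps)
  also have "\<dots> = (\<Prod>b\<in>Basis. (u - l) \<bullet> b)"
  proof -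
    have B: "(Basis :: (real^3) set) = range (\<lambda>i. axis i 1)" by (auto simp: Basis_vec_def)
    have "inj (\<lambda>i::3. axis i (1::real))" by (simp add: inj_on_def axis_eq_axis)
    then show ?thesis unfolding B by (subst prod.reindex) simp_all
  qed
  finally show "emeasure (distr (lborel \<Otimes>\<^sub>M (lborel \<Otimes>\<^sub>M lborel)) borel (\<lambda>(x, y, z). coords x y z)) (box l u)
     = ennreal (\<Prod>b\<in>Basis. (u - l) \<bullet> b)" .
qed simp

lemma nn_integral_coords:
  assumes [measurable]: "f \<in> borel_measurable borel"
  shows "(\<integral>\<^sup>+v. f v \<partial>lborel) = (\<integral>\<^sup>+x. \<integral>\<^sup>+y. \<integral>\<^sup>+z. f (coords x y z) \<partial>lborel \<partial>lborel \<partial>lborel)"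
proof -
  have sf: "sigma_finite_measure (lborel \<Otimes>\<^sub>M lborel :: (real \<times> real) measure)"
    by (simp add: lborel_prod sigma_finite_lborel)
  have "(\<integral>\<^sup>+v. f v \<partial>lborel) = (\<integral>\<^sup>+w. f ((\<lambda>(x, y, z). coords x y z) w) \<partial>(lborel \<Otimes>\<^sub>M (lborel \<Otimes>\<^sub>M lborel)))"
    by (subst lborel_eq_distr_coords, subst nn_integral_distr) auto
  also have "\<dots> = (\<integral>\<^sup>+x. \<integral>\<^sup>+w. f ((\<lambda>(x, y, z). coords x y z) (x, w)) \<partial>(lborel \<Otimes>\<^sub>M lborel) \<partial>lborel)"
    by (rule sigma_finite_measure.nn_integral_fst[OF sf, symmetric]) measurable
  also have "\<dots> = (\<integral>\<^sup>+x. \<integral>\<^sup>+y. \<integral>\<^sup>+z. f (coords x y z) \<partial>lborel \<partial>lborel \<partial>lborel)"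
    by (intro nn_integral_cong, subst sigma_finite_measure.nn_integral_fst[symmetric])
      (auto simp: sigma_finite_lborel)
  finally show ?thesis .
qed

subsection \<open>The Sobolev inequality\<close>

lemma abs_le_nn_integral_derivative:
  fixes f f' :: "real \<Rightarrow> real"
  assumes f: "\<And>t. (f has_real_derivative f' t) (at t)" and f': "continuous_on UNIV f'"
    and s: "s \<le> x" "f s = 0"
  shows "ennreal \<bar>f x\<bar> \<le> (\<integral>\<^sup>+t. ennreal \<bar>f' t\<bar> \<partial>lborel)"
proof -
  have *: "has_bochner_integral lborel (\<lambda>t. indicator {s..x} t *\<^sub>R f' t) (f x - f s)"
    by (rule has_bochner_integral_FTC_Icc)
      (use f f' s in \<open>auto simp: has_real_derivative_iff_has_vector_derivative
        intro: has_vector_derivative_at_within continuous_on_subset\<close>)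
  have "ennreal \<bar>f x\<bar> = norm (\<integral>t. indicator {s..x} t *\<^sub>R f' t \<partial>lborel)"
    using has_bochner_integral_integral_eq[OF *] s by simp
  also have "\<dots> \<le> (\<integral>\<^sup>+t. norm (indicator {s..x} t *\<^sub>R f' t) \<partial>lborel)"
    by (rule integral_norm_bound_ennreal) (rule integrable.intros[OF *])
  also have "\<dots> \<le> (\<integral>\<^sup>+t. ennreal \<bar>f' t\<bar> \<partial>lborel)"
    by (intro nn_integral_mono) (auto simp: indicator_def)
  finally show ?thesis .
qed

text \<open>The fundamental theorem along the coordinate line, started at a point outside the
  support.\<close>

lemma abs_le_nn_integral_partial:
  fixes F :: "real^'n \<Rightarrow> real"
  assumes F: "\<And>x. F differentiable (at x)" and cont: "continuous_on UNIV (partial i F)"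
    and supp: "bounded {x. F x \<noteq> 0}"
  shows "ennreal \<bar>F (a + x *\<^sub>R axis i 1)\<bar> \<le> (\<integral>\<^sup>+t. ennreal \<bar>partial i F (a + t *\<^sub>R axis i 1)\<bar> \<partial>lborel)"
proof -
  obtain R where R: "R > 0" "\<And>x. F x \<noteq> 0 \<Longrightarrow> norm x \<le> R"
    using supp unfolding bounded_pos by blast
  \<comment> \<open>Far enough to the left that |a + s e_i| >= |s| - |a| > R, and also s <=
    x.\<close>
  define s where "s = - (R + norm a + \<bar>x\<bar> + 1)"
  have "norm (a + s *\<^sub>R axis i 1) \<ge> norm (s *\<^sub>R axis i (1::real) :: real^'n) - norm a"
    by (metis add.commute norm_diff_ineq)
  moreover have "norm (s *\<^sub>R axis i (1::real) :: real^'n) - norm a > R"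
    using R by (simp add: s_def)
  ultimately have "F (a + s *\<^sub>R axis i 1) = 0" using R(2)[of "a + s *\<^sub>R axis i 1"] by linarith
  moreover have "s \<le> x" using R(1) norm_ge_zero[of a] abs_ge_minus_self[of x] unfolding s_def by linarith
  moreover have "continuous_on UNIV (\<lambda>t. partial i F (a + t *\<^sub>R axis i 1))"
    by (intro continuous_on_compose2[OF cont] continuous_intros) auto
  ultimately show ?thesis
    using abs_le_nn_integral_derivative[of "\<lambda>t. F (a + t *\<^sub>R axis i 1)"
        "\<lambda>t. partial i F (a + t *\<^sub>R axis i 1)" s x] has_real_derivative_along_axis[OF F] by blast
qed

lemma coords_alt:
  "coords x y z = coords 0 y z + x *\<^sub>R axis 1 1" "coords x y z = coords x 0 z + y *\<^sub>R axis 2 1"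
  "coords x y z = coords x y 0 + z *\<^sub>R axis 3 1"
  by (simp_all add: coords_def)

text \<open>\<open>G\<close> plays the role of \<open>F\<close> to the power \<open>3/2\<close>.\<close>

lemma Gagliardo_Nirenberg:
  fixes F G :: "real^3 \<Rightarrow> real"
  assumes F: "\<And>x. F differentiable (at x)" and cont: "\<And>i. continuous_on UNIV (partial i F)"
    and supp: "bounded {x. F x \<noteq> 0}"
    and [measurable]: "G \<in> borel_measurable borel" and G: "\<And>x. 0 \<le> G x" "\<And>x. (G x)\<^sup>2 = (F x)^3" "\<And>x. 0 \<le> F x"
  shows "(\<integral>\<^sup>+v. ennreal (G v) \<partial>lborel) \<le>
    ennsqrt (\<integral>\<^sup>+v. ennreal \<bar>partial 1 F v\<bar> \<partial>lborel) * ennsqrt (\<integral>\<^sup>+v. ennreal \<bar>partial 2 F v\<bar> \<partial>lborel)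
     * ennsqrt (\<integral>\<^sup>+v. ennreal \<bar>partial 3 F v\<bar> \<partial>lborel)"
proof -
  have [measurable]: "partial i F \<in> borel_measurable borel" for i
    using cont by (rule borel_measurable_continuous_onI)
  \<comment> \<open>Each bounds F along a whole coordinate line, and so depends only on the other
    two coordinates: the shape required by \<open>Loomis_Whitney\<close>.\<close>
  define A B C where "A y z = (\<integral>\<^sup>+t. ennreal \<bar>partial 1 F (coords t y z)\<bar> \<partial>lborel)"
    and "B x z = (\<integral>\<^sup>+t. ennreal \<bar>partial 2 F (coords x t z)\<bar> \<partial>lborel)"
    and "C x y = (\<integral>\<^sup>+t. ennreal \<bar>partial 3 F (coords x y t)\<bar> \<partial>lborel)" for x y z
  have bound: "ennreal (F (coords x y z)) \<le> A y z" "ennreal (F (coords x y z)) \<le> B x z"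
    "ennreal (F (coords x y z)) \<le> C x y" for x y z
    using abs_le_nn_integral_partial[OF F cont supp, of "coords 0 y z" x 1]
      abs_le_nn_integral_partial[OF F cont supp, of "coords x 0 z" y 2]
      abs_le_nn_integral_partial[OF F cont supp, of "coords x y 0" z 3] G(3)[of "coords x y z"]
    unfolding A_def B_def C_def coords_alt[symmetric] by simp_all
  have G_le: "ennreal (G (coords x y z)) \<le> ennsqrt (A y z) * ennsqrt (B x z) * ennsqrt (C x y)" for x y z
  proof -
    let ?v = "coords x y z"
    \<comment> \<open>G is the square root of F^3; each of the three factors F is bounded by a
      different one of A, B and C.\<close>
    have "ennreal (G ?v) = ennsqrt ((ennreal (G ?v))\<^sup>2)" by simp
    also have "(ennreal (G ?v))\<^sup>2 = ennreal (F ?v) * ennreal (F ?v) * ennreal (F ?v)"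
      using G by (simp add: ennreal_power power3_eq_cube flip: ennreal_mult)
    also have "ennsqrt \<dots> \<le> ennsqrt (A y z * B x z * C x y)"
      by (intro ennpowr_mono mult_mono bound) auto
    finally show ?thesis by (simp add: ennpowr_mult)
  qed
  have "(\<integral>\<^sup>+v. ennreal (G v) \<partial>lborel)
      \<le> (\<integral>\<^sup>+x. \<integral>\<^sup>+y. \<integral>\<^sup>+z. ennsqrt (A y z) * ennsqrt (B x z) * ennsqrt (C x y) \<partial>lborel \<partial>lborel \<partial>lborel)"
    by (subst nn_integral_coords) (auto intro!: nn_integral_mono G_le)
  also have "\<dots> \<le> ennsqrt (\<integral>\<^sup>+y. \<integral>\<^sup>+z. (ennsqrt (A y z))\<^sup>2 \<partial>lborel \<partial>lborel)
      * ennsqrt (\<integral>\<^sup>+x. \<integral>\<^sup>+z. (ennsqrt (B x z))\<^sup>2 \<partial>lborel \<partial>lborel)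
      * ennsqrt (\<integral>\<^sup>+x. \<integral>\<^sup>+y. (ennsqrt (C x y))\<^sup>2 \<partial>lborel \<partial>lborel)"
    by (rule Loomis_Whitney) (unfold A_def B_def C_def borel_prod[symmetric], measurable)
  also have "(\<integral>\<^sup>+y. \<integral>\<^sup>+z. (ennsqrt (A y z))\<^sup>2 \<partial>lborel \<partial>lborel) = (\<integral>\<^sup>+v. ennreal \<bar>partial 1 F v\<bar> \<partial>lborel)"
  proof -
    \<comment> \<open>The variable integrated in the definition of A has to become the innermost
      one, hence two exchanges of order.\<close>
    have "(\<integral>\<^sup>+v. ennreal \<bar>partial 1 F v\<bar> \<partial>lborel) =
        (\<integral>\<^sup>+y. \<integral>\<^sup>+x. \<integral>\<^sup>+z. ennreal \<bar>partial 1 F (coords x y z)\<bar> \<partial>lborel \<partial>lborel \<partial>lborel)"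
      by (subst nn_integral_coords) (auto intro!: lborel_pair.Fubini'[symmetric])
    also have "\<dots> = (\<integral>\<^sup>+y. \<integral>\<^sup>+z. \<integral>\<^sup>+x. ennreal \<bar>partial 1 F (coords x y z)\<bar> \<partial>lborel \<partial>lborel \<partial>lborel)"
      by (intro nn_integral_cong lborel_pair.Fubini'[symmetric]) measurable
    finally show ?thesis by (simp add: A_def)
  qed
  also have "(\<integral>\<^sup>+x. \<integral>\<^sup>+z. (ennsqrt (B x z))\<^sup>2 \<partial>lborel \<partial>lborel) = (\<integral>\<^sup>+v. ennreal \<bar>partial 2 F v\<bar> \<partial>lborel)"
  proof -
    have "(\<integral>\<^sup>+v. ennreal \<bar>partial 2 F v\<bar> \<partial>lborel) =
        (\<integral>\<^sup>+x. \<integral>\<^sup>+y. \<integral>\<^sup>+z. ennreal \<bar>partial 2 F (coords x y z)\<bar> \<partial>lborel \<partial>lborel \<partial>lborel)"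
      by (subst nn_integral_coords) auto
    also have "\<dots> = (\<integral>\<^sup>+x. \<integral>\<^sup>+z. \<integral>\<^sup>+y. ennreal \<bar>partial 2 F (coords x y z)\<bar> \<partial>lborel \<partial>lborel \<partial>lborel)"
      by (intro nn_integral_cong lborel_pair.Fubini'[symmetric]) measurable
    finally show ?thesis by (simp add: B_def)
  qed
  also have "(\<integral>\<^sup>+x. \<integral>\<^sup>+y. (ennsqrt (C x y))\<^sup>2 \<partial>lborel \<partial>lborel) = (\<integral>\<^sup>+v. ennreal \<bar>partial 3 F v\<bar> \<partial>lborel)"
    by (subst nn_integral_coords[of "\<lambda>v. ennreal \<bar>partial 3 F v\<bar>"]) (auto simp: C_def)
  finally show ?thesis .
qed

text \<open>The function \<open>\<lambda>t. (max 0 (\<bar>t\<bar> - l)) ^ 4\<close> is written as a sum to make its differentiability at \<open>0\<close> evident.\<close>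

lemma truncated_power4:
  fixes l t :: real
  assumes "l > 0"
  shows "(max 0 (\<bar>t\<bar> - l)) ^ 4 = (max 0 (t - l)) ^ 4 + (max 0 (- t - l)) ^ 4"
    "\<bar>4 * (max 0 (t - l)) ^ 3 - 4 * (max 0 (- t - l)) ^ 3\<bar> = 4 * (max 0 (\<bar>t\<bar> - l)) ^ 3"
    "((\<lambda>t. (max 0 (t - l)) ^ 4 + (max 0 (- t - l)) ^ 4) has_real_derivative
      4 * (max 0 (t - l)) ^ 3 - 4 * (max 0 (- t - l)) ^ 3) (at t)"
proof -
  consider "t > l" | "t < - l" | "\<bar>t\<bar> \<le> l" by linarith
  then have "(max 0 (\<bar>t\<bar> - l)) ^ 4 = (max 0 (t - l)) ^ 4 + (max 0 (- t - l)) ^ 4 \<and>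
     \<bar>4 * (max 0 (t - l)) ^ 3 - 4 * (max 0 (- t - l)) ^ 3\<bar> = 4 * (max 0 (\<bar>t\<bar> - l)) ^ 3"
  proof cases
    case 1
    then have "max 0 (\<bar>t\<bar> - l) = t - l" "max 0 (t - l) = t - l" "max 0 (- t - l) = 0" using assms by auto
    then show ?thesis using 1 by (simp add: abs_mult)
  next
    case 2
    then have "max 0 (\<bar>t\<bar> - l) = - t - l" "max 0 (t - l) = 0" "max 0 (- t - l) = - t - l" using assms by auto
    then show ?thesis using 2 by (simp add: abs_mult)
  next
    case 3
    then have "max 0 (\<bar>t\<bar> - l) = 0" "max 0 (t - l) = 0" "max 0 (- t - l) = 0" using assms by auto
    then show ?thesis by simp
  qed
  then show "(max 0 (\<bar>t\<bar> - l)) ^ 4 = (max 0 (t - l)) ^ 4 + (max 0 (- t - l)) ^ 4"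
    "\<bar>4 * (max 0 (t - l)) ^ 3 - 4 * (max 0 (- t - l)) ^ 3\<bar> = 4 * (max 0 (\<bar>t\<bar> - l)) ^ 3" by blast+
  have D: "((\<lambda>t::real. (max 0 t) ^ 4) has_real_derivative 4 * (max 0 t) ^ 3) (at t)" for t
    using DERIV_max_0_power[of 2 t] by simp
  have 1: "((\<lambda>t. (max 0 (t - l)) ^ 4) has_real_derivative 4 * (max 0 (t - l)) ^ 3 * 1) (at t)"
    by (rule DERIV_chain2[OF D]) (auto intro!: derivative_eq_intros)
  have 2: "((\<lambda>t. (max 0 (- t - l)) ^ 4) has_real_derivative 4 * (max 0 (- t - l)) ^ 3 * (-1)) (at t)"
    by (rule DERIV_chain2[OF D]) (auto intro!: derivative_eq_intros)
  show "((\<lambda>t. (max 0 (t - l)) ^ 4 + (max 0 (- t - l)) ^ 4) has_real_derivative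
      4 * (max 0 (t - l)) ^ 3 - 4 * (max 0 (- t - l)) ^ 3) (at t)"
    by (rule DERIV_cong[OF DERIV_add[OF 1 2]]) simp
qed

text \<open>Let W = max(0, |f| - l) and s be the integral of W^6. \<open>Gagliardo_Nirenberg\<close>
  for F = W^4, G = W^6 and Cauchy-Schwarz for |partial_i W^4| = 4 W^3 |partial_i f| give s <= (16 s
  d)^(3/4), that is s^4 <= 4096 d^3 s^3. The truncation gives W bounded support; hence s is finite
  and s^3 may be cancelled.\<close>

lemma Sobolev_truncated:
  fixes f :: "real^3 \<Rightarrow> real"
  assumes f: "\<And>x. f differentiable (at x)" and cont: "\<And>i. continuous_on UNIV (partial i f)"
    and lim: "(f \<longlongrightarrow> 0) at_infinity" and l: "l > 0" and d: "d \<ge> 0"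
    and D: "(\<integral>\<^sup>+x. ennreal (\<Sum>i\<in>UNIV. (partial i f x)\<^sup>2) * indicator {x. f x \<noteq> 0} x \<partial>lborel) \<le> ennreal d"
  shows "(\<integral>\<^sup>+x. ennreal ((max 0 (\<bar>f x\<bar> - l)) ^ 6) \<partial>lborel) \<le> ennreal (4096 * d ^ 3)"
proof -
  define W where "W x = max 0 (\<bar>f x\<bar> - l)" for x
  have W0: "W x \<ge> 0" for x by (simp add: W_def)
  have contf: "continuous_on UNIV f"
    using f by (simp add: continuous_on_eq_continuous_at differentiable_imp_continuous_within)
  have contW: "continuous_on UNIV W" unfolding W_def by (intro continuous_intros contf)
  have [measurable]: "f \<in> borel_measurable borel" "W \<in> borel_measurable borel" "partial i f \<in> borel_measurable borel" for i
    using contf contW cont by (auto intro: borel_measurable_continuous_onI)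
  have "{x. W x \<noteq> 0} \<subseteq> {x. norm (f x) > l}" by (auto simp: W_def)
  then have suppW: "bounded {x. W x \<noteq> 0}"
    using bounded_subset[OF bounded_superlevel_at_infinity[OF lim l]] by blast
  define \<psi> where "\<psi> t = 4 * (max 0 (t - l)) ^ 3 - 4 * (max 0 (- t - l)) ^ 3" for t
  have F_eq: "(\<lambda>x. W x ^ 4) = (\<lambda>x. (max 0 (f x - l)) ^ 4 + (max 0 (- f x - l)) ^ 4)"
    unfolding W_def by (rule ext) (rule truncated_power4[OF l])
  have Fd: "(\<lambda>x. W x ^ 4) differentiable (at x)" for x
    unfolding F_eq by (rule differentiable_compose_real[OF f truncated_power4(3)[OF l]])
  have Fp: "partial i (\<lambda>x. W x ^ 4) = (\<lambda>x. \<psi> (f x) * partial i f x)" for i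
    unfolding F_eq \<psi>_def by (rule ext) (rule partial_compose[OF f truncated_power4(3)[OF l]])
  have Fabs: "\<bar>partial i (\<lambda>x. W x ^ 4) x\<bar> = 4 * W x ^ 3 * \<bar>partial i f x\<bar>" for i x
    unfolding Fp abs_mult \<psi>_def by (simp only: truncated_power4(2)[OF l] W_def)
  obtain R where R: "\<And>x. W x \<noteq> 0 \<Longrightarrow> norm x \<le> R" using suppW by (auto simp: bounded_iff)
  have "integrable lborel (\<lambda>x. W x ^ 6)"
    by (rule continuous_bounded_support_integrable[of _ R]) (use R in \<open>auto intro!: continuous_intros contW\<close>)
  then obtain s where s: "(\<integral>\<^sup>+x. ennreal (W x ^ 6) \<partial>lborel) = ennreal s" "s \<ge> 0"
    using nn_integral_eq_integral[of lborel "\<lambda>x. W x ^ 6"] by (auto simp: integral_nonneg_AE)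
  \<comment> \<open>K = (16 s d)^(1/4) bounds each of the three square roots in the
    Gagliardo-Nirenberg estimate.\<close>
  define K where "K = (16 * s * d) powr (1/4)"
  have K: "K \<ge> 0" "K ^ 4 = 16 * s * d"
    using s d powr_power[of "16 * s * d" "1/4" 4] by (cases "16 * s * d = 0"; auto simp: K_def)+
  have J: "ennsqrt (\<integral>\<^sup>+x. ennreal \<bar>partial i (\<lambda>x. W x ^ 4) x\<bar> \<partial>lborel) \<le> ennreal K" for i
  proof -
    have "(\<integral>\<^sup>+x. ennreal \<bar>partial i (\<lambda>x. W x ^ 4) x\<bar> \<partial>lborel) =
        (\<integral>\<^sup>+x. ennreal (4 * W x ^ 3) * (ennreal \<bar>partial i f x\<bar> * indicator {x. f x \<noteq> 0} x) \<partial>lborel)"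
      \<comment> \<open>W vanishes where f = 0, so the indicator may be inserted; only the gradient
        on {f /= 0} is charged.\<close>
      unfolding Fabs using l W0 by (intro nn_integral_cong) (auto simp: indicator_def W_def ennreal_mult)
    also have "\<dots> \<le> ennsqrt (\<integral>\<^sup>+x. (ennreal (4 * W x ^ 3))\<^sup>2 \<partial>lborel)
        * ennsqrt (\<integral>\<^sup>+x. (ennreal \<bar>partial i f x\<bar> * indicator {x. f x \<noteq> 0} x)\<^sup>2 \<partial>lborel)"
      by (rule nn_integral_Cauchy_Schwarz) measurable
    also have "(\<integral>\<^sup>+x. (ennreal (4 * W x ^ 3))\<^sup>2 \<partial>lborel) = (\<integral>\<^sup>+x. ennreal 16 * ennreal (W x ^ 6) \<partial>lborel)"
      using W0 by (intro nn_integral_cong) (simp add: ennreal_power power_mult_distrib ennreal_mult flip: power_mult)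
    also have "\<dots> = ennreal (16 * s)"
      using s by (subst nn_integral_cmult) (auto simp: ennreal_mult)
    also have "(\<integral>\<^sup>+x. (ennreal \<bar>partial i f x\<bar> * indicator {x. f x \<noteq> 0} x)\<^sup>2 \<partial>lborel) \<le> ennreal d"
    proof (rule order_trans[OF nn_integral_mono D])
      fix x
      have "(partial i f x)\<^sup>2 \<le> (\<Sum>i\<in>UNIV. (partial i f x)\<^sup>2)"
        by (rule member_le_sum) auto
      then show "(ennreal \<bar>partial i f x\<bar> * indicator {x. f x \<noteq> 0} x)\<^sup>2
        \<le> ennreal (\<Sum>i\<in>UNIV. (partial i f x)\<^sup>2) * indicator {x. f x \<noteq> 0} x"
        by (auto simp: indicator_def ennreal_power intro!: ennreal_leI)
    qed
    finally have "(\<integral>\<^sup>+x. ennreal \<bar>partial i (\<lambda>x. W x ^ 4) x\<bar> \<partial>lborel) \<le> ennsqrt (ennreal (16 * s)) * ennsqrt (ennreal d)"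
      by (simp add: ennpowr_mono mult_left_mono)
    then have "ennsqrt (\<integral>\<^sup>+x. ennreal \<bar>partial i (\<lambda>x. W x ^ 4) x\<bar> \<partial>lborel) \<le> ennsqrt (ennsqrt (ennreal (16 * s * d)))"
      using s d by (intro ennpowr_mono) (auto simp: ennreal_mult ennpowr_mult)
    then show ?thesis using s d by (simp add: K_def powr_powr)
  qed
  have "ennreal s \<le> ennsqrt (\<integral>\<^sup>+v. ennreal \<bar>partial 1 (\<lambda>x. W x ^ 4) v\<bar> \<partial>lborel)
     * ennsqrt (\<integral>\<^sup>+v. ennreal \<bar>partial 2 (\<lambda>x. W x ^ 4) v\<bar> \<partial>lborel)
     * ennsqrt (\<integral>\<^sup>+v. ennreal \<bar>partial 3 (\<lambda>x. W x ^ 4) v\<bar> \<partial>lborel)"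
    unfolding s(1)[symmetric]
  proof (rule Gagliardo_Nirenberg[OF Fd])
    show "continuous_on UNIV (partial i (\<lambda>x. W x ^ 4))" for i
      unfolding Fp \<psi>_def by (intro continuous_intros contf cont)
    show "bounded {x. W x ^ 4 \<noteq> 0}" using suppW by simp
  qed (auto simp: W0 simp flip: power_mult)
  also have "\<dots> \<le> ennreal K * ennreal K * ennreal K"
    by (intro mult_mono J) auto
  finally have "s \<le> K ^ 3"
    using K by (simp add: power3_eq_cube flip: ennreal_mult)
  then have "s ^ 4 \<le> (K ^ 3) ^ 4" using s by (intro power_mono) auto
  also have "\<dots> = (K ^ 4) ^ 3" by (simp flip: power_mult)
  also have "\<dots> = (4096 * d ^ 3) * s ^ 3" by (simp add: K power_mult_distrib)
  finally have *: "s * s ^ 3 \<le> (4096 * d ^ 3) * s ^ 3" by (simp add: power4_eq_xxxx power3_eq_cube)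
  have "s \<le> 4096 * d ^ 3"
  proof (cases "s = 0")
    case False
    with s have "s ^ 3 > 0" by simp
    with * show ?thesis by (rule mult_right_le_imp_le)
  qed (use d in simp)
  then have "ennreal s \<le> ennreal (4096 * d ^ 3)" by (rule ennreal_leI)
  then show ?thesis unfolding s(1)[symmetric] W_def .
qed

text \<open>Hoelder with exponents 3/2 and 3 for V and the square of the truncated f; Fatou's lemma
  then removes the truncation. The factor 16 is the cube root of 4096.\<close>

lemma Sobolev_potential:
  fixes f V :: "real^3 \<Rightarrow> real"
  assumes f: "\<And>x. f differentiable (at x)" and cont: "\<And>i. continuous_on UNIV (partial i f)"
    and lim: "(f \<longlongrightarrow> 0) at_infinity" and d: "d \<ge> 0"
    and D: "(\<integral>\<^sup>+x. ennreal (\<Sum>i\<in>UNIV. (partial i f x)\<^sup>2) * indicator {x. f x \<noteq> 0} x \<partial>lborel) \<le> ennreal d"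
    and V[measurable]: "V \<in> borel_measurable borel" and V0: "\<And>x. V x \<ge> 0"
  shows "(\<integral>\<^sup>+x. ennreal (V x * (f x)\<^sup>2) \<partial>lborel)
    \<le> ennpowr (\<integral>\<^sup>+x. ennreal (V x powr (3/2)) \<partial>lborel) (2/3) * ennreal (16 * d)"
proof -
  have contf: "continuous_on UNIV f"
    using f by (simp add: continuous_on_eq_continuous_at differentiable_imp_continuous_within)
  then have [measurable]: "f \<in> borel_measurable borel" by (rule borel_measurable_continuous_onI)
  define W where "W n x = max 0 (\<bar>f x\<bar> - inverse (real (Suc n)))" for n x
  have [measurable]: "W n \<in> borel_measurable borel" for n unfolding W_def by measurable
  have W0: "W n x \<ge> 0" for n x by (simp add: W_def)
  let ?R = "ennpowr (\<integral>\<^sup>+x. ennreal (V x powr (3/2)) \<partial>lborel) (2/3) * ennreal (16 * d)"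
  have bound: "(\<integral>\<^sup>+x. ennreal (V x * (W n x)\<^sup>2) \<partial>lborel) \<le> ?R" for n
  proof -
    have W3: "ennpowr (ennreal ((W n x)\<^sup>2)) 3 = ennreal (W n x ^ 6)" for x
      using ennpowr_power[of 3 "ennreal ((W n x)\<^sup>2)"] by (simp add: ennreal_power flip: power_mult)
    have "(\<integral>\<^sup>+x. ennreal (V x * (W n x)\<^sup>2) \<partial>lborel) = (\<integral>\<^sup>+x. ennreal (V x) * ennreal ((W n x)\<^sup>2) \<partial>lborel)"
      using V0 by (simp add: ennreal_mult)
    also have "\<dots> \<le> ennpowr (\<integral>\<^sup>+x. ennpowr (ennreal (V x)) (3/2) \<partial>lborel) (1/(3/2))
        * ennpowr (\<integral>\<^sup>+x. ennpowr (ennreal ((W n x)\<^sup>2)) 3 \<partial>lborel) (1/3)"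
      by (rule nn_integral_Holder) (simp_all, measurable)
    also have "\<dots> = ennpowr (\<integral>\<^sup>+x. ennreal (V x powr (3/2)) \<partial>lborel) (2/3)
        * ennpowr (\<integral>\<^sup>+x. ennreal (W n x ^ 6) \<partial>lborel) (1/3)"
      using V0 by (simp add: W3 del: ennpowr_ennreal(1)) (simp add: V0)
    also have "\<dots> \<le> ennpowr (\<integral>\<^sup>+x. ennreal (V x powr (3/2)) \<partial>lborel) (2/3) * ennpowr (ennreal ((16 * d) ^ 3)) (1/3)"
      using Sobolev_truncated[OF f cont lim _ d D, of "inverse (real (Suc n))"] 
      by (intro mult_left_mono ennpowr_mono) (auto simp: W_def power_mult_distrib)
    also have "ennpowr (ennreal ((16 * d) ^ 3)) (1/3) = ennreal (16 * d)"
      using d ennpowr_power[of 3 "ennreal (16 * d)"] ennpowr_ennpowr[of "ennreal (16 * d)" 3 "1/3"]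
      by (simp add: ennreal_power)
    finally show ?thesis .
  qed
  have lim: "(\<lambda>n. ennreal (V x * (W n x)\<^sup>2)) \<longlonglongrightarrow> ennreal (V x * (f x)\<^sup>2)" for x
  proof -
    have "(\<lambda>n. ennreal (V x * (W n x)\<^sup>2)) \<longlonglongrightarrow> ennreal (V x * (max 0 (\<bar>f x\<bar> - 0))\<^sup>2)"
      unfolding W_def by (intro tendsto_intros tendsto_ennrealI LIMSEQ_inverse_real_of_nat)
    then show ?thesis by simp
  qed
  have "(\<integral>\<^sup>+x. ennreal (V x * (f x)\<^sup>2) \<partial>lborel) = (\<integral>\<^sup>+x. liminf (\<lambda>n. ennreal (V x * (W n x)\<^sup>2)) \<partial>lborel)"
    by (intro nn_integral_cong lim_imp_Liminf[symmetric] lim) simp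
  also have "\<dots> \<le> liminf (\<lambda>n. \<integral>\<^sup>+x. ennreal (V x * (W n x)\<^sup>2) \<partial>lborel)"
    by (rule nn_integral_liminf) measurable
  also have "\<dots> \<le> ?R"
    using Liminf_mono[of "\<lambda>n. \<integral>\<^sup>+x. ennreal (V x * (W n x)\<^sup>2) \<partial>lborel" "\<lambda>_. ?R" sequentially] bound
    by (simp add: Liminf_const)
  finally show ?thesis .
qed

subsection \<open>Energy identities for the head pressure\<close>

lemma nonneg_continuous_integral_eq_0:
  fixes f :: "'a::euclidean_space \<Rightarrow> real"
  assumes "continuous_on UNIV f" "\<And>x. f x \<ge> 0" "integrable lborel f" "(\<integral>x. f x \<partial>lborel) \<le> 0"
  shows "f x = 0"
proof -
  have "(\<integral>x. f x \<partial>lborel) = 0" using assms by (intro antisym) (auto simp: integral_nonneg_AE)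
  then have "AE x in lborel. f x = 0"
    using integral_nonneg_eq_0_iff_AE[OF assms(3)] assms(2) by simp
  then show ?thesis by (rule continuous_AE_eq_0[OF assms(1)])
qed

text \<open>Along the axis, a positive second derivative would make the first derivative positive
  just to the right of the maximum point, and f would exceed its maximum.\<close>

lemma second_partial_nonpos_at_max:
  fixes f :: "real^'n \<Rightarrow> real"
  assumes f: "\<And>x. f differentiable (at x)" "\<And>x. partial i f differentiable (at x)" and max: "\<And>y. f y \<le> f x"
  shows "partial i f x = 0" "partial i (partial i f) x \<le> 0"
proof -
  define g where "g s = f (x + s *\<^sub>R axis i 1)" for s
  define g' where "g' s = partial i f (x + s *\<^sub>R axis i 1)" for s
  have g: "(g has_real_derivative g' s) (at s)" for s
    unfolding g_def[abs_def] g'_def by (rule has_real_derivative_along_axis[OF f(1)])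
  have g'': "(g' has_real_derivative partial i (partial i f) x) (at 0)"
    using has_real_derivative_along_axis[OF f(2), where s=0] unfolding g'_def[abs_def] by simp
  have "g' 0 = 0"
    by (rule DERIV_local_max[OF g zero_less_one]) (simp add: g_def max)
  then show "partial i f x = 0" by (simp add: g'_def)
  show "partial i (partial i f) x \<le> 0"
  proof (rule ccontr)
    assume "\<not> ?thesis"
    then obtain d where d: "d > 0" "\<And>h. h > 0 \<Longrightarrow> h < d \<Longrightarrow> g' 0 < g' (0 + h)"
      using DERIV_pos_inc_right[OF g''] by auto
    obtain z where z: "0 < z" "z < d / 2" "g (d / 2) - g 0 = (d / 2 - 0) * g' z"
      using MVT2[of 0 "d / 2" g g'] g d by auto
    have "g' z > 0" using d(2)[of z] z \<open>g' 0 = 0\<close> d(1) by simp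
    then have "(d / 2 - 0) * g' z > 0" using d(1) by simp
    then have "g (d / 2) > g 0" using z(3) by linarith
    then show False using max[of "x + (d / 2) *\<^sub>R axis i 1"] by (simp add: g_def)
  qed
qed

context decaying_NS
begin

lemma continuous_Q: "continuous_on S Q"
  using smooth_Q by (rule smooth_continuous)

lemma continuous_u: "continuous_on S u"
  using smooth_u by (rule smooth_continuous)

lemma continuous_gradient_Q: "continuous_on S (gradient Q)"
  unfolding gradient_def[abs_def]
  by (intro continuous_on_vec_lambda smooth_continuous smooth_partial smooth_Q)

lemma continuous_curl_u: "continuous_on S (curl u)"
proof -
  have "continuous_on S (\<lambda>x. curl u x $ i)" for i
  proof -
    have "\<forall>i. continuous_on S (\<lambda>x. curl u x $ i)"
      unfolding forall_3 vorticity_components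
      by (intro conjI continuous_intros smooth_continuous smooth_DU)
    then show ?thesis by blast
  qed
  then have "continuous_on S (\<lambda>x. \<chi> i. curl u x $ i)" by (intro continuous_on_vec_lambda)
  then show ?thesis by simp
qed

lemma continuous_grad_norm_sq_u: "continuous_on S (grad_norm_sq u)"
  unfolding grad_norm_sq_u[abs_def] by (intro continuous_intros smooth_continuous smooth_DU)

lemma measurable_fields [measurable]:
  "Q \<in> borel_measurable borel" "u \<in> borel_measurable borel" "gradient Q \<in> borel_measurable borel"
  "curl u \<in> borel_measurable borel" "grad_norm_sq u \<in> borel_measurable borel"
  by (intro borel_measurable_continuous_onI continuous_Q continuous_u continuous_gradient_Q
      continuous_curl_u continuous_grad_norm_sq_u)+

lemma grad_norm_sq_nonneg: "0 \<le> grad_norm_sq u x"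
  unfolding grad_norm_sq_def by (intro sum_nonneg) simp

lemma integrable_grad_norm_sq: "integrable lborel (grad_norm_sq u)"
  using finite_dirichlet by (intro integrableI_bounded) (auto simp: grad_norm_sq_nonneg)

lemma integrable_vorticity: "integrable lborel (\<lambda>x. (norm (curl u x))\<^sup>2)"
  by (rule Bochner_Integration.integrable_bound[OF integrable_mult_right[OF integrable_grad_norm_sq, of 2]])
    (auto simp: norm_vorticity_sq_le grad_norm_sq_nonneg)

text \<open>Both identities come from divergences: of \<open>\<phi>(Q) \<nabla>Q - \<Phi>(Q) u\<close> with \<open>\<Phi>' = \<phi>\<close>, and of \<open>\<phi>(Q) \<Delta>u\<close>.\<close>

lemma head_pressure_energy:
  fixes h \<phi> :: "real \<Rightarrow> real"
  assumes h: "continuous_on UNIV h" and l: "l > 0" and h0: "\<And>t. \<bar>t\<bar> \<le> l \<Longrightarrow> h t = 0"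
    and \<phi>: "\<And>t. (\<phi> has_real_derivative h t) (at t)" and \<phi>0: "\<And>t. \<bar>t\<bar> \<le> l \<Longrightarrow> \<phi> t = 0"
  shows "integrable lborel (\<lambda>x. h (Q x) * (norm (gradient Q x))\<^sup>2)"
    "integrable lborel (\<lambda>x. \<phi> (Q x) * (norm (curl u x))\<^sup>2)"
    "integrable lborel (\<lambda>x. h (Q x) * (gradient Q x \<bullet> (u x \<times> curl u x)))"
    "(\<integral>x. h (Q x) * (norm (gradient Q x))\<^sup>2 \<partial>lborel) = - (\<integral>x. \<phi> (Q x) * (norm (curl u x))\<^sup>2 \<partial>lborel)"
    "(\<integral>x. h (Q x) * (norm (gradient Q x))\<^sup>2 \<partial>lborel)
      = (\<integral>x. h (Q x) * (gradient Q x \<bullet> (u x \<times> curl u x)) \<partial>lborel)"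
proof -
  have c\<phi>: "continuous_on UNIV \<phi>"
    using \<phi> by (meson DERIV_continuous continuous_at_imp_continuous_on)
  \<comment> \<open>A second primitive is possible because \<open>\<phi>\<close> too vanishes on
    [-l, l].\<close>
  obtain \<Phi> where \<Phi>: "\<And>t. (\<Phi> has_real_derivative \<phi> t) (at t)" and \<Phi>0: "\<And>t. \<bar>t\<bar> \<le> l \<Longrightarrow> \<Phi> t = 0"
    using antiderivative_vanishing_near_0[OF c\<phi> \<phi>0] by blast
  have c\<Phi>: "continuous_on UNIV \<Phi>"
    using \<Phi> by (meson DERIV_continuous continuous_at_imp_continuous_on)
  have comp: "continuous_on UNIV (\<lambda>x. k (Q x))" if "continuous_on UNIV k" for k :: "real \<Rightarrow> real"
    by (rule continuous_on_compose2[OF that continuous_Q]) auto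
  note cont = comp[OF h] comp[OF c\<phi>] comp[OF c\<Phi>] smooth_continuous[OF smooth_partial[OF smooth_Q]]
    smooth_continuous[OF smooth_partial[OF smooth_partial[OF smooth_Q]]] smooth_continuous[OF smooth_U]
    smooth_continuous[OF smooth_L] smooth_continuous[OF smooth_partial[OF smooth_L]]
    smooth_continuous[OF smooth_DU] continuous_gradient_Q continuous_u continuous_curl_u
  have bdd: "bounded {x. norm (Q x) > l}"
    by (rule bounded_superlevel_at_infinity[OF Q_infinity l])
  then obtain R where R: "\<And>x. \<bar>Q x\<bar> > l \<Longrightarrow> norm x \<le> R" by (auto simp: bounded_iff)
  have int: "integrable lborel f" if "continuous_on UNIV f" "\<And>x. \<bar>Q x\<bar> \<le> l \<Longrightarrow> f x = 0" for f :: "real^3 \<Rightarrow> real"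
    by (rule continuous_bounded_support_integrable[OF that(1), of R]) (use R that(2) in force)
  show i1: "integrable lborel (\<lambda>x. h (Q x) * (norm (gradient Q x))\<^sup>2)"
    by (rule int) (auto simp: h0 intro!: continuous_intros cont)
  show i2: "integrable lborel (\<lambda>x. \<phi> (Q x) * (norm (curl u x))\<^sup>2)"
    by (rule int) (auto simp: \<phi>0 intro!: continuous_intros cont)
  show i3: "integrable lborel (\<lambda>x. h (Q x) * (gradient Q x \<bullet> (u x \<times> curl u x)))"
    by (rule int) (auto simp: h0 intro!: continuous_intros continuous_on_cross cont)
  note sd = smooth_differentiable[OF smooth_Q] smooth_differentiable[OF smooth_U] smooth_differentiable[OF smooth_L]
    smooth_differentiable[OF smooth_partial[OF smooth_Q]]
  note dQ = differentiable_compose_real[OF smooth_differentiable[OF smooth_Q] \<phi>]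
    differentiable_compose_real[OF smooth_differentiable[OF smooth_Q] \<Phi>]
  have p\<phi>: "partial i (\<lambda>x. \<phi> (Q x)) x = h (Q x) * partial i Q x" for i x
    by (rule partial_compose[OF sd(1) \<phi>])
  have p\<Phi>: "partial i (\<lambda>x. \<Phi> (Q x)) x = \<phi> (Q x) * partial i Q x" for i x
    by (rule partial_compose[OF sd(1) \<Phi>])
  have norm_grad: "(norm (gradient Q x))\<^sup>2 = (\<Sum>j\<in>UNIV. partial j Q x * partial j Q x)" for x
    by (simp add: power2_norm_eq_inner inner_vec_def gradient_def)
  define F where "F j x = \<phi> (Q x) * partial j Q x - \<Phi> (Q x) * U j x" for j x
  have pF: "partial j (F j) x = (\<phi> (Q x) * partial j (partial j Q) x + h (Q x) * partial j Q x * partial j Q x)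
      - (\<Phi> (Q x) * DU j j x + \<phi> (Q x) * partial j Q x * U j x)" for j x
    unfolding F_def[abs_def]
    by (simp add: partial_diff partial_mult p\<phi> p\<Phi> dQ sd differentiable_mult)
  have "(\<integral>x. (\<Sum>j\<in>UNIV. partial j (F j) x) \<partial>lborel) = 0"
  proof (rule integral_divergence_bounded_support)
    show "F i differentiable (at x)" for i x
      unfolding F_def[abs_def] by (intro differentiable_diff differentiable_mult dQ sd)
    show "continuous_on UNIV (partial i (F i))" for i
      unfolding pF[abs_def] by (intro continuous_intros cont)
    show "bounded {x. F i x \<noteq> 0}" for i
    proof (rule bounded_subset[OF bdd], clarify)
      fix x assume "F i x \<noteq> 0"
      then show "l < norm (Q x)" using \<phi>0[of "Q x"] \<Phi>0[of "Q x"] by (cases "\<bar>Q x\<bar> \<le> l") (auto simp: F_def)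
    qed
  qed
  \<comment> \<open>The transport term \<open>\<phi>\<close>(Q) u . grad Q coming from
    \<open>head_pressure_equation\<close> is cancelled by the divergence of \<open>\<Phi>\<close>(Q)
    u, as div u = 0.\<close>
  moreover have "(\<Sum>j\<in>UNIV. partial j (F j) x) = h (Q x) * (norm (gradient Q x))\<^sup>2 + \<phi> (Q x) * (norm (curl u x))\<^sup>2" for x
  proof -
    have "(\<Sum>j\<in>UNIV. partial j (F j) x) = \<phi> (Q x) * (\<Sum>j\<in>UNIV. partial j (partial j Q) x)
        + h (Q x) * (\<Sum>j\<in>UNIV. partial j Q x * partial j Q x) - \<Phi> (Q x) * (\<Sum>j\<in>UNIV. DU j j x)
        - \<phi> (Q x) * (\<Sum>j\<in>UNIV. U j x * partial j Q x)"
      unfolding pF sum_3 by (simp add: algebra_simps)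
    then show ?thesis unfolding head_pressure_equation div_u norm_grad by (simp add: algebra_simps)
  qed
  ultimately show "(\<integral>x. h (Q x) * (norm (gradient Q x))\<^sup>2 \<partial>lborel) = - (\<integral>x. \<phi> (Q x) * (norm (curl u x))\<^sup>2 \<partial>lborel)"
    using i1 i2 by simp
  define F' where "F' j x = \<phi> (Q x) * L j x" for j x
  have pF': "partial j (F' j) x = \<phi> (Q x) * partial j (L j) x + h (Q x) * partial j Q x * L j x" for j x
    unfolding F'_def[abs_def] by (simp add: partial_mult p\<phi> dQ sd)
  have "(\<integral>x. (\<Sum>j\<in>UNIV. partial j (F' j) x) \<partial>lborel) = 0"
  proof (rule integral_divergence_bounded_support)
    show "F' i differentiable (at x)" for i x
      unfolding F'_def[abs_def] by (intro differentiable_mult dQ sd)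
    show "continuous_on UNIV (partial i (F' i))" for i
      unfolding pF'[abs_def] by (intro continuous_intros cont)
    show "bounded {x. F' i x \<noteq> 0}" for i
    proof (rule bounded_subset[OF bdd], clarify)
      fix x assume "F' i x \<noteq> 0"
      then show "l < norm (Q x)" using \<phi>0[of "Q x"] by (cases "\<bar>Q x\<bar> \<le> l") (auto simp: F'_def)
    qed
  qed
  \<comment> \<open>Since div Laplace u = 0, only h(Q) grad Q . Laplace u remains, and Laplace u is
    grad Q - u x omega.\<close>
  moreover have "(\<Sum>j\<in>UNIV. partial j (F' j) x) =
      h (Q x) * (norm (gradient Q x))\<^sup>2 - h (Q x) * (gradient Q x \<bullet> (u x \<times> curl u x))" for x
  proof -
    have "(\<Sum>j\<in>UNIV. partial j (F' j) x) = \<phi> (Q x) * (\<Sum>j\<in>UNIV. partial j (L j) x)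
        + h (Q x) * (\<Sum>j\<in>UNIV. partial j Q x * L j x)"
      unfolding pF' sum_3 by (simp add: algebra_simps)
    also have "(\<Sum>j\<in>UNIV. partial j Q x * L j x) = gradient Q x \<bullet> (\<chi> j. L j x)"
      by (simp add: inner_vec_def gradient_def)
    also have "(\<chi> j. L j x) = gradient Q x - u x \<times> curl u x"
      using gradient_Q[of x] by (simp add: algebra_simps)
    finally show ?thesis by (simp add: div_L inner_diff_right power2_norm_eq_inner algebra_simps)
  qed
  ultimately show "(\<integral>x. h (Q x) * (norm (gradient Q x))\<^sup>2 \<partial>lborel)
      = (\<integral>x. h (Q x) * (gradient Q x \<bullet> (u x \<times> curl u x)) \<partial>lborel)"
    using i1 i3 by simp
qed

text \<open>A maximum principle by energy. For \<open>\<phi>\<close> the square of max(0, t - l),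
  the integral of h(Q) |grad Q|^2 is nonnegative and also equals minus a nonnegative integral. So
  \<open>\<phi>\<close>(Q) has zero gradient, is constant, and is 0 by decay; hence Q <= l for every
  l > 0.\<close>

lemma head_pressure_nonpos: "Q x \<le> 0"
proof (rule field_le_epsilon)
  fix l :: real assume l: "l > 0"
  define \<phi> where "\<phi> t = (max 0 (t - l))\<^sup>2" for t
  define h where "h t = 2 * max 0 (t - l)" for t
  have \<phi>: "(\<phi> has_real_derivative h t) (at t)" for t
    unfolding \<phi>_def h_def by (rule DERIV_max_0_square)
  have ch: "continuous_on UNIV h" unfolding h_def by (intro continuous_intros)
  note E = head_pressure_energy[OF ch l _ \<phi>]
  have 0: "h t = 0" "\<phi> t = 0" if "\<bar>t\<bar> \<le> l" for t using that by (auto simp: h_def \<phi>_def)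
  have "h (Q x) * (norm (gradient Q x))\<^sup>2 = 0" for x
  proof (rule nonneg_continuous_integral_eq_0[where f="\<lambda>x. h (Q x) * (norm (gradient Q x))\<^sup>2"])
    show "continuous_on UNIV (\<lambda>x. h (Q x) * (norm (gradient Q x))\<^sup>2)"
      unfolding h_def by (intro continuous_intros continuous_Q continuous_gradient_Q)
    show "0 \<le> h (Q x) * (norm (gradient Q x))\<^sup>2" for x by (simp add: h_def)
    show "integrable lborel (\<lambda>x. h (Q x) * (norm (gradient Q x))\<^sup>2)" using E(1)[OF 0] by blast
    have "(\<integral>x. h (Q x) * (norm (gradient Q x))\<^sup>2 \<partial>lborel) = - (\<integral>x. \<phi> (Q x) * (norm (curl u x))\<^sup>2 \<partial>lborel)"
      using E(4)[OF 0] by blast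
    moreover have "(\<integral>x. \<phi> (Q x) * (norm (curl u x))\<^sup>2 \<partial>lborel) \<ge> 0"
      by (simp add: integral_nonneg_AE \<phi>_def)
    ultimately show "(\<integral>x. h (Q x) * (norm (gradient Q x))\<^sup>2 \<partial>lborel) \<le> 0" by simp
  qed
  then have "h (Q x) * partial i Q x = 0" for i x
    by (auto simp: gradient_def vec_eq_iff)
  then have p0: "partial i (\<lambda>x. \<phi> (Q x)) x = 0" for i x
    by (simp add: partial_compose[OF smooth_differentiable[OF smooth_Q] \<phi>])
  have const: "\<phi> (Q x) = \<phi> (Q y)" for x y
    by (rule zero_partials_imp_constant[where f="\<lambda>x. \<phi> (Q x)", OF _ p0])
      (rule differentiable_compose_real[OF smooth_differentiable[OF smooth_Q] \<phi>])
  have "((\<lambda>x. \<phi> (Q x)) \<longlongrightarrow> (max 0 (0 - l))\<^sup>2) at_infinity"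
    unfolding \<phi>_def by (intro tendsto_intros Q_infinity)
  then have "((\<lambda>x. \<phi> (Q x)) \<longlongrightarrow> 0) at_infinity" using l by simp
  from constant_at_infinity_eq_0[OF this const] have "\<phi> (Q x) = 0" .
  then show "Q x \<le> 0 + l" by (auto simp: \<phi>_def max_def split: if_splits)
qed

text \<open>At such a maximum grad Q = 0 and Laplace Q <= 0, and
  \<open>head_pressure_equation\<close> leaves |omega|^2 <= 0.\<close>

lemma vorticity_eq_0_if_head_pressure_eq_0:
  assumes "Q x = 0"
  shows "curl u x = 0"
proof -
  have "partial j Q x = 0" "partial j (partial j Q) x \<le> 0" for j
    using second_partial_nonpos_at_max[of Q j x] head_pressure_nonpos assms
      smooth_differentiable[OF smooth_Q] smooth_differentiable[OF smooth_partial[OF smooth_Q]] by auto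
  then have "(norm (curl u x))\<^sup>2 \<le> 0"
    using head_pressure_equation[of x] sum_nonpos[of UNIV "\<lambda>j. partial j (partial j Q) x"] by simp
  then show ?thesis by simp
qed

end

subsection \<open>The Dirichlet integral and the enstrophy\<close>

text \<open>A cut-off in t = |u|^2 with values in [0, 1] and continuous derivative, zero for t <= l.
  The rational form lets t times the derivative stay bounded uniformly in l and tend to 0 with
  l.\<close>

definition cutoff :: "real \<Rightarrow> real \<Rightarrow> real"
  where "cutoff l t = (max 0 (t - l))\<^sup>2 / ((max 0 (t - l))\<^sup>2 + l\<^sup>2)"

definition cutoff_deriv :: "real \<Rightarrow> real \<Rightarrow> real"
  where "cutoff_deriv l t = 2 * max 0 (t - l) * l\<^sup>2 / ((max 0 (t - l))\<^sup>2 + l\<^sup>2)\<^sup>2"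

lemma cutoff_denominator_pos: "l > 0 \<Longrightarrow> (max 0 (t - l))\<^sup>2 + (l::real)\<^sup>2 > 0"
  by (simp add: add_nonneg_pos)

lemma DERIV_cutoff:
  assumes "l > 0"
  shows "(cutoff l has_real_derivative cutoff_deriv l t) (at t)"
proof -
  note r = DERIV_max_0_square[of l t]
  let ?r = "max 0 (t - l)"
  have D: "(cutoff l has_real_derivative
      (2 * ?r * (?r\<^sup>2 + l\<^sup>2) - ?r\<^sup>2 * (2 * ?r + 0)) / ((?r\<^sup>2 + l\<^sup>2) * (?r\<^sup>2 + l\<^sup>2))) (at t)"
    unfolding cutoff_def[abs_def]
    by (rule DERIV_divide[OF r DERIV_add[OF r DERIV_const]]) (use assms in simp)
  have eq: "(2 * r * D - r\<^sup>2 * (2 * r + 0)) / (D * D) = 2 * r * l\<^sup>2 / D\<^sup>2" if "D = r\<^sup>2 + l\<^sup>2" for r D :: real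
  proof -
    have "2 * r * D - r\<^sup>2 * (2 * r + 0) = 2 * r * l\<^sup>2"
      unfolding that by (simp add: algebra_simps power2_eq_square)
    then show ?thesis by (simp only: power2_eq_square[of D])
  qed
  show ?thesis unfolding cutoff_deriv_def by (rule DERIV_cong[OF D eq[OF refl]])
qed

lemma continuous_cutoff_deriv: "l > 0 \<Longrightarrow> continuous_on UNIV (cutoff_deriv l)"
  unfolding cutoff_deriv_def[abs_def]
  by (intro continuous_intros) (metis cutoff_denominator_pos less_irrefl zero_eq_power2)

lemma cutoff_bounds: "0 \<le> cutoff l t" "cutoff l t \<le> 1"
proof -
  have "0 \<le> a / (a + b)" "a / (a + b) \<le> 1" if "0 \<le> a" "0 \<le> b" for a b :: real
    using that by (auto simp: divide_le_eq_1)
  then show "0 \<le> cutoff l t" "cutoff l t \<le> 1"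
    unfolding cutoff_def by simp_all
qed

text \<open>With r = t - l > 0 and D = r^2 + l^2, the product is 2 (r + l) r l^2 / D^2; the constant
  comes from 2 (r + l) r <= 3 D and l^2 <= D. It does not depend on l, which dominated convergence
  requires.\<close>

lemma cutoff_deriv_bounds:
  assumes "l > 0" "t \<ge> 0"
  shows "0 \<le> cutoff_deriv l t" "t * cutoff_deriv l t \<le> 3"
proof -
  let ?r = "max 0 (t - l)"
  show nonneg: "0 \<le> cutoff_deriv l t" unfolding cutoff_deriv_def by simp
  have pos: "?r\<^sup>2 + l\<^sup>2 > 0" by (rule cutoff_denominator_pos[OF assms(1)])
  show "t * cutoff_deriv l t \<le> 3"
  proof (cases "t \<le> l")
    case False
    then have t: "t = ?r + l" by simp
    have "(2 * (r + l) * r) * l\<^sup>2 \<le> (3 * (r\<^sup>2 + l\<^sup>2)) * (r\<^sup>2 + l\<^sup>2)" for r :: real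
    proof (rule mult_mono)
      have "2 * (r + l) * r = 2 * r\<^sup>2 + 2 * r * l" by (simp add: algebra_simps power2_eq_square)
      then show "2 * (r + l) * r \<le> 3 * (r\<^sup>2 + l\<^sup>2)"
        using sum_squares_bound[of r l] zero_le_power2[of l] unfolding distrib_left by linarith
    qed auto
    note this[of ?r]
    moreover have div: "X / D\<^sup>2 \<le> 3" if "X \<le> (3 * D) * D" "D > 0" for X D :: real
      using that by (simp add: pos_divide_le_eq power2_eq_square mult.assoc)
    ultimately
    have "(2 * (?r + l) * ?r) * l\<^sup>2 / (?r\<^sup>2 + l\<^sup>2)\<^sup>2 \<le> 3"
      using div[OF _ pos] by blast
    moreover have "t * cutoff_deriv l t = (2 * (?r + l) * ?r) * l\<^sup>2 / (?r\<^sup>2 + l\<^sup>2)\<^sup>2"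
      using t by (simp add: cutoff_deriv_def mult.assoc mult.left_commute)
    ultimately show ?thesis by simp
  qed (simp add: cutoff_deriv_def)
qed

lemma cutoff_limits:
  fixes l :: "nat \<Rightarrow> real"
  assumes l: "l \<longlonglongrightarrow> 0" "\<And>n. l n > 0" and t: "t \<ge> 0"
  shows "(\<lambda>n. cutoff (l n) t) \<longlonglongrightarrow> (if t = 0 then 0 else 1)" "(\<lambda>n. t * cutoff_deriv (l n) t) \<longlonglongrightarrow> 0"
proof -
  have "(\<lambda>n. cutoff (l n) t) \<longlonglongrightarrow> (if t = 0 then 0 else 1) \<and> (\<lambda>n. t * cutoff_deriv (l n) t) \<longlonglongrightarrow> 0"
  proof (cases "t = 0")
    case True
    have "max 0 (0 - l n) = 0" for n using l(2)[of n] by simp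
    then show ?thesis using True by (simp add: cutoff_def)
  next
    case False
    then have t0: "max 0 (t - 0) = t" "(max 0 (t - 0))\<^sup>2 + 0\<^sup>2 \<noteq> 0" "((max 0 (t - 0))\<^sup>2 + 0\<^sup>2)\<^sup>2 \<noteq> 0" using t by auto
    have "(\<lambda>n. cutoff (l n) t) \<longlonglongrightarrow> (max 0 (t - 0))\<^sup>2 / ((max 0 (t - 0))\<^sup>2 + 0\<^sup>2)"
      unfolding cutoff_def by (intro tendsto_intros l t0)
    moreover have "(\<lambda>n. t * cutoff_deriv (l n) t) \<longlonglongrightarrow> t * (2 * max 0 (t - 0) * 0\<^sup>2 / ((max 0 (t - 0))\<^sup>2 + 0\<^sup>2)\<^sup>2)"
      unfolding cutoff_deriv_def by (intro tendsto_intros l t0)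
    ultimately show ?thesis using False t by simp
  qed
  then show "(\<lambda>n. cutoff (l n) t) \<longlonglongrightarrow> (if t = 0 then 0 else 1)" "(\<lambda>n. t * cutoff_deriv (l n) t) \<longlonglongrightarrow> 0"
    by blast+
qed

context decaying_NS
begin

lemma norm_u_sq: "(norm (u x))\<^sup>2 = (\<Sum>j\<in>UNIV. U j x * U j x)"
  by (simp add: power2_norm_eq_inner inner_vec_def)

lemma smooth_norm_u_sq: "smooth (\<lambda>x. (norm (u x))\<^sup>2)"
  unfolding norm_u_sq by (intro smooth_sum smooth_mult smooth_U)

lemma partial_norm_u_sq: "partial i (\<lambda>x. (norm (u x))\<^sup>2) x = 2 * (\<Sum>k\<in>UNIV. U k x * DU i k x)"
  unfolding norm_u_sq
  by (simp add: partial_sum partial_mult smooth_differentiable smooth_U smooth_mult sum_distrib_left mult.commute)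

text \<open>The two inner sums are the Jacobian and its transpose applied to u. Each has squared
  length at most |u|^2 |grad u|^2, and 2 |a b| <= a^2 + b^2 bounds their scalar product.\<close>

lemma sum_abs_product_le_norm_u_sq:
  "\<bar>\<Sum>i\<in>UNIV. (\<Sum>k\<in>UNIV. U k x * DU i k x) * (\<Sum>k\<in>UNIV. U k x * DU k i x)\<bar>
    \<le> (norm (u x))\<^sup>2 * grad_norm_sq u x"
proof -
  define a b where "a i = (\<Sum>k\<in>UNIV. U k x * DU i k x)" and "b i = (\<Sum>k\<in>UNIV. U k x * DU k i x)" for i
  have "(\<Sum>i\<in>UNIV. (a i)\<^sup>2) \<le> (\<Sum>i\<in>UNIV. (norm (u x))\<^sup>2 * (\<Sum>k\<in>UNIV. (DU i k x)\<^sup>2))"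
    unfolding a_def norm_u_sq
    using Cauchy_Schwarz_ineq_sum[of "\<lambda>k. U k x" _ UNIV] by (intro sum_mono) (simp add: power2_eq_square)
  also have "\<dots> = (norm (u x))\<^sup>2 * grad_norm_sq u x"
    by (simp add: grad_norm_sq_u power2_eq_square flip: sum_distrib_left)
  finally have a: "(\<Sum>i\<in>UNIV. (a i)\<^sup>2) \<le> (norm (u x))\<^sup>2 * grad_norm_sq u x" .
  have "(\<Sum>i\<in>UNIV. (b i)\<^sup>2) \<le> (\<Sum>i\<in>UNIV. (norm (u x))\<^sup>2 * (\<Sum>k\<in>UNIV. (DU k i x)\<^sup>2))"
    unfolding b_def norm_u_sq
    using Cauchy_Schwarz_ineq_sum[of "\<lambda>k. U k x" _ UNIV] by (intro sum_mono) (simp add: power2_eq_square)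
  also have "\<dots> = (norm (u x))\<^sup>2 * (\<Sum>i\<in>UNIV. \<Sum>k\<in>UNIV. (DU k i x)\<^sup>2)"
    by (simp flip: sum_distrib_left)
  also have "(\<Sum>i\<in>UNIV. \<Sum>k\<in>UNIV. (DU k i x)\<^sup>2) = grad_norm_sq u x"
    by (subst sum.swap) (simp add: grad_norm_sq_u power2_eq_square)
  finally have b: "(\<Sum>i\<in>UNIV. (b i)\<^sup>2) \<le> (norm (u x))\<^sup>2 * grad_norm_sq u x" .
  have "2 * \<bar>\<Sum>i\<in>UNIV. a i * b i\<bar> \<le> 2 * (\<Sum>i\<in>UNIV. \<bar>a i * b i\<bar>)"
    by simp
  also have "\<dots> \<le> (\<Sum>i\<in>UNIV. (a i)\<^sup>2 + (b i)\<^sup>2)"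
    unfolding sum_distrib_left
  proof (rule sum_mono)
    fix i show "2 * \<bar>a i * b i\<bar> \<le> (a i)\<^sup>2 + (b i)\<^sup>2"
      using zero_le_power2[of "\<bar>a i\<bar> - \<bar>b i\<bar>"] by (simp add: power2_diff abs_mult)
  qed
  finally show ?thesis using a b unfolding a_def b_def by (simp add: sum.distrib)
qed

text \<open>Integrate the divergence of the cut-off times (u . grad) u. As div u = 0, the divergence
  of (u . grad) u is |grad u|^2 - |omega|^2; the derivative of the cut-off contributes an error
  bounded by \<open>sum_abs_product_le_norm_u_sq\<close>.\<close>

lemma dirichlet_cutoff_identity:
  assumes l: "l > 0"
  shows "(\<integral>x. cutoff l ((norm (u x))\<^sup>2) * grad_norm_sq u x \<partial>lborel) \<le>
    (\<integral>x. (norm (curl u x))\<^sup>2 \<partial>lborel)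
     + (\<integral>x. 2 * ((norm (u x))\<^sup>2 * cutoff_deriv l ((norm (u x))\<^sup>2)) * grad_norm_sq u x \<partial>lborel)"
proof -
  define s where "s x = (norm (u x))\<^sup>2" for x
  define F where "F i x = cutoff l (s x) * (\<Sum>j\<in>UNIV. U j x * DU j i x)" for i x
  define B where "B x = 2 * (\<Sum>i\<in>UNIV. (\<Sum>k\<in>UNIV. U k x * DU i k x) * (\<Sum>k\<in>UNIV. U k x * DU k i x))" for x
  have ss: "smooth s" unfolding s_def[abs_def] by (rule smooth_norm_u_sq)
  have ps: "partial i (\<lambda>x. cutoff l (s x)) x = cutoff_deriv l (s x) * (2 * (\<Sum>k\<in>UNIV. U k x * DU i k x))" for i x
    using partial_compose[OF smooth_differentiable[OF ss] DERIV_cutoff[OF l], of i x] partial_norm_u_sq[of i x]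
    by (simp add: s_def[abs_def])
  have ds: "(\<lambda>x. cutoff l (s x)) differentiable (at x)" for x
    by (rule differentiable_compose_real[OF smooth_differentiable[OF ss] DERIV_cutoff[OF l]])
  have sV: "smooth (\<lambda>x. \<Sum>j\<in>UNIV. U j x * DU j i x)" for i
    by (intro smooth_sum smooth_mult smooth_U smooth_DU)
  have pV: "partial i (\<lambda>x. \<Sum>j\<in>UNIV. U j x * DU j i x) x = (\<Sum>j\<in>UNIV. U j x * partial j (DU i i) x + DU i j x * DU j i x)" for i x
  proof -
    have "partial i (\<lambda>x. \<Sum>j\<in>UNIV. U j x * DU j i x) x = (\<Sum>j\<in>UNIV. partial i (\<lambda>x. U j x * DU j i x) x)"
      by (intro partial_sum smooth_differentiable smooth_mult smooth_U smooth_DU)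
    also have "\<dots> = (\<Sum>j\<in>UNIV. U j x * partial i (DU j i) x + DU i j x * DU j i x)"
      by (intro sum.cong refl partial_mult smooth_differentiable smooth_U smooth_DU)
    also have "\<dots> = (\<Sum>j\<in>UNIV. U j x * partial j (DU i i) x + DU i j x * DU j i x)"
    proof (rule sum.cong[OF refl])
      fix j show "U j x * partial i (DU j i) x + DU i j x * DU j i x = U j x * partial j (DU i i) x + DU i j x * DU j i x"
        by (subst partial_commute[OF smooth_U, of i j i]) (rule refl)
    qed
    finally show ?thesis .
  qed
  have pF: "partial i (F i) x = cutoff l (s x) * (\<Sum>j\<in>UNIV. U j x * partial j (DU i i) x + DU i j x * DU j i x)
      + cutoff_deriv l (s x) * (2 * (\<Sum>k\<in>UNIV. U k x * DU i k x)) * (\<Sum>j\<in>UNIV. U j x * DU j i x)" for i x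
    unfolding F_def[abs_def] by (subst partial_mult) (simp_all only: ds sV smooth_differentiable pV ps)
  have ccut: "continuous_on UNIV (cutoff l)"
    using DERIV_cutoff[OF l] by (meson DERIV_continuous continuous_at_imp_continuous_on)
  have cs: "continuous_on UNIV s" by (rule smooth_continuous[OF ss])
  have comp: "continuous_on UNIV (\<lambda>x. cutoff l (s x))" "continuous_on UNIV (\<lambda>x. cutoff_deriv l (s x))"
    using continuous_on_compose2[OF ccut cs] continuous_on_compose2[OF continuous_cutoff_deriv[OF l] cs] by auto
  note cont = comp smooth_continuous[OF smooth_U] smooth_continuous[OF smooth_DU]
    smooth_continuous[OF smooth_partial[OF smooth_DU]] continuous_grad_norm_sq_u continuous_curl_u cs
  have c0: "cutoff l (s x) = 0" "cutoff_deriv l (s x) = 0" if "s x \<le> l" for x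
    using that by (auto simp: cutoff_def cutoff_deriv_def)
  have "(s \<longlongrightarrow> 0) at_infinity"
  proof -
    have "(s \<longlongrightarrow> (norm (0::real^3))\<^sup>2) at_infinity" unfolding s_def[abs_def] by (intro tendsto_intros u_infinity)
    then show ?thesis by simp
  qed
  from bounded_superlevel_at_infinity[OF this l] have bdd: "bounded {x. s x > l}"
    by (simp add: s_def)
  then obtain R where R: "\<And>x. s x > l \<Longrightarrow> norm x \<le> R" by (auto simp: bounded_iff)
  have int: "integrable lborel f" if "continuous_on UNIV f" "\<And>x. s x \<le> l \<Longrightarrow> f x = 0" for f :: "real^3 \<Rightarrow> real"
    by (rule continuous_bounded_support_integrable[OF that(1), of R]) (use R that(2) in force)
  have i: "integrable lborel (\<lambda>x. cutoff l (s x) * grad_norm_sq u x)"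
    "integrable lborel (\<lambda>x. cutoff l (s x) * (norm (curl u x))\<^sup>2)"
    "integrable lborel (\<lambda>x. cutoff_deriv l (s x) * B x)"
    "integrable lborel (\<lambda>x. 2 * (s x * cutoff_deriv l (s x)) * grad_norm_sq u x)"
    unfolding B_def by (rule int; auto simp: c0 intro!: continuous_intros cont)+
  have "(\<integral>x. (\<Sum>i\<in>UNIV. partial i (F i) x) \<partial>lborel) = 0"
  proof (rule integral_divergence_bounded_support)
    show "F i differentiable (at x)" for i x
      unfolding F_def[abs_def] by (intro differentiable_mult ds smooth_differentiable sV)
    show "continuous_on UNIV (partial i (F i))" for i
      unfolding pF[abs_def] by (intro continuous_intros cont)
    show "bounded {x. F i x \<noteq> 0}" for i
    proof (rule bounded_subset[OF bdd], clarify)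
      fix x assume "F i x \<noteq> 0"
      then show "l < s x" using c0[of x] by (cases "s x \<le> l") (auto simp: F_def)
    qed
  qed
  moreover have "(\<Sum>i\<in>UNIV. partial i (F i) x) =
      cutoff l (s x) * grad_norm_sq u x - cutoff l (s x) * (norm (curl u x))\<^sup>2 + cutoff_deriv l (s x) * B x" for x
  proof -
    \<comment> \<open>This double sum is u . grad div u.\<close>
    have "(\<Sum>i\<in>UNIV. \<Sum>j\<in>UNIV. U j x * partial j (DU i i) x) = 0"
      by (subst sum.swap) (simp add: partial_div_u flip: sum_distrib_left)
    moreover have "(\<Sum>i\<in>UNIV. c * (\<Sum>j\<in>UNIV. a i j + b i j) + d * (2 * X i) * Y i) =
        c * (\<Sum>i\<in>UNIV. \<Sum>j\<in>UNIV. a i j) + c * (\<Sum>i\<in>UNIV. \<Sum>j\<in>UNIV. b i j) + d * (2 * (\<Sum>i\<in>UNIV. X i * Y i))"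
      for c d and a b :: "3 \<Rightarrow> 3 \<Rightarrow> real" and X Y :: "3 \<Rightarrow> real"
      by (simp add: sum.distrib sum_distrib_left distrib_left mult_ac)
    moreover have "(\<Sum>i\<in>UNIV. \<Sum>j\<in>UNIV. DU i j x * DU j i x) = grad_norm_sq u x - (norm (curl u x))\<^sup>2"
      unfolding norm_vorticity_sq grad_norm_sq_u by (simp add: sum_subtractf)
    ultimately show ?thesis
      unfolding pF B_def by (simp add: right_diff_distrib)
  qed
  ultimately have "(\<integral>x. cutoff l (s x) * grad_norm_sq u x \<partial>lborel) =
      (\<integral>x. cutoff l (s x) * (norm (curl u x))\<^sup>2 \<partial>lborel) - (\<integral>x. cutoff_deriv l (s x) * B x \<partial>lborel)"
    using i by simp
  moreover have "(\<integral>x. cutoff l (s x) * (norm (curl u x))\<^sup>2 \<partial>lborel) \<le> (\<integral>x. (norm (curl u x))\<^sup>2 \<partial>lborel)"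
    by (intro integral_mono i integrable_vorticity mult_left_le_one_le cutoff_bounds) simp
  moreover have "- (\<integral>x. cutoff_deriv l (s x) * B x \<partial>lborel) \<le> (\<integral>x. 2 * (s x * cutoff_deriv l (s x)) * grad_norm_sq u x \<partial>lborel)"
    unfolding Bochner_Integration.integral_minus[symmetric]
  proof (intro integral_mono i Bochner_Integration.integrable_minus)
    fix x
    have "\<bar>B x\<bar> \<le> 2 * (s x * grad_norm_sq u x)"
      using sum_abs_product_le_norm_u_sq[of x] unfolding B_def s_def by (simp add: abs_mult)
    then have "cutoff_deriv l (s x) * (- B x) \<le> cutoff_deriv l (s x) * (2 * (s x * grad_norm_sq u x))"
      using cutoff_deriv_bounds(1)[OF l, of "s x"] by (intro mult_left_mono) (auto simp: s_def)
    then show "- (cutoff_deriv l (s x) * B x) \<le> 2 * (s x * cutoff_deriv l (s x)) * grad_norm_sq u x"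
      by (simp add: mult_ac)
  qed
  ultimately show ?thesis unfolding s_def by linarith
qed

text \<open>Let l tend to 0 in \<open>dirichlet_cutoff_identity\<close>. The cut-offs converge to
  the indicator of {u /= 0}; the error tends to 0 pointwise and is dominated by 6 |grad u|^2, with 6
  twice the constant of \<open>cutoff_deriv_bounds\<close>.\<close>

lemma dirichlet_le_enstrophy:
  "(\<integral>\<^sup>+x. ennreal (grad_norm_sq u x) * indicator {x. u x \<noteq> 0} x \<partial>lborel) \<le> (\<integral>\<^sup>+x. ennreal ((norm (curl u x))\<^sup>2) \<partial>lborel)"
proof -
  define l where "l n = inverse (real (Suc n))" for n
  have l: "l \<longlonglongrightarrow> 0" "\<And>n. l n > 0" using LIMSEQ_inverse_real_of_nat unfolding l_def by auto
  have [measurable]: "cutoff m \<in> borel_measurable borel" "cutoff_deriv m \<in> borel_measurable borel" for m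
    unfolding cutoff_def[abs_def] cutoff_deriv_def[abs_def] by measurable
  have ind: "integrable lborel (\<lambda>x. grad_norm_sq u x * indicator {x. u x \<noteq> 0} x)"
    by (rule Bochner_Integration.integrable_bound[OF integrable_grad_norm_sq]) (auto simp: indicator_def)
  have 1: "(\<lambda>n. \<integral>x. cutoff (l n) ((norm (u x))\<^sup>2) * grad_norm_sq u x \<partial>lborel)
      \<longlonglongrightarrow> (\<integral>x. grad_norm_sq u x * indicator {x. u x \<noteq> 0} x \<partial>lborel)"
  proof (rule integral_dominated_convergence[where w="grad_norm_sq u"])
    show "AE x in lborel. (\<lambda>n. cutoff (l n) ((norm (u x))\<^sup>2) * grad_norm_sq u x)
        \<longlonglongrightarrow> grad_norm_sq u x * indicator {x. u x \<noteq> 0} x"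
    proof (rule AE_I2)
      fix x
      show "(\<lambda>n. cutoff (l n) ((norm (u x))\<^sup>2) * grad_norm_sq u x) \<longlonglongrightarrow> grad_norm_sq u x * indicator {x. u x \<noteq> 0} x"
        using tendsto_mult_right[OF cutoff_limits(1)[OF l, of "(norm (u x))\<^sup>2"], of "grad_norm_sq u x"]
        by (auto simp: indicator_def split: if_splits)
    qed
    show "AE x in lborel. norm (cutoff (l n) ((norm (u x))\<^sup>2) * grad_norm_sq u x) \<le> grad_norm_sq u x" for n
      by (intro AE_I2) (simp add: abs_mult cutoff_bounds grad_norm_sq_nonneg mult_left_le_one_le)
  qed (auto simp: integrable_grad_norm_sq)
  have 2: "(\<lambda>n. \<integral>x. 2 * ((norm (u x))\<^sup>2 * cutoff_deriv (l n) ((norm (u x))\<^sup>2)) * grad_norm_sq u x \<partial>lborel)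
      \<longlonglongrightarrow> (\<integral>x. 0 \<partial>(lborel :: (real^3) measure))"
  proof (rule integral_dominated_convergence[where w="\<lambda>x. 6 * grad_norm_sq u x"])
    show "AE x in lborel. (\<lambda>n. 2 * ((norm (u x))\<^sup>2 * cutoff_deriv (l n) ((norm (u x))\<^sup>2)) * grad_norm_sq u x) \<longlonglongrightarrow> 0"
    proof (rule AE_I2)
      fix x
      have "(\<lambda>n. 2 * ((norm (u x))\<^sup>2 * cutoff_deriv (l n) ((norm (u x))\<^sup>2)) * grad_norm_sq u x) \<longlonglongrightarrow> 2 * 0 * grad_norm_sq u x"
        by (intro tendsto_intros cutoff_limits(2)[OF l]) simp
      then show "(\<lambda>n. 2 * ((norm (u x))\<^sup>2 * cutoff_deriv (l n) ((norm (u x))\<^sup>2)) * grad_norm_sq u x) \<longlonglongrightarrow> 0" by simp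
    qed
    show "AE x in lborel. norm (2 * ((norm (u x))\<^sup>2 * cutoff_deriv (l n) ((norm (u x))\<^sup>2)) * grad_norm_sq u x) \<le> 6 * grad_norm_sq u x" for n
    proof (rule AE_I2)
      fix x
      have "2 * ((norm (u x))\<^sup>2 * cutoff_deriv (l n) ((norm (u x))\<^sup>2)) * grad_norm_sq u x \<le> 6 * grad_norm_sq u x"
        using cutoff_deriv_bounds(2)[OF l(2), of "(norm (u x))\<^sup>2" n] by (intro mult_right_mono grad_norm_sq_nonneg) simp
      then show "norm (2 * ((norm (u x))\<^sup>2 * cutoff_deriv (l n) ((norm (u x))\<^sup>2)) * grad_norm_sq u x) \<le> 6 * grad_norm_sq u x"
        using cutoff_deriv_bounds(1)[OF l(2), of "(norm (u x))\<^sup>2" n] grad_norm_sq_nonneg[of x] by (simp add: abs_mult)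
    qed
  qed (auto simp: integrable_grad_norm_sq)
  have "(\<integral>x. grad_norm_sq u x * indicator {x. u x \<noteq> 0} x \<partial>lborel) \<le> (\<integral>x. (norm (curl u x))\<^sup>2 \<partial>lborel) + (\<integral>x. 0 \<partial>(lborel :: (real^3) measure))"
    by (rule LIMSEQ_le[OF 1 tendsto_add[OF tendsto_const 2]]) (use dirichlet_cutoff_identity[OF l(2)] in blast)
  then have "ennreal (\<integral>x. grad_norm_sq u x * indicator {x. u x \<noteq> 0} x \<partial>lborel) \<le> ennreal (\<integral>x. (norm (curl u x))\<^sup>2 \<partial>lborel)"
    by (intro ennreal_leI) simp
  also have "ennreal (\<integral>x. grad_norm_sq u x * indicator {x. u x \<noteq> 0} x \<partial>lborel)
      = (\<integral>\<^sup>+x. ennreal (grad_norm_sq u x * indicator {x. u x \<noteq> 0} x) \<partial>lborel)"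
    by (rule nn_integral_eq_integral[symmetric, OF ind]) (simp add: grad_norm_sq_nonneg)
  also have "ennreal (\<integral>x. (norm (curl u x))\<^sup>2 \<partial>lborel) = (\<integral>\<^sup>+x. ennreal ((norm (curl u x))\<^sup>2) \<partial>lborel)"
    by (rule nn_integral_eq_integral[symmetric, OF integrable_vorticity]) simp
  finally show ?thesis by (simp add: indicator_mult_ennreal mult.commute ennreal_indicator ennreal_mult'' flip: ennreal_indicator)
qed

end

section \<open>Tangential projections\<close>

lemma cross_diff_normal_dot:
  fixes u w n :: "real^3"
  shows "((u - a *\<^sub>R n) \<times> (w - b *\<^sub>R n)) \<bullet> n = (u \<times> w) \<bullet> n"
  \<comment> \<open>The discarded terms are triple products in which n occurs twice.\<close>
  by (simp add: Cross3.left_diff_distrib Cross3.right_diff_distrib cross_mult_left cross_mult_right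
      inner_diff_left dot_cross_self)

lemma norm_diff_unit_projection_le:
  fixes v n :: "'a::real_inner"
  assumes "norm n = 1"
  shows "norm (v - (v \<bullet> n) *\<^sub>R n) \<le> norm v"
proof -
  have "n \<bullet> n = 1" using assms by (simp add: norm_eq_1)
  then have "(norm (v - (v \<bullet> n) *\<^sub>R n))\<^sup>2 = (norm v)\<^sup>2 - (v \<bullet> n)\<^sup>2"
    unfolding power2_norm_eq_inner
    by (simp add: inner_diff_left inner_diff_right inner_commute power2_eq_square)
  then have "(norm (v - (v \<bullet> n) *\<^sub>R n))\<^sup>2 \<le> (norm v)\<^sup>2" by simp
  then show ?thesis by (simp add: power2_le_iff_abs_le)
qed

lemma norm_tangential_le: "norm (tangential q v x) \<le> norm (v x)"
proof (cases "gradient q x = 0")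
  case False
  then have "norm (normal_dir q x) = 1" by (simp add: normal_dir_def)
  from norm_diff_unit_projection_le[OF this] show ?thesis using False by (simp add: tangential_def)
qed (simp add: tangential_def)

lemma measurable_cross3 [measurable (raw)]:
  fixes f g :: "'a \<Rightarrow> real^3"
  assumes "f \<in> borel_measurable M" "g \<in> borel_measurable M"
  shows "(\<lambda>x. f x \<times> g x) \<in> borel_measurable M"
  by (rule borel_measurable_continuous_Pair[OF assms]) (intro continuous_on_cross continuous_intros)

subsection \<open>Moduli\<close>

context
  fixes \<xi> :: "real \<Rightarrow> real"
  assumes \<xi>: "admissible_modulus \<xi>"
begin

lemma modulus_pos: "s > 0 \<Longrightarrow> \<xi> s > 0"
  using \<xi> by (simp add: admissible_modulus_def)

lemma modulus_nonneg: "s \<ge> 0 \<Longrightarrow> \<xi> s \<ge> 0"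
  using \<xi> modulus_pos[of s] by (auto simp: admissible_modulus_def less_eq_real_def)

lemma modulus_mono: "0 \<le> s \<Longrightarrow> s \<le> t \<Longrightarrow> \<xi> s \<le> \<xi> t"
  using \<xi> by (auto simp: admissible_modulus_def mono_on_def)

text \<open>Continuity of \<xi> is known only on [0, \<infinity>); the maximum turns it into a
  continuous function on the whole line.\<close>

lemma continuous_modulus_max: "l \<ge> 0 \<Longrightarrow> continuous_on UNIV (\<lambda>s. \<xi> (max l s))"
  using \<xi> by (auto simp: admissible_modulus_def intro!: continuous_on_compose2[of "{0..}" \<xi>] continuous_intros)

lemma measurable_modulus_abs [measurable (raw)]:
  assumes [measurable]: "f \<in> borel_measurable M"
  shows "(\<lambda>x. \<xi> \<bar>f x\<bar>) \<in> borel_measurable M"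
proof -
  have [measurable]: "(\<lambda>s. \<xi> (max 0 s)) \<in> borel_measurable borel"
    by (rule borel_measurable_continuous_onI) (simp add: continuous_modulus_max)
  have "(\<lambda>x. \<xi> (max 0 \<bar>f x\<bar>)) \<in> borel_measurable M"
    by (rule measurable_compose[of "\<lambda>x. \<bar>f x\<bar>" M borel "\<lambda>s. \<xi> (max 0 s)"]) measurable
  then show ?thesis by simp
qed

lemma measurable_recip_integrand:
  assumes "l \<ge> 0"
  shows "(\<lambda>s. ennreal (1 / \<xi> s) * indicator {l..b} s) \<in> borel_measurable borel"
proof -
  have "(\<lambda>s. ennreal (1 / \<xi> \<bar>s\<bar>) * indicator {l..b} s) \<in> borel_measurable borel" by measurable
  moreover have "(\<lambda>s. ennreal (1 / \<xi> \<bar>s\<bar>) * indicator {l..b} s) = (\<lambda>s. ennreal (1 / \<xi> s) * indicator {l..b} s)"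
    using assms by (auto simp: indicator_def fun_eq_iff)
  ultimately show ?thesis by simp
qed

lemma recip_integral_antimono: "l \<le> m \<Longrightarrow> recip_integral \<xi> m \<le> recip_integral \<xi> l"
  unfolding recip_integral_def by (intro nn_integral_mono) (auto simp: indicator_def)

text \<open>By monotonicity 1/\<xi> is at most 1 / \<open>\<xi> l\<close> on [l, 1].\<close>

lemma recip_integral_finite:
  assumes "l > 0" shows "recip_integral \<xi> l < \<infinity>"
proof -
  have "recip_integral \<xi> l \<le> (\<integral>\<^sup>+s. ennreal (1 / \<xi> l) * indicator {l..1} s \<partial>lborel)"
    unfolding recip_integral_def using assms modulus_mono[of l] modulus_pos[of l]
    by (intro nn_integral_mono) (auto simp: indicator_def intro!: ennreal_leI divide_left_mono mult_pos_pos modulus_pos)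
  also have "\<dots> < \<infinity>"
    by (subst nn_integral_cmult_indicator) (auto simp: ennreal_mult_less_top emeasure_lborel_Icc_eq)
  finally show ?thesis .
qed

text \<open>Fatou's lemma on the intervals [1/(n+1), 1] yields one level with a large integral, and
  the integral only grows as the level decreases.\<close>

lemma recip_integral_unbounded:
  "eventually (\<lambda>l. ennreal B < recip_integral \<xi> l) (at_right 0)"
proof -
  let ?f = "\<lambda>n s. ennreal (1 / \<xi> s) * indicator {inverse (real (Suc n))..1} s"
  have "\<infinity> = (\<integral>\<^sup>+s. ennreal (1 / \<xi> s) * indicator {0..1} s \<partial>lborel)"
    using \<xi> by (simp add: admissible_modulus_def recip_integral_def)
  also have "\<dots> = (\<integral>\<^sup>+s. liminf (\<lambda>n. ?f n s) \<partial>lborel)"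
  proof (rule nn_integral_cong)
    fix s :: real
    have "(\<lambda>n. ?f n s) \<longlonglongrightarrow> ennreal (1 / \<xi> s) * indicator {0..1} s"
    proof (cases "0 < s")
      case True
      then obtain N where N: "inverse (real (Suc N)) < s" using reals_Archimedean by blast
      have "eventually (\<lambda>n. ?f n s = ennreal (1 / \<xi> s) * indicator {0..1} s) sequentially"
        using eventually_ge_at_top[of N]
      proof eventually_elim
        case (elim n)
        then have "inverse (real (Suc n)) \<le> inverse (real (Suc N))" by (intro le_imp_inverse_le) auto
        then have "inverse (real (Suc n)) \<le> s" using N by linarith
        then show ?case using True by (auto simp: indicator_def simp del: of_nat_Suc)
      qed
      then show ?thesis by (rule tendsto_eventually)
    next
      case False
      then have "?f n s = 0" for n by (auto simp: indicator_def not_less dest: order_trans) 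
      \<comment> \<open>At s = 0 this rests on \<open>1 / \<xi> 0 = 1 / 0 = 0\<close>.\<close>
      moreover have "ennreal (1 / \<xi> s) * indicator {0..1} s = 0"
        using False \<xi> by (cases "s = 0") (auto simp: admissible_modulus_def)
      ultimately show ?thesis by (simp only: tendsto_const)
    qed
    then show "ennreal (1 / \<xi> s) * indicator {0..1} s = liminf (\<lambda>n. ?f n s)"
      by (rule lim_imp_Liminf[symmetric, rotated]) simp
  qed
  also have "\<dots> \<le> liminf (\<lambda>n. \<integral>\<^sup>+s. ?f n s \<partial>lborel)"
    using measurable_recip_integrand by (intro nn_integral_liminf) simp
  finally have "\<not> liminf (\<lambda>n. recip_integral \<xi> (inverse (real (Suc n)))) \<le> ennreal B"
    by (simp add: recip_integral_def top_unique)
  moreover have "liminf (\<lambda>n. recip_integral \<xi> (inverse (real (Suc n)))) \<le> liminf (\<lambda>_. ennreal B)"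
    if "\<And>n. \<not> ennreal B < recip_integral \<xi> (inverse (real (Suc n)))"
    using that by (intro Liminf_mono) (simp add: not_less)
  ultimately obtain n where n: "ennreal B < recip_integral \<xi> (inverse (real (Suc n)))"
    by (auto simp: Liminf_const)
  have "eventually (\<lambda>l. l \<in> {0<..<inverse (real (Suc n))}) (at_right 0)"
    by (rule eventually_at_right_real) simp
  then show ?thesis
    by eventually_elim (use n recip_integral_antimono in \<open>auto intro: less_le_trans\<close>)
qed

text \<open>The ramp of width \<open>\<xi> l\<close> makes the weight continuous; since \<open>1 / \<xi> \<le> 1 / \<xi> l\<close> there, it lowers the
  integral by at most \<open>1\<close>.\<close>

definition ramp_weight :: "real \<Rightarrow> real \<Rightarrow> real"
  where "ramp_weight l s = max 0 (min 1 ((s - l) / \<xi> l)) / \<xi> (max l s)"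

lemma continuous_ramp_weight: 
  assumes "l > 0" shows "continuous_on UNIV (ramp_weight l)"
proof -
  have "\<xi> (max l s) > 0" for s by (rule modulus_pos) (use assms in simp)
  then have "\<xi> (max l s) \<noteq> 0" "\<xi> l \<noteq> 0" for s using modulus_pos[OF assms] by (auto simp: less_imp_neq[symmetric])
  then show ?thesis unfolding ramp_weight_def[abs_def]
    using assms by (intro continuous_intros continuous_modulus_max) auto
qed

lemma ramp_weight_nonneg: "l > 0 \<Longrightarrow> 0 \<le> ramp_weight l s"
  unfolding ramp_weight_def using modulus_nonneg[of "max l s"] by simp

lemma ramp_weight_eq_0: "l > 0 \<Longrightarrow> s \<le> l \<Longrightarrow> ramp_weight l s = 0"
  unfolding ramp_weight_def using modulus_pos[of l] by (simp add: divide_nonpos_pos min_def)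

lemma ramp_weight_le: "l > 0 \<Longrightarrow> s > l \<Longrightarrow> ramp_weight l s \<le> 1 / \<xi> s"
  unfolding ramp_weight_def using modulus_pos[of s] by (intro frac_le) auto

text \<open>Three pieces cover [l, 1]: beyond m; below m where the ramp has reached 1 and the weight
  equals 1/\<xi>; and the ramp itself, of width \<open>\<xi> l\<close> and height at most 1 /
  \<open>\<xi> l\<close>. The pieces may overlap or leave [l, 1], so the bound is by their
  sum.\<close>

lemma recip_integral_le_ramp:
  assumes l: "0 < l" "l < m" and g: "\<And>s. (g has_real_derivative ramp_weight l s) (at s)" "g l = 0"
  shows "recip_integral \<xi> l \<le> recip_integral \<xi> m + ennreal (g m) + 1"
proof -
  note [measurable] = measurable_recip_integrand
  have [measurable]: "ramp_weight l \<in> borel_measurable borel"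
    by (intro borel_measurable_continuous_onI continuous_ramp_weight l)
  have \<xi>l: "\<xi> l > 0" using modulus_pos l by simp
  let ?A = "\<lambda>s. ennreal (1 / \<xi> s) * indicator {m..1} s" and ?B = "\<lambda>s. ennreal (ramp_weight l s) * indicator {l..m} s"
    and ?C = "\<lambda>s. ennreal (1 / \<xi> l) * indicator {l..l + \<xi> l} s"
  have "recip_integral \<xi> l \<le> (\<integral>\<^sup>+s. ?A s + ?B s + ?C s \<partial>lborel)"
    unfolding recip_integral_def
  proof (rule nn_integral_mono)
    fix s :: real
    show "ennreal (1 / \<xi> s) * indicator {l..1} s \<le> ?A s + ?B s + ?C s"
    proof (cases "s \<in> {l..1}")
      case True
      consider "m \<le> s" | "s < m" "s \<ge> l + \<xi> l" | "s < l + \<xi> l" by linarith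
      then show ?thesis
      proof cases
        case 1
        then have "ennreal (1 / \<xi> s) * indicator {l..1} s = ?A s" using True by simp
        then show ?thesis by (simp add: add_increasing2)
      next
        case 2
        then have "ramp_weight l s = 1 / \<xi> s"
          using \<xi>l True by (simp add: ramp_weight_def max_def min_def le_divide_eq)
        then have "ennreal (1 / \<xi> s) * indicator {l..1} s = ?B s" using True 2 by simp
        then show ?thesis by (simp add: add_increasing add_increasing2)
      next
        case 3
        have "ennreal (1 / \<xi> s) \<le> ennreal (1 / \<xi> l)"
          using True l \<xi>l modulus_mono[of l s] modulus_pos[of s] by (intro ennreal_leI divide_left_mono) auto
        then have "ennreal (1 / \<xi> s) * indicator {l..1} s \<le> ?C s" using True 3 by simp
        then show ?thesis by (simp add: add_increasing)
      qed
    qed simp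
  qed
  also have "\<dots> = (\<integral>\<^sup>+s. ?A s \<partial>lborel) + (\<integral>\<^sup>+s. ?B s \<partial>lborel) + (\<integral>\<^sup>+s. ?C s \<partial>lborel)"
    using l by (simp add: nn_integral_add)
  also have "(\<integral>\<^sup>+s. ?A s \<partial>lborel) = recip_integral \<xi> m" by (simp add: recip_integral_def)
  also have "(\<integral>\<^sup>+s. ?B s \<partial>lborel) = ennreal (g m)"
    using nn_integral_FTC_Icc[of "ramp_weight l" l m g] g l ramp_weight_nonneg by simp
  also have "(\<integral>\<^sup>+s. ?C s \<partial>lborel) = 1"
    using \<xi>l by (subst nn_integral_cmult_indicator) (auto simp flip: ennreal_mult)
  finally show ?thesis .
qed

end

subsection \<open>The level set estimate\<close>

context decaying_NS
begin

text \<open>The square of (u x omega) . n_Q, without reference to the projections;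
  \<open>stretching_eq\<close> identifies it with |u_T|^2 |omega_T|^2 Theta^2.\<close>

definition stretching :: "real^3 \<Rightarrow> real"
  where "stretching x = (if gradient Q x = 0 then 0
    else (gradient Q x \<bullet> (u x \<times> curl u x))\<^sup>2 / (norm (gradient Q x))\<^sup>2)"

lemma measurable_stretching [measurable]: "stretching \<in> borel_measurable borel"
  unfolding stretching_def[abs_def] by measurable

lemma stretching_nonneg: "0 \<le> stretching x"
  by (simp add: stretching_def)

text \<open>\<open>stretching\<close> may jump where grad Q = 0; this continuous majorant makes its
  weighted integrals finite.\<close>

lemma stretching_le: "stretching x \<le> (norm (u x \<times> curl u x))\<^sup>2"
proof (cases "gradient Q x = 0")
  case False
  have "(gradient Q x \<bullet> (u x \<times> curl u x))\<^sup>2 \<le> (norm (gradient Q x))\<^sup>2 * (norm (u x \<times> curl u x))\<^sup>2"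
    using Cauchy_Schwarz_ineq[of "gradient Q x" "u x \<times> curl u x"] by (simp add: power2_norm_eq_inner)
  then show ?thesis using False by (simp add: stretching_def divide_le_eq mult.commute)
qed (simp add: stretching_def)

lemma stretching_eq:
  "stretching x = (norm (u_tan u p x))\<^sup>2 * (norm (vort_tan u p x))\<^sup>2 * (tan_angle u p x)\<^sup>2"
proof (cases "gradient Q x = 0")
  case True
  then show ?thesis by (simp add: stretching_def tan_angle_def)
next
  case False
  define n where "n = normal_dir Q x"
  have n: "n = gradient Q x /\<^sub>R norm (gradient Q x)" using False by (simp add: n_def normal_dir_def)
  have "(u_tan u p x \<times> vort_tan u p x) \<bullet> n = (u x \<times> curl u x) \<bullet> n"
    using False by (simp add: u_tan_def vort_tan_def tangential_def cross_diff_normal_dot n_def)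
  also have "\<dots> = (gradient Q x \<bullet> (u x \<times> curl u x)) / norm (gradient Q x)"
    by (simp add: n inner_commute divide_inverse mult.commute)
  finally have st: "stretching x = ((u_tan u p x \<times> vort_tan u p x) \<bullet> n)\<^sup>2"
    using False by (simp add: stretching_def power_divide)
  show ?thesis
  \<comment> \<open>If a tangential part vanishes, \<open>tan_angle\<close> is 0 by convention, and
    so is the triple product.\<close>
  proof (cases "u_tan u p x = 0 \<or> vort_tan u p x = 0")
    case True
    then show ?thesis using st by auto
  next
    case False
    then show ?thesis using \<open>gradient Q x \<noteq> 0\<close> st
      by (simp add: tan_angle_def n_def power_divide power_mult_distrib)
  qed
qed

text \<open>With a = |grad Q| and b = grad Q . (u x omega), use b <= a^2/2 + (b/a)^2/2 under the
  weight h(Q). The integral of h(Q) |grad Q|^2 is finite, so half of it can be absorbed, with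
  constant 1 as the outcome. By the first energy identity it equals the enstrophy weighted by
  -\<open>\<phi>\<close>(Q).\<close>

lemma stretching_energy:
  fixes h \<phi> :: "real \<Rightarrow> real"
  assumes h: "continuous_on UNIV h" and l: "l > 0" and h0: "\<And>t. \<bar>t\<bar> \<le> l \<Longrightarrow> h t = 0"
    and \<phi>: "\<And>t. (\<phi> has_real_derivative h t) (at t)" and \<phi>0: "\<And>t. \<bar>t\<bar> \<le> l \<Longrightarrow> \<phi> t = 0"
    and h_nonneg: "\<And>t. h t \<ge> 0"
  shows "(\<integral>\<^sup>+x. ennreal (- \<phi> (Q x) * (norm (curl u x))\<^sup>2) \<partial>lborel) \<le> (\<integral>\<^sup>+x. ennreal (h (Q x) * stretching x) \<partial>lborel)"
proof -
  note E = head_pressure_energy[OF h l h0 \<phi> \<phi>0]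
  have [measurable]: "h \<in> borel_measurable borel" using h by (rule borel_measurable_continuous_onI)
  obtain R where R: "\<And>x. \<bar>Q x\<bar> > l \<Longrightarrow> norm x \<le> R"
    using bounded_superlevel_at_infinity[OF Q_infinity l] by (auto simp: bounded_iff)
  have "integrable lborel (\<lambda>x. h (Q x) * (norm (u x \<times> curl u x))\<^sup>2)"
  proof (rule continuous_bounded_support_integrable)
    show "continuous_on UNIV (\<lambda>x. h (Q x) * (norm (u x \<times> curl u x))\<^sup>2)"
      by (intro continuous_intros continuous_on_compose2[OF h continuous_Q] continuous_on_cross
          continuous_u continuous_curl_u) auto
    show "norm x \<le> R" if "h (Q x) * (norm (u x \<times> curl u x))\<^sup>2 \<noteq> 0" for x
      using that R[of x] h0[of "Q x"] by (cases "\<bar>Q x\<bar> \<le> l") auto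
  qed
  then have int: "integrable lborel (\<lambda>x. h (Q x) * stretching x)"
    by (rule Bochner_Integration.integrable_bound)
      (auto simp: h_nonneg stretching_nonneg intro!: mult_left_mono stretching_le)
  let ?I = "\<integral>x. h (Q x) * (norm (gradient Q x))\<^sup>2 \<partial>lborel"
  have "?I = (\<integral>x. h (Q x) * (gradient Q x \<bullet> (u x \<times> curl u x)) \<partial>lborel)" by (rule E(5))
  also have "\<dots> \<le> (\<integral>x. 1/2 * (h (Q x) * (norm (gradient Q x))\<^sup>2) + 1/2 * (h (Q x) * stretching x) \<partial>lborel)"
  proof (rule integral_mono)
    show "integrable lborel (\<lambda>x. 1/2 * (h (Q x) * (norm (gradient Q x))\<^sup>2) + 1/2 * (h (Q x) * stretching x))"
      by (intro Bochner_Integration.integrable_add integrable_mult_right E int)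
    show "integrable lborel (\<lambda>x. h (Q x) * (gradient Q x \<bullet> (u x \<times> curl u x)))" by (rule E)
    fix x
    have "gradient Q x \<bullet> (u x \<times> curl u x) \<le> 1/2 * (norm (gradient Q x))\<^sup>2 + 1/2 * stretching x"
    proof (cases "gradient Q x = 0")
      case False
      define a b where "a = norm (gradient Q x)" and "b = gradient Q x \<bullet> (u x \<times> curl u x)"
      have a: "a > 0" using False by (simp add: a_def)
      then have "2 * b = 2 * a * (b / a)" by simp
      also have "\<dots> \<le> a\<^sup>2 + (b / a)\<^sup>2" by (rule sum_squares_bound)
      finally show ?thesis using False by (simp add: stretching_def a_def b_def power_divide)
    qed (simp add: stretching_def)
    from mult_left_mono[OF this h_nonneg[of "Q x"]]
    show "h (Q x) * (gradient Q x \<bullet> (u x \<times> curl u x))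
        \<le> 1/2 * (h (Q x) * (norm (gradient Q x))\<^sup>2) + 1/2 * (h (Q x) * stretching x)"
      by (simp add: algebra_simps)
  qed
  also have "\<dots> = 1/2 * ?I + 1/2 * (\<integral>x. h (Q x) * stretching x \<partial>lborel)"
    using E(1) int by simp
  finally have le: "?I \<le> (\<integral>x. h (Q x) * stretching x \<partial>lborel)" by simp
  \<comment> \<open>Because \<open>\<phi>\<close> is nondecreasing with \<open>\<phi> 0 = 0\<close>,
    and Q <= 0.\<close>
  have "- \<phi> (Q x) \<ge> 0" for x
  proof -
    have "\<phi> (Q x) \<le> \<phi> 0"
      by (rule DERIV_nonneg_imp_nondecreasing[OF head_pressure_nonpos])
        (rule exI[where x="h _"], rule conjI[OF \<phi> h_nonneg])
    then show ?thesis using \<phi>0[of 0] l by simp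
  qed
  then have "(\<integral>\<^sup>+x. ennreal (- \<phi> (Q x) * (norm (curl u x))\<^sup>2) \<partial>lborel)
      = ennreal (\<integral>x. - \<phi> (Q x) * (norm (curl u x))\<^sup>2 \<partial>lborel)"
    using E(2) by (intro nn_integral_eq_integral) (auto intro!: AE_I2 mult_nonpos_nonneg)
  also have "(\<integral>x. - \<phi> (Q x) * (norm (curl u x))\<^sup>2 \<partial>lborel) = ?I"
    by (rule trans[OF _ E(4)[symmetric]]) simp
  also have "\<dots> \<le> ennreal (\<integral>x. h (Q x) * stretching x \<partial>lborel)" using le by (rule ennreal_leI)
  also have "\<dots> = (\<integral>\<^sup>+x. ennreal (h (Q x) * stretching x) \<partial>lborel)"
    using int by (intro nn_integral_eq_integral[symmetric]) (auto simp: h_nonneg stretching_nonneg)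
  finally show ?thesis .
qed

definition enstrophy :: ennreal
  where "enstrophy = (\<integral>\<^sup>+x. ennreal ((norm (curl u x))\<^sup>2) \<partial>lborel)"

lemma enstrophy_finite: "enstrophy < \<infinity>"
  using integrable_vorticity unfolding enstrophy_def by (simp add: integrable_iff_bounded)

text \<open>By \<open>dirichlet_le_enstrophy\<close> the gradient vanishes almost everywhere on {u
  /= 0}, so |u|^2 has zero gradient, is constant, and decays.\<close>

lemma zero_velocity_if_zero_enstrophy:
  assumes "enstrophy = 0"
  shows "u x = 0"
proof -
  have "(\<integral>\<^sup>+x. ennreal (grad_norm_sq u x) * indicator {x. u x \<noteq> 0} x \<partial>lborel) = 0"
    using dirichlet_le_enstrophy assms by (simp add: enstrophy_def)
  then have "AE x in lborel. ennreal (grad_norm_sq u x) * indicator {x. u x \<noteq> 0} x = 0"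
    by (subst (asm) nn_integral_0_iff_AE) auto
  \<comment> \<open>The factor |u|^2 replaces the indicator to obtain a continuous function, which
    then vanishes everywhere.\<close>
  then have "AE x in lborel. (norm (u x))\<^sup>2 * grad_norm_sq u x = 0"
    by eventually_elim (auto simp: indicator_def grad_norm_sq_nonneg ennreal_eq_0_iff intro: antisym split: if_splits)
  then have 0: "(norm (u x))\<^sup>2 * grad_norm_sq u x = 0" for x
    by (rule continuous_AE_eq_0[rotated]) (intro continuous_intros continuous_u continuous_grad_norm_sq_u)
  have "partial i (\<lambda>x. (norm (u x))\<^sup>2) x = 0" for i x
  proof (cases "u x = 0")
    case False
    then have "grad_norm_sq u x = 0" using 0[of x] by simp
    then have "partial i u x = 0" unfolding grad_norm_sq_def by (simp add: sum_nonneg_eq_0_iff)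
    then have "DU i k x = 0" for k by (simp flip: partial_u)
    then show ?thesis by (simp add: partial_norm_u_sq)
  qed (simp add: partial_norm_u_sq)
  then have const: "(norm (u x))\<^sup>2 = (norm (u y))\<^sup>2" for x y
    by (rule zero_partials_imp_constant[where f="\<lambda>x. (norm (u x))\<^sup>2", rotated])
      (rule smooth_differentiable[OF smooth_norm_u_sq])
  have "((\<lambda>x. (norm (u x))\<^sup>2) \<longlongrightarrow> (norm (0::real^3))\<^sup>2) at_infinity"
    by (intro tendsto_intros u_infinity)
  then have "((\<lambda>x. (norm (u x))\<^sup>2) \<longlongrightarrow> 0) at_infinity" by simp
  from constant_at_infinity_eq_0[OF this const] show ?thesis by simp
qed

text \<open>\<open>stretching_energy\<close> bounds g(m) times the enstrophy on {|Q| > m}, and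
  \<open>recip_integral_le_ramp\<close> compares g(m) with the full integral from l. The first
  summand on the right has a coefficient independent of l. The form is additive because subtraction
  in \<open>ennreal\<close> truncates.\<close>

lemma enstrophy_superlevel_bound:
  assumes \<xi>: "admissible_modulus \<xi>" and l: "0 < l" "l < m"
  shows "recip_integral \<xi> l * (\<integral>\<^sup>+x. ennreal ((norm (curl u x))\<^sup>2) * indicator {x. \<bar>Q x\<bar> > m} x \<partial>lborel)
    \<le> (recip_integral \<xi> m + 1) * (\<integral>\<^sup>+x. ennreal ((norm (curl u x))\<^sup>2) * indicator {x. \<bar>Q x\<bar> > m} x \<partial>lborel)
     + (\<integral>\<^sup>+x. ennreal (stretching x / \<xi> \<bar>Q x\<bar>) * indicator {x. \<bar>Q x\<bar> > l} x \<partial>lborel)"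
    (is "_ * ?e \<le> _ * ?e + ?T")
proof -
  \<comment> \<open>Reflected, because Q <= 0 means that |Q| = -Q; correspondingly
    \<open>g s = - \<phi> (- s)\<close> is a primitive of the weight.\<close>
  define h where "h t = ramp_weight \<xi> l (- t)" for t
  have ch: "continuous_on UNIV h" unfolding h_def
    by (intro continuous_on_compose2[OF continuous_ramp_weight[OF \<xi> l(1)]] continuous_intros) auto
  have h0: "h t = 0" if "\<bar>t\<bar> \<le> l" for t unfolding h_def
    using that l by (intro ramp_weight_eq_0[OF \<xi>]) auto
  have h_nonneg: "h t \<ge> 0" for t unfolding h_def by (intro ramp_weight_nonneg[OF \<xi>] l)
  obtain \<phi> where \<phi>: "\<And>t. (\<phi> has_real_derivative h t) (at t)" and \<phi>0: "\<And>t. \<bar>t\<bar> \<le> l \<Longrightarrow> \<phi> t = 0"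
    using antiderivative_vanishing_near_0[OF ch h0] by blast
  define g where "g s = - \<phi> (- s)" for s
  have g: "(g has_real_derivative ramp_weight \<xi> l s) (at s)" for s
  proof -
    have "((\<lambda>s. \<phi> (- s)) has_real_derivative h (- s) * (- 1)) (at s)"
      by (rule DERIV_chain2[OF \<phi>]) (auto intro!: derivative_eq_intros)
    from DERIV_minus[OF this] show ?thesis by (simp add: g_def[abs_def] h_def)
  qed
  have gl: "g l = 0" using \<phi>0[of "- l"] l by (simp add: g_def)
  have g_mono: "g a \<le> g b" if "a \<le> b" for a b
    by (rule DERIV_nonneg_imp_nondecreasing[OF that])
      (rule exI[where x="ramp_weight \<xi> l _"], rule conjI[OF g ramp_weight_nonneg[OF \<xi> l(1)]])
  have gm: "0 \<le> g m" using g_mono[of l m] gl l by simp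
  have "ennreal (g m) * ?e = (\<integral>\<^sup>+x. ennreal (g m) * (ennreal ((norm (curl u x))\<^sup>2) * indicator {x. \<bar>Q x\<bar> > m} x) \<partial>lborel)"
    by (rule nn_integral_cmult[symmetric]) measurable
  also have "\<dots> \<le> (\<integral>\<^sup>+x. ennreal (- \<phi> (Q x) * (norm (curl u x))\<^sup>2) \<partial>lborel)"
  proof (rule nn_integral_mono)
    fix x
    show "ennreal (g m) * (ennreal ((norm (curl u x))\<^sup>2) * indicator {x. \<bar>Q x\<bar> > m} x) \<le> ennreal (- \<phi> (Q x) * (norm (curl u x))\<^sup>2)"
    proof (cases "\<bar>Q x\<bar> > m")
      case True
      then have "g m \<le> - \<phi> (Q x)"
        using g_mono[of m "- Q x"] head_pressure_nonpos[of x] by (simp add: g_def)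
      then have "g m * (norm (curl u x))\<^sup>2 \<le> - \<phi> (Q x) * (norm (curl u x))\<^sup>2"
        by (rule mult_right_mono) simp
      then show ?thesis using True gm by (simp add: ennreal_leI flip: ennreal_mult)
    qed simp
  qed
  also have "\<dots> \<le> (\<integral>\<^sup>+x. ennreal (h (Q x) * stretching x) \<partial>lborel)"
    by (rule stretching_energy[OF ch l(1) h0 \<phi> \<phi>0 h_nonneg])
  also have "\<dots> \<le> ?T"
  proof (rule nn_integral_mono)
    fix x
    show "ennreal (h (Q x) * stretching x) \<le> ennreal (stretching x / \<xi> \<bar>Q x\<bar>) * indicator {x. \<bar>Q x\<bar> > l} x"
    proof (cases "\<bar>Q x\<bar> > l")
      case True
      then have "h (Q x) \<le> 1 / \<xi> \<bar>Q x\<bar>"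
        using ramp_weight_le[OF \<xi> l(1), of "- Q x"] head_pressure_nonpos[of x] by (simp add: h_def)
      from mult_right_mono[OF this stretching_nonneg[of x]] show ?thesis using True
        by (auto intro!: ennreal_leI)
    next
      case False
      then show ?thesis by (simp add: h0)
    qed
  qed
  finally have *: "ennreal (g m) * ?e \<le> ?T" .
  have "recip_integral \<xi> l * ?e \<le> (recip_integral \<xi> m + ennreal (g m) + 1) * ?e"
    by (intro mult_right_mono recip_integral_le_ramp[OF \<xi> l g gl]) simp
  also have "\<dots> = (recip_integral \<xi> m + 1) * ?e + ennreal (g m) * ?e"
    by (simp add: distrib_right ac_simps)
  also have "\<dots> \<le> (recip_integral \<xi> m + 1) * ?e + ?T"
    using * by (rule add_left_mono)
  finally show ?thesis .
qed

text \<open>For fixed m, divide \<open>enstrophy_superlevel_bound\<close> by the integral from l,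
  which tends to infinity: the enstrophy on {|Q| > m} is at most \<theta> times the total. Letting m
  tend to 0 gives E <= \<theta> E. It suffices that the smallness holds frequently, since the growth
  of the integral holds eventually.\<close>

lemma zero_velocity_if_stretching_small:
  assumes \<xi>: "admissible_modulus \<xi>" and \<theta>: "0 \<le> \<theta>" "\<theta> < 1"
    and small: "frequently (\<lambda>l. (\<integral>\<^sup>+x. ennreal (stretching x / \<xi> \<bar>Q x\<bar>) * indicator {x. \<bar>Q x\<bar> > l} x \<partial>lborel)
      \<le> ennreal \<theta> * recip_integral \<xi> l * enstrophy) (at_right 0)"
  shows "u x = 0"
proof (rule zero_velocity_if_zero_enstrophy)
  obtain E where E: "enstrophy = ennreal E" "E \<ge> 0" using enstrophy_finite by (cases enstrophy) auto
  let ?w = "\<lambda>m x. ennreal ((norm (curl u x))\<^sup>2) * indicator {x. \<bar>Q x\<bar> > m} x"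
  have le: "(\<integral>\<^sup>+x. ?w m x \<partial>lborel) \<le> ennreal (\<theta> * E)" if m: "m > 0" for m
  proof (rule ccontr)
    assume gt: "\<not> ?thesis"
    have "(\<integral>\<^sup>+x. ?w m x \<partial>lborel) \<le> enstrophy"
      unfolding enstrophy_def by (intro nn_integral_mono) (auto simp: indicator_def)
    then obtain e where e: "(\<integral>\<^sup>+x. ?w m x \<partial>lborel) = ennreal e" "e \<ge> 0"
      using enstrophy_finite by (cases "\<integral>\<^sup>+x. ?w m x \<partial>lborel") (auto simp: top_unique)
    have d: "e - \<theta> * E > 0" using gt e \<theta> E by (auto simp: not_le ennreal_less_iff)
    obtain i0 where i0: "recip_integral \<xi> m = ennreal i0" "i0 \<ge> 0"
      using recip_integral_finite[OF \<xi> m] by (cases "recip_integral \<xi> m") auto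
    have "eventually (\<lambda>l. l \<in> {0<..<m}) (at_right 0)" by (rule eventually_at_right_real) fact
    \<comment> \<open>The threshold is the value of the integral from l beyond which the bound
      contradicts e > \<theta> E.\<close>
    then have "eventually (\<lambda>l. 0 < l \<and> l < m \<and> ennreal ((i0 + 1) * e / (e - \<theta> * E)) < recip_integral \<xi> l) (at_right 0)"
      using recip_integral_unbounded[OF \<xi>, of "(i0 + 1) * e / (e - \<theta> * E)"] by eventually_elim auto
    from frequently_eventually_conj[OF small this]
    obtain l where l: "0 < l" "l < m" "ennreal ((i0 + 1) * e / (e - \<theta> * E)) < recip_integral \<xi> l"
      "(\<integral>\<^sup>+x. ennreal (stretching x / \<xi> \<bar>Q x\<bar>) * indicator {x. \<bar>Q x\<bar> > l} x \<partial>lborel) \<le> ennreal \<theta> * recip_integral \<xi> l * enstrophy"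
      by (auto dest!: frequently_ex)
    obtain i where i: "recip_integral \<xi> l = ennreal i" "i \<ge> 0"
      using recip_integral_finite[OF \<xi> l(1)] by (cases "recip_integral \<xi> l") auto
    have "ennreal i * ennreal e \<le> (ennreal i0 + 1) * ennreal e + ennreal \<theta> * ennreal i * ennreal E"
      using order_trans[OF enstrophy_superlevel_bound[OF \<xi> l(1,2)] add_left_mono[OF l(4)]]
      by (simp add: e i i0 E)
    then have "ennreal (i * e) \<le> ennreal ((i0 + 1) * e + \<theta> * i * E)"
      using e i i0 E \<theta> by (simp add: ennreal_mult ennreal_plus)
    then have "i * e \<le> (i0 + 1) * e + \<theta> * i * E"
      using e i i0 E \<theta> by (subst (asm) ennreal_le_iff) auto
    then have "i * (e - \<theta> * E) \<le> (i0 + 1) * e" by (simp add: algebra_simps)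
    then have "i \<le> (i0 + 1) * e / (e - \<theta> * E)" using d by (simp add: le_divide_eq)
    moreover have "(i0 + 1) * e / (e - \<theta> * E) < i"
      using l(3) i i0 e d by (subst (asm) i(1), subst (asm) ennreal_less_iff) auto
    ultimately show False by simp
  qed
  have "enstrophy = (\<integral>\<^sup>+x. liminf (\<lambda>n. ?w (inverse (real (Suc n))) x) \<partial>lborel)"
    unfolding enstrophy_def
  proof (rule nn_integral_cong)
    fix x
    have "(\<lambda>n. ?w (inverse (real (Suc n))) x) \<longlonglongrightarrow> ennreal ((norm (curl u x))\<^sup>2)"
    \<comment> \<open>The superlevel sets never capture {Q = 0}, but omega vanishes there.\<close>
    proof (cases "Q x = 0")
      case True
      then show ?thesis using vorticity_eq_0_if_head_pressure_eq_0 by simp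
    next
      case False
      then obtain N where N: "inverse (real (Suc N)) < \<bar>Q x\<bar>" using reals_Archimedean[of "\<bar>Q x\<bar>"] by auto
      have "eventually (\<lambda>n. ?w (inverse (real (Suc n))) x = ennreal ((norm (curl u x))\<^sup>2)) sequentially"
        using eventually_ge_at_top[of N]
      proof eventually_elim
        case (elim n)
        then have "inverse (real (Suc n)) \<le> inverse (real (Suc N))" by (intro le_imp_inverse_le) auto
        then have "inverse (real (Suc n)) < \<bar>Q x\<bar>" using N by linarith
        then show ?case by (simp del: of_nat_Suc)
      qed
      then show ?thesis by (rule tendsto_eventually)
    qed
    then show "ennreal ((norm (curl u x))\<^sup>2) = liminf (\<lambda>n. ?w (inverse (real (Suc n))) x)"
      by (rule lim_imp_Liminf[symmetric, rotated]) simp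
  qed
  also have "\<dots> \<le> liminf (\<lambda>n. \<integral>\<^sup>+x. ?w (inverse (real (Suc n))) x \<partial>lborel)"
    by (rule nn_integral_liminf) measurable
  also have "\<dots> \<le> ennreal (\<theta> * E)"
    using Liminf_mono[of "\<lambda>n. \<integral>\<^sup>+x. ?w (inverse (real (Suc n))) x \<partial>lborel" "\<lambda>_. ennreal (\<theta> * E)" sequentially] le
    by (simp add: Liminf_const)
  finally have "E \<le> \<theta> * E" using E \<theta> by (simp add: ennreal_le_iff)
  then have "E * (1 - \<theta>) \<le> 0" by (simp add: algebra_simps)
  then have "E = 0" using E \<theta> by (simp add: mult_le_0_iff)
  then show "enstrophy = 0" using E by simp
qed

text \<open>\<open>Sobolev_potential\<close> for each component of u. Since {u_j /= 0} lies in {u /=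
  0}, the component Dirichlet integrals sum to at most the one over {u /= 0}, hence to at most the
  enstrophy; the constant stays 16.\<close>

lemma potential_bound:
  fixes V :: "real^3 \<Rightarrow> real"
  assumes [measurable]: "V \<in> borel_measurable borel" and V: "\<And>x. V x \<ge> 0"
  shows "(\<integral>\<^sup>+x. ennreal (V x * (norm (u x))\<^sup>2) \<partial>lborel)
    \<le> ennpowr (\<integral>\<^sup>+x. ennreal (V x powr (3/2)) \<partial>lborel) (2/3) * (16 * enstrophy)"
proof -
  let ?d = "\<lambda>j x. ennreal (\<Sum>i\<in>UNIV. (DU i j x)\<^sup>2) * indicator {x. u x $ j \<noteq> 0} x"
  let ?N = "ennpowr (\<integral>\<^sup>+x. ennreal (V x powr (3/2)) \<partial>lborel) (2/3)"
  have [measurable]: "DU i j \<in> borel_measurable borel" for i j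
    by (intro borel_measurable_continuous_onI smooth_continuous smooth_DU)
  have [measurable]: "U j \<in> borel_measurable borel" for j
    by (intro borel_measurable_continuous_onI smooth_continuous smooth_U)
  have "(\<Sum>j\<in>UNIV. \<integral>\<^sup>+x. ?d j x \<partial>lborel) = (\<integral>\<^sup>+x. (\<Sum>j\<in>UNIV. ?d j x) \<partial>lborel)"
    by (rule nn_integral_sum[symmetric]) measurable
  also have "\<dots> \<le> (\<integral>\<^sup>+x. ennreal (grad_norm_sq u x) * indicator {x. u x \<noteq> 0} x \<partial>lborel)"
  proof (rule nn_integral_mono)
    fix x
    show "(\<Sum>j\<in>UNIV. ?d j x) \<le> ennreal (grad_norm_sq u x) * indicator {x. u x \<noteq> 0} x"
    proof (cases "u x = 0")
      case False
      have "(\<Sum>j\<in>UNIV. ?d j x) \<le> (\<Sum>j\<in>UNIV. ennreal (\<Sum>i\<in>UNIV. (DU i j x)\<^sup>2))"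
        by (intro sum_mono) (auto simp: indicator_def)
      also have "\<dots> = ennreal (\<Sum>j\<in>UNIV. \<Sum>i\<in>UNIV. (DU i j x)\<^sup>2)"
        by (intro sum_ennreal sum_nonneg) simp
      also have "(\<Sum>j\<in>UNIV. \<Sum>i\<in>UNIV. (DU i j x)\<^sup>2) = grad_norm_sq u x"
        by (subst sum.swap) (simp add: grad_norm_sq_u power2_eq_square)
      finally show ?thesis using False by simp
    qed simp
  qed
  also have "\<dots> \<le> enstrophy" unfolding enstrophy_def by (rule dirichlet_le_enstrophy)
  finally have sum_le: "(\<Sum>j\<in>UNIV. \<integral>\<^sup>+x. ?d j x \<partial>lborel) \<le> enstrophy" .
  have each: "(\<integral>\<^sup>+x. ennreal (V x * (u x $ j)\<^sup>2) \<partial>lborel) \<le> ?N * (16 * (\<integral>\<^sup>+x. ?d j x \<partial>lborel))" for j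
  proof -
    have "(\<integral>\<^sup>+x. ?d j x \<partial>lborel) \<le> (\<Sum>j\<in>UNIV. \<integral>\<^sup>+x. ?d j x \<partial>lborel)"
      by (rule member_le_sum) auto
    with sum_le have "(\<integral>\<^sup>+x. ?d j x \<partial>lborel) < \<infinity>" using enstrophy_finite by (meson le_less_trans)
    then obtain d where d: "(\<integral>\<^sup>+x. ?d j x \<partial>lborel) = ennreal d" "d \<ge> 0"
      by (cases "\<integral>\<^sup>+x. ?d j x \<partial>lborel") auto
    have lim: "(U j \<longlongrightarrow> 0) at_infinity"
      using tendsto_vec_nth[OF u_infinity, of j] by simp
    have "(\<integral>\<^sup>+x. ennreal (V x * (u x $ j)\<^sup>2) \<partial>lborel) \<le> ?N * ennreal (16 * d)"
    proof (rule Sobolev_potential[OF _ _ lim d(2)])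
      show "U j differentiable at x" for x by (intro smooth_differentiable smooth_U)
      show "continuous_on UNIV (DU i j)" for i by (intro smooth_continuous smooth_DU)
    qed (use d V in auto)
    then show ?thesis using d by (simp add: ennreal_mult)
  qed
  have "(\<integral>\<^sup>+x. ennreal (V x * (norm (u x))\<^sup>2) \<partial>lborel) = (\<integral>\<^sup>+x. (\<Sum>j\<in>UNIV. ennreal (V x * (u x $ j)\<^sup>2)) \<partial>lborel)"
  proof (rule nn_integral_cong)
    fix x
    have "V x * (norm (u x))\<^sup>2 = (\<Sum>j\<in>UNIV. V x * (u x $ j)\<^sup>2)"
      unfolding norm_u_sq by (simp add: sum_distrib_left power2_eq_square)
    then show "ennreal (V x * (norm (u x))\<^sup>2) = (\<Sum>j\<in>UNIV. ennreal (V x * (u x $ j)\<^sup>2))"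
      by (simp add: sum_ennreal V)
  qed
  also have "\<dots> = (\<Sum>j\<in>UNIV. \<integral>\<^sup>+x. ennreal (V x * (u x $ j)\<^sup>2) \<partial>lborel)"
    by (rule nn_integral_sum) measurable
  also have "\<dots> \<le> (\<Sum>j\<in>UNIV. ?N * (16 * (\<integral>\<^sup>+x. ?d j x \<partial>lborel)))"
    by (intro sum_mono each)
  also have "\<dots> = ?N * (16 * (\<Sum>j\<in>UNIV. \<integral>\<^sup>+x. ?d j x \<partial>lborel))"
    by (simp add: sum_distrib_left)
  also have "\<dots> \<le> ?N * (16 * enstrophy)"
    by (intro mult_left_mono sum_le) auto
  finally show ?thesis .
qed

section \<open>The two smallness criteria\<close>

lemma measurable_tangential_fields [measurable]:
  "u_tan u p \<in> borel_measurable borel" "vort_tan u p \<in> borel_measurable borel"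
  "tan_angle u p \<in> borel_measurable borel"
proof -
  have n [measurable]: "normal_dir Q \<in> borel_measurable borel"
    unfolding normal_dir_def[abs_def] by measurable
  show u [measurable]: "u_tan u p \<in> borel_measurable borel"
    unfolding u_tan_def tangential_def[abs_def] by measurable
  show w [measurable]: "vort_tan u p \<in> borel_measurable borel"
    unfolding vort_tan_def tangential_def[abs_def] by measurable
  show "tan_angle u p \<in> borel_measurable borel"
    unfolding tan_angle_def[abs_def] by measurable
qed

lemma superlevel_sets [measurable]: "superlevel u p l \<in> sets borel"
  unfolding superlevel_def by measurable

text \<open>The factor |omega_T|^2 of \<open>stretching\<close> is at most |omega|^2; the remaining
  factor is bounded by its essential supremum.\<close>

lemma stretching_Linf_bound:
  assumes \<xi>: "admissible_modulus \<xi>" and l: "l > 0"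
  shows "(\<integral>\<^sup>+x. ennreal (stretching x / \<xi> \<bar>Q x\<bar>) * indicator {x. \<bar>Q x\<bar> > l} x \<partial>lborel)
    \<le> Linf_norm (superlevel u p l) (\<lambda>x. (norm (u_tan u p x))\<^sup>2 * (tan_angle u p x)\<^sup>2 / \<xi> \<bar>Q x\<bar>) * enstrophy"
proof -
  define f where "f x = (norm (u_tan u p x))\<^sup>2 * (tan_angle u p x)\<^sup>2 / \<xi> \<bar>Q x\<bar>" for x
  let ?N = "Linf_norm (superlevel u p l) f"
  have f0: "f x \<ge> 0" for x using modulus_nonneg[OF \<xi>, of "\<bar>Q x\<bar>"] by (simp add: f_def)
  have "AE x in lebesgue_on (superlevel u p l). ennreal \<bar>f x\<bar> \<le> ?N"
    unfolding Linf_norm_def by (rule esssup_AE)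
  then have "AE x in lebesgue. x \<in> superlevel u p l \<longrightarrow> ennreal \<bar>f x\<bar> \<le> ?N"
    by (subst (asm) AE_restrict_space_iff) auto
  then have "AE x in lebesgue. ennreal (stretching x / \<xi> \<bar>Q x\<bar>) * indicator {x. \<bar>Q x\<bar> > l} x \<le> ?N * ennreal ((norm (curl u x))\<^sup>2)"
  proof eventually_elim
    case (elim x)
    show ?case
    proof (cases "\<bar>Q x\<bar> > l")
      case True
      have "stretching x / \<xi> \<bar>Q x\<bar> = f x * (norm (vort_tan u p x))\<^sup>2"
        by (simp add: stretching_eq f_def)
      also have "\<dots> \<le> f x * (norm (curl u x))\<^sup>2"
        by (intro mult_left_mono power_mono f0) (auto simp: vort_tan_def norm_tangential_le)
      finally have "ennreal (stretching x / \<xi> \<bar>Q x\<bar>) \<le> ennreal (f x) * ennreal ((norm (curl u x))\<^sup>2)"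
        using f0 by (simp add: ennreal_leI flip: ennreal_mult)
      also have "\<dots> \<le> ?N * ennreal ((norm (curl u x))\<^sup>2)"
        using elim True f0[of x] by (intro mult_right_mono) (auto simp: superlevel_def)
      finally show ?thesis using True by simp
    qed simp
  qed
  from nn_integral_mono_AE[OF this]
  have "(\<integral>\<^sup>+x. ennreal (stretching x / \<xi> \<bar>Q x\<bar>) * indicator {x. \<bar>Q x\<bar> > l} x \<partial>lborel) \<le> (\<integral>\<^sup>+x. ?N * ennreal ((norm (curl u x))\<^sup>2) \<partial>lborel)"
    \<comment> \<open>The norm refers to the completed measure, the enstrophy to
      \<open>lborel\<close>.\<close>
    by (simp only: nn_integral_completion)
  also have "\<dots> = ?N * enstrophy"
    unfolding enstrophy_def by (rule nn_integral_cmult) measurable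
  finally show ?thesis unfolding f_def .
qed

text \<open>Here |u_T|^2 is bounded by |u|^2, and the rest, cut off to the superlevel set, is the
  potential V of \<open>potential_bound\<close>.\<close>

lemma stretching_Lp_bound:
  assumes \<xi>: "admissible_modulus \<xi>" and l: "l > 0"
  shows "(\<integral>\<^sup>+x. ennreal (stretching x / \<xi> \<bar>Q x\<bar>) * indicator {x. \<bar>Q x\<bar> > l} x \<partial>lborel)
    \<le> Lp_norm (3/2) (superlevel u p l) (\<lambda>x. (norm (vort_tan u p x))\<^sup>2 * (tan_angle u p x)\<^sup>2 / \<xi> \<bar>Q x\<bar>)
      * (16 * enstrophy)"
proof -
  note [measurable] = measurable_modulus_abs[OF \<xi>]
  define f where "f x = (norm (vort_tan u p x))\<^sup>2 * (tan_angle u p x)\<^sup>2 / \<xi> \<bar>Q x\<bar>" for x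
  define V where "V x = f x * indicator {x. \<bar>Q x\<bar> > l} x" for x
  have f0: "f x \<ge> 0" for x using modulus_nonneg[OF \<xi>, of "\<bar>Q x\<bar>"] by (simp add: f_def)
  have V0: "V x \<ge> 0" for x using f0 by (simp add: V_def)
  have [measurable]: "V \<in> borel_measurable borel" unfolding V_def f_def by measurable
  have "Lp_norm (3/2) (superlevel u p l) f
      = ennpowr (\<integral>\<^sup>+x. ennreal (\<bar>f x\<bar> powr (3/2)) * indicator (superlevel u p l) x \<partial>lebesgue) (2/3)"
    unfolding Lp_norm_def by (subst nn_integral_restrict_space) auto
  also have "(\<lambda>x. ennreal (\<bar>f x\<bar> powr (3/2)) * indicator (superlevel u p l) x) = (\<lambda>x. ennreal (V x powr (3/2)))"
    using f0 by (auto simp: fun_eq_iff V_def superlevel_def indicator_def)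
  finally have N: "Lp_norm (3/2) (superlevel u p l) f = ennpowr (\<integral>\<^sup>+x. ennreal (V x powr (3/2)) \<partial>lborel) (2/3)"
    by (simp only: nn_integral_completion)
  have "(\<integral>\<^sup>+x. ennreal (stretching x / \<xi> \<bar>Q x\<bar>) * indicator {x. \<bar>Q x\<bar> > l} x \<partial>lborel)
      \<le> (\<integral>\<^sup>+x. ennreal (V x * (norm (u x))\<^sup>2) \<partial>lborel)"
  proof (rule nn_integral_mono)
    fix x
    have "stretching x / \<xi> \<bar>Q x\<bar> = f x * (norm (u_tan u p x))\<^sup>2"
      by (simp add: stretching_eq f_def)
    also have "\<dots> \<le> f x * (norm (u x))\<^sup>2"
      by (intro mult_left_mono power_mono f0) (auto simp: u_tan_def norm_tangential_le)
    finally show "ennreal (stretching x / \<xi> \<bar>Q x\<bar>) * indicator {x. \<bar>Q x\<bar> > l} x \<le> ennreal (V x * (norm (u x))\<^sup>2)"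
      by (auto simp: V_def indicator_def intro!: ennreal_leI)
  qed
  also have "\<dots> \<le> Lp_norm (3/2) (superlevel u p l) f * (16 * enstrophy)"
    unfolding N by (rule potential_bound) (auto simp: V0)
  finally show ?thesis unfolding f_def .
qed

text \<open>Common end of both criteria: K = 1 for the supremum norm, K = 16 for the L^(3/2) norm. A
  limit inferior below 1/K supplies r < 1/K that bounds the quotient frequently, and \<theta> = r
  K.\<close>

lemma zero_velocity_if_Liminf_less:
  fixes N :: "real \<Rightarrow> ennreal"
  assumes \<xi>: "admissible_modulus \<xi>" and K: "K > 0"
    and lim: "Liminf (at_right 0) (\<lambda>l. inverse (recip_integral \<xi> l) * N l) < ennreal (1 / K)"
    and N: "\<And>l. l > 0 \<Longrightarrow> (\<integral>\<^sup>+x. ennreal (stretching x / \<xi> \<bar>Q x\<bar>) * indicator {x. \<bar>Q x\<bar> > l} x \<partial>lborel)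
      \<le> N l * (ennreal K * enstrophy)"
  shows "u x = 0"
proof -
  from lim obtain y where y: "y < ennreal (1 / K)"
      "frequently (\<lambda>l. inverse (recip_integral \<xi> l) * N l \<le> y) (at_right 0)"
    unfolding not_le[symmetric] le_Liminf_iff by (auto simp: frequently_def not_le)
  then obtain r where r: "y = ennreal r" "r \<ge> 0" by (cases y) auto
  have "r < 1 / K" using y(1) r by (simp add: ennreal_less_iff)
  then have \<theta>: "0 \<le> r * K" "r * K < 1" using K r by (auto simp: field_simps)
  have "eventually (\<lambda>l::real. l > 0) (at_right 0)" by (simp add: eventually_at_right_less)
  \<comment> \<open>The integral must be nonzero and finite to cancel against its inverse in
    \<open>ennreal\<close>; for l >= 1 it is 0.\<close>
  then have "eventually (\<lambda>l. l > 0 \<and> ennreal 1 < recip_integral \<xi> l) (at_right 0)"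
    using recip_integral_unbounded[OF \<xi>, of 1] by eventually_elim auto
  from frequently_eventually_conj[OF y(2) this]
  have "frequently (\<lambda>l. (\<integral>\<^sup>+x. ennreal (stretching x / \<xi> \<bar>Q x\<bar>) * indicator {x. \<bar>Q x\<bar> > l} x \<partial>lborel)
      \<le> ennreal (r * K) * recip_integral \<xi> l * enstrophy) (at_right 0)"
  proof (rule frequently_elim1)
    fix l assume l: "(l > 0 \<and> ennreal 1 < recip_integral \<xi> l) \<and> inverse (recip_integral \<xi> l) * N l \<le> y"
    then obtain i where i: "recip_integral \<xi> l = ennreal i" "i > 1"
      using recip_integral_finite[OF \<xi>, of l] by (cases "recip_integral \<xi> l") (auto simp: ennreal_less_iff)
    have "N l = recip_integral \<xi> l * (inverse (recip_integral \<xi> l) * N l)"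
      using i by (simp add: inverse_ennreal flip: mult.assoc ennreal_mult)
    also have "\<dots> \<le> recip_integral \<xi> l * y" using l by (intro mult_left_mono) auto
    finally have "N l * (ennreal K * enstrophy) \<le> (recip_integral \<xi> l * ennreal r) * (ennreal K * enstrophy)"
      unfolding r by (intro mult_right_mono) auto
    also have "\<dots> = ennreal (r * K) * recip_integral \<xi> l * enstrophy"
      using r K by (simp add: ennreal_mult ac_simps)
    finally show "(\<integral>\<^sup>+x. ennreal (stretching x / \<xi> \<bar>Q x\<bar>) * indicator {x. \<bar>Q x\<bar> > l} x \<partial>lborel)
      \<le> ennreal (r * K) * recip_integral \<xi> l * enstrophy"
      using N[of l] l by (meson order_trans)
  qed
  from zero_velocity_if_stretching_small[OF \<xi> \<theta> this] show ?thesis .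
qed

end

theorem theorem1p1:
  shows "\<exists>c::real. c > 0 \<and>
    (\<forall>(u :: real^3 \<Rightarrow> real^3) (p :: real^3 \<Rightarrow> real) (\<xi> :: real \<Rightarrow> real).
      smooth_stationary_NS u p \<longrightarrow>
      (u \<longlongrightarrow> 0) at_infinity \<longrightarrow>
      (\<integral>\<^sup>+x. ennreal (grad_norm_sq u x) \<partial>lborel) < \<infinity> \<longrightarrow>
      (head_pressure u p \<longlongrightarrow> 0) at_infinity \<longrightarrow>
      admissible_modulus \<xi> \<longrightarrow>
      (Liminf (at_right 0) (\<lambda>l. inverse (recip_integral \<xi> l) *
          Linf_norm (superlevel u p l)
            (\<lambda>x. (norm (u_tan u p x))\<^sup>2 * (tan_angle u p x)\<^sup>2 / \<xi> \<bar>head_pressure u p x\<bar>)) < 1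
       \<or>
       Liminf (at_right 0) (\<lambda>l. inverse (recip_integral \<xi> l) *
          Lp_norm (3/2) (superlevel u p l)
            (\<lambda>x. (norm (vort_tan u p x))\<^sup>2 * (tan_angle u p x)\<^sup>2 / \<xi> \<bar>head_pressure u p x\<bar>))
         < ennreal c) \<longrightarrow>
      (\<forall>x. u x = 0))"
\<comment> \<open>The reciprocal of the factor 16 in \<open>stretching_Lp_bound\<close>, which goes
  back to 4096 = 16^3 in \<open>Sobolev_truncated\<close>.\<close>
proof (intro exI[of _ "1/16"] conjI allI impI)
  fix u :: "real^3 \<Rightarrow> real^3" and p :: "real^3 \<Rightarrow> real" and \<xi> :: "real \<Rightarrow> real" and x
  assume NS: "smooth_stationary_NS u p" "(u \<longlongrightarrow> 0) at_infinity"
      "(\<integral>\<^sup>+x. ennreal (grad_norm_sq u x) \<partial>lborel) < \<infinity>" "(head_pressure u p \<longlongrightarrow> 0) at_infinity"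
    and \<xi>: "admissible_modulus \<xi>"
    and small: "Liminf (at_right 0) (\<lambda>l. inverse (recip_integral \<xi> l) *
          Linf_norm (superlevel u p l)
            (\<lambda>x. (norm (u_tan u p x))\<^sup>2 * (tan_angle u p x)\<^sup>2 / \<xi> \<bar>head_pressure u p x\<bar>)) < 1
       \<or>
       Liminf (at_right 0) (\<lambda>l. inverse (recip_integral \<xi> l) *
          Lp_norm (3/2) (superlevel u p l)
            (\<lambda>x. (norm (vort_tan u p x))\<^sup>2 * (tan_angle u p x)\<^sup>2 / \<xi> \<bar>head_pressure u p x\<bar>))
         < ennreal (1/16)"
  interpret decaying_NS u p by unfold_locales (rule NS)+
  from small show "u x = 0"
  proof
    assume "Liminf (at_right 0) (\<lambda>l. inverse (recip_integral \<xi> l) *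
          Linf_norm (superlevel u p l)
            (\<lambda>x. (norm (u_tan u p x))\<^sup>2 * (tan_angle u p x)\<^sup>2 / \<xi> \<bar>head_pressure u p x\<bar>)) < 1"
    then show ?thesis
      using zero_velocity_if_Liminf_less[OF \<xi> zero_less_one] stretching_Linf_bound[OF \<xi>] by simp
  next
    assume "Liminf (at_right 0) (\<lambda>l. inverse (recip_integral \<xi> l) *
          Lp_norm (3/2) (superlevel u p l)
            (\<lambda>x. (norm (vort_tan u p x))\<^sup>2 * (tan_angle u p x)\<^sup>2 / \<xi> \<bar>head_pressure u p x\<bar>))
         < ennreal (1/16)"
    then show ?thesis
      using zero_velocity_if_Liminf_less[OF \<xi>, where K=16] stretching_Lp_bound[OF \<xi>] by simp
  qed
qed simp

end
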